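(* Let $d\ge 1$ and $p\ge 1$ be integers, let $\alpha>0$, and let $\omega\in C^0([0,1]^d)$ satisfy $\omega(\boldsymbol{x})>0$ for all $\boldsymbol{x}\in[0,1]^d$; all of these are fixed. Consider a family of tensor-product B-spline bases $\{\widehat B_i\}_{i=1}^{N_{\mathrm{dof}}}$ of degree $p$ on $[0,1]^d$, built from open knot vectors that are quasi-uniform with constant $\alpha$, with maximal mesh-size $h\to 0$. Let $$[\mathbf{M}]_{i,j}=\int_{(0,1)^d}\widehat B_i(\boldsymbol{x})\,\widehat B_j(\boldsymbol{x})\,\omega(\boldsymbol{x})\,d\boldsymbol{x},\qquad [\widehat{\mathbf{M}}]_{i,j}=\int_{(0,1)^d}\widehat B_i(\boldsymbol{x})\,\widehat B_j(\boldsymbol{x})\,d\boldsymbol{x},$$ let $\mathbf{D}=\mathrm{diag}(\mathbf{M})$ and $\widehat{\mathbf{D}}=\mathrm{diag}(\widehat{\mathbf{M}})$ be the diagonal matrices formed by the diagonals of $\mathbf{M}$ and $\widehat{\mathbf{M}}$, and define $$\boldsymbol{\mathcal{M}}=\mathbf{D}^{\frac12}\widehat{\mathbf{D}}^{-\frac12}\,\widehat{\mathbf{M}}\,\widehat{\mathbf{D}}^{-\frac12}\mathbf{D}^{\frac12}.$$ Then $$\lim_{h\to 0}\kappa\left(\boldsymbol{\mathcal{M}}^{-\frac12}\,\mathbf{M}\,\boldsymbol{\mathcal{M}}^{-\frac12}\right)=1 .$$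
   Context: For each direction $k=1,\dots,d$, $\Xi_k=\{\xi_{k,1}\le\dots\le\xi_{k,m+p+1}\}$ is an open knot vector: $0=\xi_{k,1}=\dots=\xi_{k,p+1}<\xi_{k,p+2}\le\dots\le\xi_{k,m}<\xi_{k,m+1}=\dots=\xi_{k,m+p+1}=1$, with interior knots repeated at most $p$ times. The univariate B-splines $\widehat b_{i,p}$, $i=1,\dots,m$, are defined on each $\Xi_k$ by the Cox–De Boor recursion, and the $d$-variate B-splines are the products $\widehat B_{\mathbf{i}}(\zeta)=\prod_{k=1}^d \widehat b[\Xi_{k}]_{i_k,p}(\zeta_k)$ for $\mathbf{i}\in\mathbf{I}=\{1,\dots,m\}^d$; they are reordered co-lexicographically as $\widehat B_1,\dots,\widehat B_{N_{\mathrm{dof}}}$, $N_{\mathrm{dof}}=m^d$. The mesh-size $h$ is the maximal length $\xi_{k,i+1}-\xi_{k,i}$ over all $k$ and $i$. Quasi-uniformity with constant $\alpha>0$ ($\alpha$ independent of $h$) means every nonempty knot span satisfies $\alpha h\le \xi_{k,i+1}-\xi_{k,i}$. For a symmetric positive definite matrix $\mathbf{A}$, $\kappa(\mathbf{A})=\lambda_{\max}(\mathbf{A})/\lambda_{\min}(\mathbf{A})$. $\boldsymbol{\mathcal{M}}^{-1/2}$ is the inverse of the symmetric positive definite square root of $\boldsymbol{\mathcal{M}}$. The limit is understood over the whole class: for every $\varepsilon>0$ there is $h_0>0$ such that for every $m$ and every choice of open knot vectors $\Xi_1,\dots,\Xi_d$ on $[0,1]$ for degree $p$, each with $m+p+1$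 knots, with first and last knots $0$ and $1$ repeated exactly $p+1$ times, with interior knots repeated at most $p$ times, and quasi-uniform with constant $\alpha$ (with the fixed $d,p,\alpha$) with $h<h_0$, the condition number differs from $1$ by less than $\varepsilon$. *)

theory Defs
  imports "HOL-Analysis.Analysis" "Jordan_Normal_Form.Spectral_Radius"
begin

text \<open>Points of the \<open>d\<close>-dimensional cube are functions \<open>nat \<Rightarrow> real\<close> in the extensional product over
  the directions \<open>{1..d}\<close>, with the product topology and the product Lebesgue measure.
  Knots, B-splines and directions are numbered from 1; rows and columns of matrices from 0.\<close>

definition unit_cube :: "nat \<Rightarrow> (nat \<Rightarrow> real) set" where
  "unit_cube d = PiE {1..d} (\<lambda>_. {0..1})"

definition open_unit_cube :: "nat \<Rightarrow> (nat \<Rightarrow> real) set" where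
  "open_unit_cube d = PiE {1..d} (\<lambda>_. {0<..<1})"

text \<open>Only the values \<open>\<xi> 1, \<dots>, \<xi> (m + p + 1)\<close> matter. The conditions force \<open>m \<ge> p + 1\<close>;
  the last one bounds the multiplicity of every interior knot by \<open>p\<close>.\<close>

definition open_knot_vector :: "nat \<Rightarrow> nat \<Rightarrow> (nat \<Rightarrow> real) \<Rightarrow> bool" where
  "open_knot_vector m p \<xi> \<longleftrightarrow>
     (\<forall>i\<in>{1..m+p}. \<xi> i \<le> \<xi> (i+1)) \<and>
     (\<forall>i\<in>{1..p+1}. \<xi> i = 0) \<and> 0 < \<xi> (p+2) \<and>
     \<xi> m < 1 \<and> (\<forall>i\<in>{m+1..m+p+1}. \<xi> i = 1) \<and>
     (\<forall>i\<in>{p+2..m}. card {j\<in>{p+2..m}. \<xi> j = \<xi> i} \<le> p)"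

definition mesh_size :: "nat \<Rightarrow> nat \<Rightarrow> nat \<Rightarrow> (nat \<Rightarrow> nat \<Rightarrow> real) \<Rightarrow> real" where
  "mesh_size d p m \<Xi> = Max ((\<lambda>(k,i). \<Xi> k (i+1) - \<Xi> k i) ` ({1..d} \<times> {1..m+p}))"

definition quasi_uniform :: "real \<Rightarrow> nat \<Rightarrow> nat \<Rightarrow> nat \<Rightarrow> (nat \<Rightarrow> nat \<Rightarrow> real) \<Rightarrow> bool" where
  "quasi_uniform \<alpha> d p m \<Xi> \<longleftrightarrow>
     (\<forall>k\<in>{1..d}. \<forall>i\<in>{1..m+p}. \<Xi> k i < \<Xi> k (i+1) \<longrightarrow>
        \<alpha> * mesh_size d p m \<Xi> \<le> \<Xi> k (i+1) - \<Xi> k i)"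

text \<open>Cox--De Boor recursion; the usual convention that a quotient with zero denominator is zero
  is built into division.\<close>

fun bspline :: "(nat \<Rightarrow> real) \<Rightarrow> nat \<Rightarrow> nat \<Rightarrow> real \<Rightarrow> real" where
  "bspline \<xi> 0 i x = (if \<xi> i \<le> x \<and> x < \<xi> (i+1) then 1 else 0)"
| "bspline \<xi> (Suc q) i x =
     (x - \<xi> i) / (\<xi> (i+q+1) - \<xi> i) * bspline \<xi> q i x +
     (\<xi> (i+q+2) - x) / (\<xi> (i+q+2) - \<xi> (i+1)) * bspline \<xi> q (i+1) x"

text \<open>The multi-index in \<open>{1..m}\<^sup>d\<close> at position \<open>j \<in> {0..<m^d}\<close> of the co-lexicographic
  order, in which the index of direction 1 varies fastest.\<close>

definition multi_index :: "nat \<Rightarrow> nat \<Rightarrow> nat \<Rightarrow> nat" where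
  "multi_index m j k = (j div m^(k-1)) mod m + 1"

definition tensor_bspline ::
  "nat \<Rightarrow> nat \<Rightarrow> nat \<Rightarrow> (nat \<Rightarrow> nat \<Rightarrow> real) \<Rightarrow> nat \<Rightarrow> (nat \<Rightarrow> real) \<Rightarrow> real" where
  "tensor_bspline d p m \<Xi> j x = (\<Prod>k\<in>{1..d}. bspline (\<Xi> k) p (multi_index m j k) (x k))"

definition mass_matrix ::
  "nat \<Rightarrow> nat \<Rightarrow> nat \<Rightarrow> (nat \<Rightarrow> nat \<Rightarrow> real) \<Rightarrow> ((nat \<Rightarrow> real) \<Rightarrow> real) \<Rightarrow> real mat" where
  "mass_matrix d p m \<Xi> \<omega> = Matrix.mat (m^d) (m^d) (\<lambda>(i,j).
     set_lebesgue_integral (PiM {1..d} (\<lambda>_. lborel)) (open_unit_cube d)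
       (\<lambda>x. tensor_bspline d p m \<Xi> i x * tensor_bspline d p m \<Xi> j x * \<omega> x))"

definition diag_part :: "real mat \<Rightarrow> real mat" where
  "diag_part A = mat_diag (dim_row A) (\<lambda>i. A $$ (i,i))"

definition spd :: "nat \<Rightarrow> real mat \<Rightarrow> bool" where
  "spd n A \<longleftrightarrow> A \<in> carrier_mat n n \<and> transpose_mat A = A \<and>
     (\<forall>v\<in>carrier_vec n. v \<noteq> 0\<^sub>v n \<longrightarrow> 0 < scalar_prod v (A *\<^sub>v v))"

definition spd_sqrt :: "real mat \<Rightarrow> real mat" where
  "spd_sqrt A = (THE S. spd (dim_row A) S \<and> S * S = A)"

definition spd_inv_sqrt :: "real mat \<Rightarrow> real mat" where
  "spd_inv_sqrt A = the (mat_inverse (spd_sqrt A))"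

text \<open>Only meant for symmetric positive definite matrices, whose eigenvalues are all real.\<close>

definition cond_number :: "real mat \<Rightarrow> real" where
  "cond_number A = Max (spectrum A) / Min (spectrum A)"

definition precond_matrix ::
  "nat \<Rightarrow> nat \<Rightarrow> nat \<Rightarrow> (nat \<Rightarrow> nat \<Rightarrow> real) \<Rightarrow> ((nat \<Rightarrow> real) \<Rightarrow> real) \<Rightarrow> real mat" where
  "precond_matrix d p m \<Xi> \<omega> =
     (let M = mass_matrix d p m \<Xi> \<omega>; M_hat = mass_matrix d p m \<Xi> (\<lambda>_. 1);
          D = diag_part M; D_hat = diag_part M_hat
      in spd_sqrt D * spd_inv_sqrt D_hat * M_hat * spd_inv_sqrt D_hat * spd_sqrt D)"

end

theory Submission
  imports Defs
begin

text \<open>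
  Write \<open>G\<^sub>c = \<Sum>\<^sub>i c\<^sub>i B\<^sub>i\<close> for the spline with coefficients \<open>c\<close>, \<open>\<M>\<close> for the preconditioner and
  \<open>s\<^sub>i\<^sup>2 = \<integral>\<omega> B\<^sub>i\<^sup>2 / \<integral>B\<^sub>i\<^sup>2\<close> for the squared diagonal entries of \<open>D\<^sup>1\<^sup>/\<^sup>2 D_hat\<^sup>-\<^sup>1\<^sup>/\<^sup>2\<close>. The eigenvalues
  in question are Rayleigh quotients of \<open>v\<^sup>T M v = \<integral>\<omega> G\<^sub>v\<^sup>2\<close> against \<open>v\<^sup>T \<M> v = \<integral>G\<^sub>s\<^sub>v\<^sup>2\<close>. The entries of
  \<open>M - \<M>\<close> are \<open>\<integral>B\<^sub>i B\<^sub>j (\<omega> - s\<^sub>i s\<^sub>j)\<close>. Now \<open>s\<^sub>i\<^sup>2\<close> is a mean of \<open>\<omega>\<close> over the support of \<open>B\<^sub>i\<close>, a box whose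
  sides are at most \<open>(p + 1) h\<close>. So if \<open>\<omega>\<close> varies by at most \<open>\<delta>\<close> on such boxes, then \<open>s\<^sub>i s\<^sub>j\<close>, which lies
  between \<open>s\<^sub>i\<^sup>2\<close> and \<open>s\<^sub>j\<^sup>2\<close>, differs from \<open>\<omega>\<close> by at most \<open>\<delta>\<close> wherever \<open>B\<^sub>i B\<^sub>j\<close> does not vanish. Since at most
  \<open>(p + 1)\<^sup>d\<close> B-splines are nonzero at a point, the two forms differ by at most
  \<open>\<delta> (p + 1)\<^sup>d \<Sum>\<^sub>i v\<^sub>i\<^sup>2 \<integral>B\<^sub>i\<^sup>2\<close>. Uniform continuity of \<open>\<omega>\<close> makes \<open>\<delta>\<close> small with \<open>h\<close>, and the proof is complete as
  soon as the sum is bounded by a constant multiple of \<open>v\<^sup>T M v\<close> (\<open>weighted_norm_perturbation\<close>).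

  Since \<open>\<omega>\<close> has a positive lower bound, this follows from the stability of the B-spline basis in the
  square norm (\<open>l2_stability\<close>), with a constant
  depending only on \<open>d\<close>, \<open>p\<close>, \<open>\<alpha>\<close> and not on the knots. It comes from functions dual to the B-splines that are
  supported where the B-spline is and have size \<open>O(1/h)\<close> in each direction. In one variable
  (\<open>bspline_local_dual\<close>) Marsden's identity on a nonempty knot span, rescaled to \<open>[0,1]\<close>, writes each monomial
  of degree at most \<open>p\<close> as a combination of the \<open>p + 1\<close> active B-splines, with coefficients that are bounded
  because quasi-uniformity keeps the rescaled knots bounded. The matrix of these coefficients is
  square, so its right inverse, formed by the polynomial coefficients of the B-splines, is also its left
  inverse: the B-spline coefficients of a spline are bounded combinations of the monomial coefficients on the span,
  and those are read off by fixed functions dual to the monomials.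
  Products of dual functions are dual to products of B-splines, and the Cauchy-Schwarz inequality turns
  them into the stability bound.

  The statement speaks of square roots of matrices. They exist by the spectral theorem, proved by deflation
  with Householder reflections, and are unique by a trace argument; both together reduce the condition
  number to Rayleigh quotients (\<open>cond_number_preconditioned\<close>).
\<close>

unbundle no vec_syntax

section \<open>Spectral theorem for real symmetric matrices\<close>

lemma symmetric_mat_adjoint:
  fixes A :: "real mat"
  assumes A: "A \<in> carrier_mat n n" and sym: "transpose_mat A = A"
    and u: "u \<in> carrier_vec n" and v: "v \<in> carrier_vec n"
  shows "u \<bullet> (A *\<^sub>v v) = (A *\<^sub>v u) \<bullet> v"
  using transpose_vec_mult_scalar[OF A v u] sym by simp

lemma scalar_prod_self_nonneg: "0 \<le> (v :: real vec) \<bullet> v"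
  unfolding scalar_prod_def by (intro sum_nonneg) auto

lemma scalar_prod_self_eq_0_iff:
  fixes v :: "real vec"
  assumes "v \<in> carrier_vec n"
  shows "v \<bullet> v = 0 \<longleftrightarrow> v = 0\<^sub>v n"
proof
  assume "v \<bullet> v = 0"
  hence "\<forall>i\<in>{0..<dim_vec v}. v $ i * v $ i = 0"
    unfolding scalar_prod_def by (subst (asm) sum_nonneg_eq_0_iff) auto
  thus "v = 0\<^sub>v n" using assms by (intro eq_vecI) auto
qed (use assms in auto)

text \<open>
  Take a complex eigenvector \<open>x + \<i> y\<close> for \<open>k\<close>. Comparing \<open>x \<bullet> A y\<close> with \<open>A x \<bullet> y\<close> gives
  \<open>Im k (x \<bullet> x + y \<bullet> y) = 0\<close>, so \<open>k\<close> is real and one of \<open>x\<close>, \<open>y\<close> is a real eigenvector.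
\<close>

lemma symmetric_mat_real_eigenvector:
  fixes A :: "real mat"
  assumes A: "A \<in> carrier_mat n n" and sym: "transpose_mat A = A" and n: "0 < n"
  obtains v l where "v \<in> carrier_vec n" "v \<noteq> 0\<^sub>v n" "A *\<^sub>v v = l \<cdot>\<^sub>v v"
proof -
  define C where "C = map_mat complex_of_real A"
  have C: "C \<in> carrier_mat n n" using A by (simp add: C_def)
  from spectrum_non_empty[OF C n] obtain k v where v: "v \<in> carrier_vec n" "v \<noteq> 0\<^sub>v n"
      and ev: "C *\<^sub>v v = k \<cdot>\<^sub>v v"
    using C unfolding spectrum_def eigenvalue_def eigenvector_def by auto
  define x where "x = map_vec Re v"
  define y where "y = map_vec Im v"
  have x: "x \<in> carrier_vec n" and y: "y \<in> carrier_vec n" using v by (auto simp: x_def y_def)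
  have Cv: "(C *\<^sub>v v) $ i = (\<Sum>j<n. complex_of_real (A $$ (i,j)) * v $ j)" if "i < n" for i
    using that A v by (auto simp: C_def scalar_prod_def atLeast0LessThan intro!: sum.cong)
  have Av: "(A *\<^sub>v w) $ i = (\<Sum>j<n. A $$ (i,j) * w $ j)" if "i < n" "w \<in> carrier_vec n" for i w
    using that A by (auto simp: scalar_prod_def atLeast0LessThan intro!: sum.cong)
  have kv: "(C *\<^sub>v v) $ i = k * v $ i" if "i < n" for i
    using that v unfolding ev by simp
  have Ax: "A *\<^sub>v x = Re k \<cdot>\<^sub>v x - Im k \<cdot>\<^sub>v y"
  proof (rule eq_vecI)
    fix i assume "i < dim_vec (Re k \<cdot>\<^sub>v x - Im k \<cdot>\<^sub>v y)"
    hence i: "i < n" using x y by simp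
    have "(A *\<^sub>v x) $ i = Re ((C *\<^sub>v v) $ i)"
      using v unfolding Cv[OF i] Av[OF i x] by (auto simp: x_def intro!: sum.cong)
    also have "\<dots> = (Re k \<cdot>\<^sub>v x - Im k \<cdot>\<^sub>v y) $ i"
      unfolding kv[OF i] using i v by (simp add: x_def y_def)
    finally show "(A *\<^sub>v x) $ i = (Re k \<cdot>\<^sub>v x - Im k \<cdot>\<^sub>v y) $ i" .
  qed (use A x y in auto)
  have Ay: "A *\<^sub>v y = Im k \<cdot>\<^sub>v x + Re k \<cdot>\<^sub>v y"
  proof (rule eq_vecI)
    fix i assume "i < dim_vec (Im k \<cdot>\<^sub>v x + Re k \<cdot>\<^sub>v y)"
    hence i: "i < n" using x y by simp
    have "(A *\<^sub>v y) $ i = Im ((C *\<^sub>v v) $ i)"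
      using v unfolding Cv[OF i] Av[OF i y] by (auto simp: y_def intro!: sum.cong)
    also have "\<dots> = (Im k \<cdot>\<^sub>v x + Re k \<cdot>\<^sub>v y) $ i"
      unfolding kv[OF i] using i v by (simp add: x_def y_def)
    finally show "(A *\<^sub>v y) $ i = (Im k \<cdot>\<^sub>v x + Re k \<cdot>\<^sub>v y) $ i" .
  qed (use A x y in auto)
  have xy0: "x \<noteq> 0\<^sub>v n \<or> y \<noteq> 0\<^sub>v n"
  proof (rule ccontr)
    assume "\<not> ?thesis"
    hence "x = 0\<^sub>v n" "y = 0\<^sub>v n" by auto
    hence "v $ i = 0" if "i < n" for i
      using that v unfolding x_def y_def
      by (metis carrier_vecD complex_eqI index_map_vec(1) index_zero_vec(1) zero_complex.simps)
    hence "v = 0\<^sub>v n" using v by (intro eq_vecI) auto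
    with v show False by simp
  qed
  \<comment> \<open>Symmetry of \<open>A\<close> turns the two expansions below into \<open>Im k (x \<bullet> x + y \<bullet> y) = 0\<close>.\<close>
  have "x \<bullet> (A *\<^sub>v y) = (A *\<^sub>v x) \<bullet> y" by (rule symmetric_mat_adjoint[OF A sym x y])
  moreover have "x \<bullet> (A *\<^sub>v y) = Im k * (x \<bullet> x) + Re k * (x \<bullet> y)"
    unfolding Ay using x y by (subst scalar_prod_add_distrib[of _ n]) auto
  moreover have "(A *\<^sub>v x) \<bullet> y = Re k * (x \<bullet> y) - Im k * (y \<bullet> y)"
    unfolding Ax using x y by (subst minus_scalar_prod_distrib[of _ n]) auto
  ultimately have "Im k * (x \<bullet> x + y \<bullet> y) = 0" by (simp add: algebra_simps)
  moreover have "x \<bullet> x + y \<bullet> y \<noteq> 0"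
    using xy0 scalar_prod_self_nonneg[of x] scalar_prod_self_nonneg[of y]
      scalar_prod_self_eq_0_iff[OF x] scalar_prod_self_eq_0_iff[OF y] by force
  ultimately have im: "Im k = 0" by simp
  have "A *\<^sub>v x = Re k \<cdot>\<^sub>v x" "A *\<^sub>v y = Re k \<cdot>\<^sub>v y"
    unfolding Ax Ay im using x y by (auto intro!: eq_vecI)
  thus ?thesis using xy0 x y that by blast
qed

text \<open>
  The reflection in the hyperplane orthogonal to \<open>v - e\<^sub>0\<close> exchanges the unit vectors \<open>v\<close> and \<open>e\<^sub>0\<close>. It is
  its own transpose and inverse, which makes the deflation step below a similarity and a congruence at once.
\<close>

lemma householder_reflection:
  fixes v :: "real vec"
  assumes v: "v \<in> carrier_vec n" and vv: "v \<bullet> v = 1" and n: "0 < n"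
  obtains W where "W \<in> carrier_mat n n" "transpose_mat W = W" "W * W = 1\<^sub>m n"
    "W *\<^sub>v unit_vec n 0 = v"
proof (cases "v = unit_vec n 0")
  case True
  show ?thesis by (rule that[of "1\<^sub>m n"]) (use True in auto)
next
  case False
  define e :: "real vec" where "e = unit_vec n 0"
  have e: "e \<in> carrier_vec n" by (simp add: e_def)
  \<comment> \<open>The normal of the hyperplane that exchanges \<open>v\<close> and \<open>e\<close>.\<close>
  define w where "w = v - e"
  have w: "w \<in> carrier_vec n" using v e by (simp add: w_def)
  have w0: "w \<noteq> 0\<^sub>v n"
  proof
    assume w0: "w = 0\<^sub>v n"
    have "v $ i = e $ i" if "i < n" for i
    proof -
      have "w $ i = 0" using w0 that by simp
      thus ?thesis using that v e by (simp add: w_def)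
    qed
    hence "v = e" using v e by (intro eq_vecI) auto
    with False show False by (simp add: e_def)
  qed
  define g where "g = w \<bullet> w"
  have g: "g \<noteq> 0" using w0 w scalar_prod_self_eq_0_iff by (simp add: g_def)
  have we: "w \<bullet> e = v $ 0 - 1" and g': "g = 2 - 2 * v $ 0"
  proof -
    show "w \<bullet> e = v $ 0 - 1" using v n unfolding w_def e_def by simp
    have "g = v \<bullet> v - v \<bullet> e - (e \<bullet> v - e \<bullet> e)"
      unfolding g_def w_def using v e
      by (simp add: scalar_prod_minus_distrib[of _ n] minus_scalar_prod_distrib[of _ n])
    also have "\<dots> = 2 - 2 * v $ 0" using v vv n by (simp add: e_def)
    finally show "g = 2 - 2 * v $ 0" .
  qed
  define W where "W = Matrix.mat n n (\<lambda>(i,j). (if i = j then 1 else 0) - 2 / g * w $ i * w $ j)"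
  have W: "W \<in> carrier_mat n n" by (simp add: W_def)
  have Wx: "W *\<^sub>v x = x - (2 / g * (w \<bullet> x)) \<cdot>\<^sub>v w" if x: "x \<in> carrier_vec n" for x
  proof (rule eq_vecI)
    fix i assume "i < dim_vec (x - (2 / g * (w \<bullet> x)) \<cdot>\<^sub>v w)"
    hence i: "i < n" using w x by simp
    have "(W *\<^sub>v x) $ i = (\<Sum>j<n. ((if i = j then 1 else 0) - 2 / g * w $ i * w $ j) * x $ j)"
      using i x by (auto simp: W_def scalar_prod_def atLeast0LessThan intro!: sum.cong)
    also have "\<dots> = (\<Sum>j<n. (if i = j then x $ j else 0)) - (\<Sum>j<n. 2 / g * w $ i * (w $ j * x $ j))"
      unfolding sum_subtractf[symmetric] by (intro sum.cong) (auto simp: algebra_simps)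
    also have "\<dots> = x $ i - 2 / g * w $ i * (w \<bullet> x)"
      using i x w by (simp add: scalar_prod_def atLeast0LessThan sum_distrib_left)
    also have "\<dots> = (x - (2 / g * (w \<bullet> x)) \<cdot>\<^sub>v w) $ i" using i w x by simp
    finally show "(W *\<^sub>v x) $ i = (x - (2 / g * (w \<bullet> x)) \<cdot>\<^sub>v w) $ i" .
  qed (use W w x in auto)
  have sym: "transpose_mat W = W" by (rule eq_matI) (auto simp: W_def)
  have WWx: "W *\<^sub>v (W *\<^sub>v x) = x" if x: "x \<in> carrier_vec n" for x
  proof -
    define c where "c = 2 / g * (w \<bullet> x)"
    have Wxc: "W *\<^sub>v x \<in> carrier_vec n" using W x by simp
    have "w \<bullet> (W *\<^sub>v x) = w \<bullet> x - c * g"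
      unfolding Wx[OF x] c_def[symmetric] using w x
      by (simp add: scalar_prod_minus_distrib[of _ n] g_def)
    also have "\<dots> = - (w \<bullet> x)" using g by (simp add: c_def)
    finally have "2 / g * (w \<bullet> (W *\<^sub>v x)) = - c" by (simp add: c_def)
    hence "W *\<^sub>v (W *\<^sub>v x) = W *\<^sub>v x - (- c) \<cdot>\<^sub>v w" using Wx[OF Wxc] by simp
    hence "W *\<^sub>v (W *\<^sub>v x) = x - c \<cdot>\<^sub>v w - (- c) \<cdot>\<^sub>v w" using Wx[OF x] by (metis c_def)
    also have "\<dots> = x" using w x by (intro eq_vecI) auto
    finally show ?thesis .
  qed
  have "W * W = 1\<^sub>m n"
  proof (rule eq_matI)
    fix i j assume "i < dim_row (1\<^sub>m n :: real mat)" "j < dim_col (1\<^sub>m n :: real mat)"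
    hence ij: "i < n" "j < n" by auto
    have "col (W * W) j = W *\<^sub>v (W *\<^sub>v unit_vec n j)"
      using W ij by (intro eq_vecI) (auto intro!: arg_cong2[where f = scalar_prod] eq_vecI)
    also have "\<dots> = unit_vec n j" by (rule WWx) simp
    finally have "(W * W) $$ (i,j) = unit_vec n j $ i"
      using W ij by (metis carrier_matD index_col mult_carrier_mat)
    thus "(W * W) $$ (i,j) = 1\<^sub>m n $$ (i,j)" using ij by auto
  qed (use W in auto)
  moreover have "W *\<^sub>v unit_vec n 0 = v"
  proof -
    have "2 / g * (w \<bullet> e) = -1" using g unfolding we by (simp add: g' field_simps)
    hence "W *\<^sub>v e = e - (-1) \<cdot>\<^sub>v w" using Wx[OF e] by simp
    also have "\<dots> = v" unfolding w_def using v e by (intro eq_vecI) auto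
    finally show ?thesis by (simp add: e_def)
  qed
  ultimately show ?thesis using W sym that by blast
qed

text \<open>
  Conjugating by the reflection that sends \<open>e\<^sub>0\<close> to a unit eigenvector splits off the eigenvalue as a
  \<open>1 \<times> 1\<close> block, because symmetry makes the rest of the first row vanish with the first column.
\<close>

theorem real_spectral_decomposition:
  fixes A :: "real mat"
  assumes "A \<in> carrier_mat n n" "transpose_mat A = A"
  shows "\<exists>U f. U \<in> carrier_mat n n \<and> transpose_mat U * U = 1\<^sub>m n \<and>
    A = U * mat_diag n f * transpose_mat U"
  using assms
proof (induction n arbitrary: A)
  case 0
  show ?case by (intro exI[of _ "1\<^sub>m 0"] exI[of _ "\<lambda>_. 0"]) (use 0 in \<open>auto intro!: eq_matI\<close>)
next
  case (Suc n A)
  note A = Suc.prems(1) and sym = Suc.prems(2)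
  obtain v' l where v': "v' \<in> carrier_vec (Suc n)" "v' \<noteq> 0\<^sub>v (Suc n)" "A *\<^sub>v v' = l \<cdot>\<^sub>v v'"
    by (rule symmetric_mat_real_eigenvector[OF A sym]) auto
  have pos: "0 < v' \<bullet> v'"
    using scalar_prod_self_nonneg[of v'] scalar_prod_self_eq_0_iff[OF v'(1)] v'(2) by linarith
  define v where "v = (1 / sqrt (v' \<bullet> v')) \<cdot>\<^sub>v v'"
  have v: "v \<in> carrier_vec (Suc n)" using v' by (simp add: v_def)
  have vv: "v \<bullet> v = 1"
    using pos by (simp add: v_def real_sqrt_mult_self field_simps)
  have Av: "A *\<^sub>v v = l \<cdot>\<^sub>v v"
    unfolding v_def mult_mat_vec[OF A v'(1)] v'(3) by (simp add: smult_smult_assoc mult.commute)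
  obtain W where W: "W \<in> carrier_mat (Suc n) (Suc n)" "transpose_mat W = W" "W * W = 1\<^sub>m (Suc n)"
      and We: "W *\<^sub>v unit_vec (Suc n) 0 = v"
    by (rule householder_reflection[OF v vv]) auto
  define B where "B = W * A * W"
  have B: "B \<in> carrier_mat (Suc n) (Suc n)" using W A by (simp add: B_def)
  have Bsym: "transpose_mat B = B"
    unfolding B_def using W A sym
    by (simp add: transpose_mult[of _ "Suc n" "Suc n" _ "Suc n"] assoc_mult_mat[of _ "Suc n" "Suc n" _ "Suc n" _ "Suc n"])
  have Wv: "W *\<^sub>v v = unit_vec (Suc n) 0"
    unfolding We[symmetric] using W by (simp flip: assoc_mult_mat_vec)
  have Be: "B *\<^sub>v unit_vec (Suc n) 0 = l \<cdot>\<^sub>v unit_vec (Suc n) 0"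
  proof -
    have "B *\<^sub>v unit_vec (Suc n) 0 = W *\<^sub>v (A *\<^sub>v (W *\<^sub>v unit_vec (Suc n) 0))"
      unfolding B_def using W(1) A
      by (simp add: assoc_mult_mat_vec[of _ "Suc n" "Suc n" _ "Suc n"])
    thus ?thesis by (simp add: We Av mult_mat_vec[OF W(1) v] Wv)
  qed
  have B0: "B $$ (i,0) = (if i = 0 then l else 0)" if "i < Suc n" for i
  proof -
    have "B $$ (i,0) = (B *\<^sub>v unit_vec (Suc n) 0) $ i" using B that by simp
    thus ?thesis unfolding Be using that by auto
  qed
  have B0': "B $$ (0,i) = (if i = 0 then l else 0)" if "i < Suc n" for i
    using B0[OF that] Bsym that B by (metis carrier_matD(1) carrier_matD(2) index_transpose_mat(1) zero_less_Suc)
  define B3 where "B3 = Matrix.mat n n (\<lambda>(i,j). B $$ (Suc i, Suc j))"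
  have B3: "B3 \<in> carrier_mat n n" by (simp add: B3_def)
  have B3sym: "transpose_mat B3 = B3"
  proof (rule eq_matI)
    fix i j assume "i < dim_row B3" "j < dim_col B3"
    hence ij: "i < n" "j < n" by (auto simp: B3_def)
    have "B $$ (Suc j, Suc i) = transpose_mat B $$ (Suc i, Suc j)" using B ij by simp
    thus "transpose_mat B3 $$ (i,j) = B3 $$ (i,j)" using Bsym ij by (simp add: B3_def)
  qed (auto simp: B3_def)
  from Suc.IH[OF B3 B3sym] obtain U3 f3 where U3: "U3 \<in> carrier_mat n n"
    and U3o: "transpose_mat U3 * U3 = 1\<^sub>m n" and B3d: "B3 = U3 * mat_diag n f3 * transpose_mat U3" by blast
  define f where "f = (\<lambda>i. if i = 0 then l else f3 (i - 1))"
  define V where "V = four_block_mat (1\<^sub>m 1) (0\<^sub>m 1 n) (0\<^sub>m n 1) U3"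
  have V: "V \<in> carrier_mat (Suc n) (Suc n)"
    using four_block_carrier_mat[of "1\<^sub>m 1 :: real mat" 1 1 U3 n n] U3 by (simp add: V_def)
  have VT: "transpose_mat V = four_block_mat (1\<^sub>m 1) (0\<^sub>m 1 n) (0\<^sub>m n 1) (transpose_mat U3)"
    unfolding V_def by (subst transpose_four_block_mat[of _ 1 1 _ n _ n]) (use U3 in auto)
  have fD: "mat_diag (Suc n) f = four_block_mat (mat_diag 1 (\<lambda>_. l)) (0\<^sub>m 1 n) (0\<^sub>m n 1) (mat_diag n f3)"
    by (rule eq_matI) (auto simp: mat_diag_def f_def four_block_mat_def Let_def)
  have BD: "B = four_block_mat (mat_diag 1 (\<lambda>_. l)) (0\<^sub>m 1 n) (0\<^sub>m n 1) B3"
  proof (rule eq_matI)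
    fix i j
    assume "i < dim_row (four_block_mat (mat_diag 1 (\<lambda>_. l)) (0\<^sub>m 1 n) (0\<^sub>m n 1) B3)"
      "j < dim_col (four_block_mat (mat_diag 1 (\<lambda>_. l)) (0\<^sub>m 1 n) (0\<^sub>m n 1) B3)"
    hence "i < Suc n" "j < Suc n" using B3 by (auto simp: mat_diag_def)
    thus "B $$ (i,j) = four_block_mat (mat_diag 1 (\<lambda>_. l)) (0\<^sub>m 1 n) (0\<^sub>m n 1) B3 $$ (i,j)"
      using B0 B0' by (cases i; cases j) (auto simp: mat_diag_def four_block_mat_def Let_def B3_def)
  qed (use B B3 in \<open>auto simp: mat_diag_def\<close>)
  have VTV: "transpose_mat V * V = 1\<^sub>m (Suc n)"
    unfolding VT unfolding V_def
    by (subst mult_four_block_mat[of _ 1 1 _ n _ n _ _ 1 _ n])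
       (use U3 U3o in \<open>auto simp: mat_diag_def intro!: eq_matI\<close>)
  have VD: "V * mat_diag (Suc n) f * transpose_mat V = B"
  proof -
    have "V * mat_diag (Suc n) f = four_block_mat (mat_diag 1 (\<lambda>_. l)) (0\<^sub>m 1 n) (0\<^sub>m n 1) (U3 * mat_diag n f3)"
      unfolding V_def fD
      using U3 left_mult_one_mat[OF mat_diag_dim[of 1 "\<lambda>_. l"]]
        left_mult_zero_mat[OF mat_diag_dim[of 1 "\<lambda>_. l"], of n]
        left_mult_zero_mat[OF mat_diag_dim[of n f3], of 1]
      by (subst mult_four_block_mat[of _ 1 1 _ n _ n _ _ 1 _ n]) (auto simp del: One_nat_def)
    also have "\<dots> * transpose_mat V = four_block_mat (mat_diag 1 (\<lambda>_. l)) (0\<^sub>m 1 n) (0\<^sub>m n 1) (U3 * mat_diag n f3 * transpose_mat U3)"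
      unfolding VT
      by (subst mult_four_block_mat[of _ 1 1 _ n _ n _ _ 1 _ n])
         (use U3 right_mult_one_mat[OF mat_diag_dim[of 1 "\<lambda>_. l"]]
           right_mult_zero_mat[OF mat_diag_dim[of 1 "\<lambda>_. l"], of n]
           right_mult_zero_mat[OF mult_carrier_mat[OF U3 mat_diag_dim[of n f3]], of 1]
           mult_carrier_mat[OF mult_carrier_mat[OF U3 mat_diag_dim[of n f3]], of "transpose_mat U3" n]
          in \<open>auto simp del: One_nat_def\<close>)
    finally show ?thesis by (simp add: BD B3d)
  qed
  have A_eq: "A = W * B * W"
  proof -
    have "W * B * W = (W * W) * A * (W * W)"
      unfolding B_def using W(1) A by (simp add: assoc_mult_mat[of _ "Suc n" "Suc n" _ "Suc n" _ "Suc n"])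
    thus ?thesis unfolding W(3) using A by simp
  qed
  show ?case
  proof (intro exI conjI)
    show "W * V \<in> carrier_mat (Suc n) (Suc n)" using W V by simp
    have WVT: "transpose_mat (W * V) = transpose_mat V * W"
      using transpose_mult[OF W(1) V] W(2) by simp
    have "transpose_mat V * W * (W * V) = transpose_mat V * (W * W) * V"
      using W(1) V by (simp add: assoc_mult_mat[of _ "Suc n" "Suc n" _ "Suc n" _ "Suc n"])
    thus "transpose_mat (W * V) * (W * V) = 1\<^sub>m (Suc n)" using W(3) V VTV WVT by simp
    have regroup: "W * V * X * (Y * W) = W * (V * X * Y) * W"
      if "X \<in> carrier_mat (Suc n) (Suc n)" "Y \<in> carrier_mat (Suc n) (Suc n)" for X Y
      using W(1) V that by (simp add: assoc_mult_mat[of _ "Suc n" "Suc n" _ "Suc n" _ "Suc n"])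
    have "W * V * mat_diag (Suc n) f * (transpose_mat V * W) = W * (V * mat_diag (Suc n) f * transpose_mat V) * W"
      by (rule regroup) (use V in auto)
    thus "A = W * V * mat_diag (Suc n) f * transpose_mat (W * V)" using VD A_eq WVT by simp
  qed
qed

lemma spdD:
  assumes "spd n A"
  shows "A \<in> carrier_mat n n" "transpose_mat A = A"
    "\<And>v. v \<in> carrier_vec n \<Longrightarrow> v \<noteq> 0\<^sub>v n \<Longrightarrow> 0 < v \<bullet> (A *\<^sub>v v)"
  using assms by (auto simp: spd_def)

section \<open>Square roots of positive definite matrices\<close>

lemma mult_mat_zero_vec:
  fixes U :: "real mat"
  assumes "U \<in> carrier_mat n n"
  shows "U *\<^sub>v 0\<^sub>v n = 0\<^sub>v n"
  by (rule eq_vecI) (use assms in auto)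

lemma spd_quadratic_form_nonneg:
  assumes "spd n A" "v \<in> carrier_vec n"
  shows "0 \<le> v \<bullet> (A *\<^sub>v v)"
  using spdD[OF assms(1)] assms(2) by (cases "v = 0\<^sub>v n") (auto intro: less_imp_le)

lemma quadratic_form_mat_diag:
  fixes v :: "real vec"
  assumes v: "v \<in> carrier_vec n"
  shows "v \<bullet> (mat_diag n f *\<^sub>v v) = (\<Sum>i<n. f i * (v $ i)\<^sup>2)"
proof -
  have "(mat_diag n f *\<^sub>v v) $ i = f i * v $ i" if "i < n" for i
  proof -
    have "(mat_diag n f *\<^sub>v v) $ i = (\<Sum>j<n. (if i = j then f j else 0) * v $ j)"
      using that v by (simp add: mat_diag_def scalar_prod_def atLeast0LessThan)
    also have "\<dots> = (\<Sum>j<n. if i = j then f j * v $ j else 0)" by (intro sum.cong) auto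
    finally show ?thesis using that by simp
  qed
  thus ?thesis using v
    by (auto simp: scalar_prod_def atLeast0LessThan mat_diag_def power2_eq_square intro!: sum.cong)
qed

lemma spd_mat_diag:
  assumes "\<And>i. i < n \<Longrightarrow> 0 < f i"
  shows "spd n (mat_diag n f)"
  unfolding spd_def
proof (intro conjI ballI impI)
  show "transpose_mat (mat_diag n f) = mat_diag n f" by (rule eq_matI) (auto simp: mat_diag_def)
  fix v :: "real vec" assume v: "v \<in> carrier_vec n" "v \<noteq> 0\<^sub>v n"
  then obtain i where i: "i < n" "v $ i \<noteq> 0"
    by (metis carrier_vecD eq_vecI index_zero_vec(1) index_zero_vec(2))
  have "0 < (\<Sum>i<n. f i * (v $ i)\<^sup>2)"
    by (rule sum_pos2[of _ i]) (use i assms in \<open>auto intro!: mult_nonneg_nonneg simp: less_imp_le\<close>)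
  thus "0 < v \<bullet> (mat_diag n f *\<^sub>v v)" by (simp add: quadratic_form_mat_diag[OF v(1)])
qed auto

lemma quadratic_form_congruence:
  fixes A :: "real mat"
  assumes A: "A \<in> carrier_mat n n" and U: "U \<in> carrier_mat n n" and v: "v \<in> carrier_vec n"
  shows "v \<bullet> ((U * A * transpose_mat U) *\<^sub>v v) = (transpose_mat U *\<^sub>v v) \<bullet> (A *\<^sub>v (transpose_mat U *\<^sub>v v))"
proof -
  have UT: "transpose_mat U \<in> carrier_mat n n" using U by simp
  have "(U * A * transpose_mat U) *\<^sub>v v = U *\<^sub>v (A *\<^sub>v (transpose_mat U *\<^sub>v v))"
    using A U UT v by (simp add: assoc_mult_mat_vec[of _ n n _ n])
  moreover have "v \<bullet> (U *\<^sub>v (A *\<^sub>v (transpose_mat U *\<^sub>v v))) = (transpose_mat U *\<^sub>v v) \<bullet> (A *\<^sub>v (transpose_mat U *\<^sub>v v))"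
    by (rule transpose_vec_mult_scalar[OF U _ v, symmetric]) (use A U v in auto)
  ultimately show ?thesis by simp
qed

lemma spd_congruence:
  assumes A: "spd n A" and U: "U \<in> carrier_mat n n"
    and inj: "\<And>v. v \<in> carrier_vec n \<Longrightarrow> transpose_mat U *\<^sub>v v = 0\<^sub>v n \<Longrightarrow> v = 0\<^sub>v n"
  shows "spd n (U * A * transpose_mat U)"
  unfolding spd_def
proof (intro conjI ballI impI)
  note Ac = spdD(1)[OF A]
  have UT: "transpose_mat U \<in> carrier_mat n n" using U by simp
  show "U * A * transpose_mat U \<in> carrier_mat n n" using Ac U UT by simp
  show "transpose_mat (U * A * transpose_mat U) = U * A * transpose_mat U"
    using U UT Ac spdD(2)[OF A]
    by (simp add: transpose_mult[of _ n n _ n] assoc_mult_mat[of _ n n _ n _ n])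
  fix v :: "real vec" assume v: "v \<in> carrier_vec n" "v \<noteq> 0\<^sub>v n"
  have "transpose_mat U *\<^sub>v v \<noteq> 0\<^sub>v n" using inj v by blast
  moreover have "transpose_mat U *\<^sub>v v \<in> carrier_vec n" using UT v by simp
  ultimately show "0 < v \<bullet> ((U * A * transpose_mat U) *\<^sub>v v)"
    unfolding quadratic_form_congruence[OF Ac U v(1)] by (rule spdD(3)[OF A, rotated])
qed

text \<open>
  Take square roots of the eigenvalues; they are positive because \<open>f i\<close> is the value of the form
  of \<open>A\<close> at the \<open>i\<close>-th eigenvector.
\<close>

lemma spd_sqrt_exists:
  assumes A: "spd n A"
  shows "\<exists>S. spd n S \<and> S * S = A"
proof -
  from real_spectral_decomposition[OF spdD(1,2)[OF A]] obtain U f where U: "U \<in> carrier_mat n n"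
    and UU: "transpose_mat U * U = 1\<^sub>m n" and Ad: "A = U * mat_diag n f * transpose_mat U" by blast
  have UT: "transpose_mat U \<in> carrier_mat n n" using U by simp
  have UU': "U * transpose_mat U = 1\<^sub>m n" by (rule mat_mult_left_right_inverse[OF UT U UU])
  have inj: "v = 0\<^sub>v n" if "v \<in> carrier_vec n" "transpose_mat U *\<^sub>v v = 0\<^sub>v n" for v
  proof -
    have "v = (U * transpose_mat U) *\<^sub>v v" using UU' that by simp
    also have "\<dots> = U *\<^sub>v 0\<^sub>v n" using U UT that(1) by (simp add: assoc_mult_mat_vec[of _ n n _ n] that(2))
    also have "\<dots> = 0\<^sub>v n" by (rule mult_mat_zero_vec[OF U])
    finally show ?thesis .
  qed
  have f: "0 < f i" if i: "i < n" for i
  proof -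
    define v where "v = U *\<^sub>v unit_vec n i"
    have v: "v \<in> carrier_vec n" using U by (simp add: v_def)
    have Uv: "transpose_mat U *\<^sub>v v = unit_vec n i"
      unfolding v_def using assoc_mult_mat_vec[OF UT U, of "unit_vec n i"] UU by simp
    have v0: "v \<noteq> 0\<^sub>v n"
    proof
      assume "v = 0\<^sub>v n"
      hence "transpose_mat U *\<^sub>v v = 0\<^sub>v n" using mult_mat_zero_vec[OF UT] by simp
      hence "unit_vec n i = (0\<^sub>v n :: real vec)" by (rule trans[OF Uv[symmetric]])
      thus False using unit_vec_nonzero[OF i, where 'a = real] by blast
    qed
    have "0 < v \<bullet> (A *\<^sub>v v)" by (rule spdD(3)[OF A v v0])
    also have "v \<bullet> (A *\<^sub>v v) = unit_vec n i \<bullet> (mat_diag n f *\<^sub>v unit_vec n i)"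
      unfolding Ad quadratic_form_congruence[OF mat_diag_dim U v] Uv ..
    also have "\<dots> = (\<Sum>j<n. f j * (unit_vec n i $ j)\<^sup>2)" by (rule quadratic_form_mat_diag) simp
    also have "\<dots> = (\<Sum>j<n. if j = i then f j else 0)" using i by (intro sum.cong) auto
    also have "\<dots> = f i" using i by simp
    finally show ?thesis .
  qed
  define S where "S = U * mat_diag n (\<lambda>i. sqrt (f i)) * transpose_mat U"
  have "spd n S"
    unfolding S_def by (rule spd_congruence[OF spd_mat_diag U inj]) (use f in auto)
  moreover have "S * S = A"
  proof -
    have md: "mat_diag n (\<lambda>i. sqrt (f i)) \<in> carrier_mat n n" by simp
    have regroup: "U * X * transpose_mat U * (U * X * transpose_mat U)
        = U * X * (transpose_mat U * U) * X * transpose_mat U"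
      if "X \<in> carrier_mat n n" for X
      using U UT that by (simp add: assoc_mult_mat[of _ n n _ n _ n])
    have "S * S = U * mat_diag n (\<lambda>i. sqrt (f i)) * (transpose_mat U * U) * mat_diag n (\<lambda>i. sqrt (f i)) * transpose_mat U"
      unfolding S_def by (rule regroup[OF md])
    also have "\<dots> = U * (mat_diag n (\<lambda>i. sqrt (f i)) * mat_diag n (\<lambda>i. sqrt (f i))) * transpose_mat U"
      using assoc_mult_mat[OF U md md] right_mult_one_mat[OF mult_carrier_mat[OF U md]]
      by (simp add: UU del: mat_diag_diag)
    also have "mat_diag n (\<lambda>i. sqrt (f i)) * mat_diag n (\<lambda>i. sqrt (f i)) = mat_diag n f"
      unfolding mat_diag_diag
      by (rule eq_matI) (use f in \<open>auto simp: mat_diag_def less_imp_le\<close>)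
    finally show ?thesis by (simp add: Ad)
  qed
  ultimately show ?thesis by blast
qed

text \<open>
  Cyclicity of the trace.
\<close>

lemma sum_diag_mult_commute:
  fixes X Y :: "real mat"
  assumes "X \<in> carrier_mat n n" "Y \<in> carrier_mat n n"
  shows "(\<Sum>i<n. (X * Y) $$ (i,i)) = (\<Sum>i<n. (Y * X) $$ (i,i))"
proof -
  have "(\<Sum>i<n. (X * Y) $$ (i,i)) = (\<Sum>i<n. \<Sum>j<n. X $$ (i,j) * Y $$ (j,i))"
    using assms by (auto simp: scalar_prod_def atLeast0LessThan intro!: sum.cong)
  also have "\<dots> = (\<Sum>j<n. \<Sum>i<n. X $$ (i,j) * Y $$ (j,i))" by (rule sum.swap)
  also have "\<dots> = (\<Sum>i<n. (Y * X) $$ (i,i))"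
    using assms by (auto simp: scalar_prod_def atLeast0LessThan mult.commute intro!: sum.cong)
  finally show ?thesis .
qed

text \<open>
  With \<open>D = S - T\<close>, the hypothesis says \<open>S D = - D T\<close>. Multiplying by \<open>D\<close> on the left and taking traces,
  \<open>tr (D S D) = - tr (D T D)\<close>. Both traces are sums of values of a positive definite form at the columns of
  \<open>D\<close>, so all these values vanish and \<open>D = 0\<close>.
\<close>

lemma spd_sqrt_unique:
  assumes S: "spd n S" and T: "spd n T" and eq: "S * S = T * T"
  shows "S = T"
proof -
  note Sc = spdD(1)[OF S] and Tc = spdD(1)[OF T]
  define D where "D = S - T"
  have D: "D \<in> carrier_mat n n" unfolding D_def by (rule minus_carrier_mat[OF Tc])
  have Dsym: "transpose_mat D = D"
    unfolding D_def using Sc Tc spdD(2)[OF S] spdD(2)[OF T] by (simp add: transpose_minus)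
  have SD: "S * D = - (D * T)"
  proof -
    have "S * D = S * S - S * T" unfolding D_def by (rule mult_minus_distrib_mat[OF Sc Sc Tc])
    also have "\<dots> = - (S * T - T * T)" unfolding eq
      by (rule eq_matI) (use Sc Tc in auto)
    also have "S * T - T * T = D * T" unfolding D_def by (rule minus_mult_distrib_mat[OF Sc Tc Tc, symmetric])
    finally show ?thesis .
  qed
  have quad: "(\<Sum>i<n. (D * (X * D)) $$ (i,i)) = (\<Sum>i<n. col D i \<bullet> (X *\<^sub>v col D i))"
    if X: "X \<in> carrier_mat n n" for X
  proof (rule sum.cong[OF refl])
    fix i assume "i \<in> {..<n}"
    hence i: "i < n" by simp
    have "row D i = col D i" using row_transpose[of i D] D i Dsym by simp
    moreover have "(D * (X * D)) $$ (i,i) = row D i \<bullet> col (X * D) i"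
      by (rule index_mult_mat(1)) (use i D X in auto)
    ultimately show "(D * (X * D)) $$ (i,i) = col D i \<bullet> (X *\<^sub>v col D i)"
      using col_mult2[OF X D i] by simp
  qed
  have "(\<Sum>i<n. (D * (S * D)) $$ (i,i)) = - (\<Sum>i<n. (D * (D * T)) $$ (i,i))"
    unfolding SD sum_negf[symmetric] using D Tc by (intro sum.cong) auto
  also have "(\<Sum>i<n. (D * (D * T)) $$ (i,i)) = (\<Sum>i<n. (D * (T * D)) $$ (i,i))"
    using sum_diag_mult_commute[of D n "D * T"] D Tc by (simp add: assoc_mult_mat[of _ n n _ n _ n])
  finally have sum0: "(\<Sum>i<n. col D i \<bullet> (S *\<^sub>v col D i)) = - (\<Sum>i<n. col D i \<bullet> (T *\<^sub>v col D i))"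
    using quad[OF Sc] quad[OF Tc] by simp
  have colD: "col D i \<in> carrier_vec n" for i using D by auto
  have "0 \<le> (\<Sum>i<n. col D i \<bullet> (T *\<^sub>v col D i))"
    by (intro sum_nonneg spd_quadratic_form_nonneg[OF T] colD)
  moreover have "0 \<le> (\<Sum>i<n. col D i \<bullet> (S *\<^sub>v col D i))"
    by (intro sum_nonneg spd_quadratic_form_nonneg[OF S] colD)
  ultimately have "(\<Sum>i<n. col D i \<bullet> (S *\<^sub>v col D i)) = 0" using sum0 by linarith
  hence z: "col D i \<bullet> (S *\<^sub>v col D i) = 0" if "i < n" for i
    using that spd_quadratic_form_nonneg[OF S colD] by (subst (asm) sum_nonneg_eq_0_iff) auto
  have "col D i = 0\<^sub>v n" if "i < n" for i
    using z[OF that] spdD(3)[OF S colD, of i] by force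
  hence "D $$ (i,j) = 0" if "i < n" "j < n" for i j
  proof -
    have "D $$ (i,j) = col D j $ i" using that D by simp
    thus ?thesis using \<open>\<And>i. i < n \<Longrightarrow> col D i = 0\<^sub>v n\<close> that by simp
  qed
  hence "S $$ (i,j) = T $$ (i,j)" if "i < n" "j < n" for i j
    using that Sc Tc by (simp add: D_def)
  thus ?thesis using Sc Tc by (intro eq_matI) auto
qed

lemma spd_sqrt_eqI:
  assumes S: "spd n S" and eq: "S * S = A"
  shows "spd_sqrt A = S"
proof -
  have "dim_row A = n" using eq spdD(1)[OF S] by auto
  thus ?thesis unfolding spd_sqrt_def
    using S eq by (intro the_equality) (auto intro: spd_sqrt_unique)
qed

lemma spd_sqrt:
  assumes "spd n A"
  shows "spd n (spd_sqrt A)" "spd_sqrt A * spd_sqrt A = A"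
  using spd_sqrt_exists[OF assms] spd_sqrt_eqI by auto

lemma spd_mat_inverse:
  assumes S: "spd n S"
  obtains R where "mat_inverse S = Some R" "R \<in> carrier_mat n n" "transpose_mat R = R"
    "S * R = 1\<^sub>m n" "R * S = 1\<^sub>m n"
proof -
  note Sc = spdD(1)[OF S]
  have "Determinant.det S \<noteq> 0"
  proof
    assume "Determinant.det S = 0"
    then obtain v where v: "v \<in> carrier_vec n" "v \<noteq> 0\<^sub>v n" "S *\<^sub>v v = 0\<^sub>v n"
      using det_0_iff_vec_prod_zero[OF Sc] by blast
    from spdD(3)[OF S v(1,2)] v show False by simp
  qed
  hence "S \<in> Units (ring_mat TYPE(real) n ())" by (rule det_non_zero_imp_unit[OF Sc])
  then obtain R where R: "mat_inverse S = Some R"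
    using mat_inverse(1)[OF Sc, of "()"] by (cases "mat_inverse S") auto
  from mat_inverse(2)[OF Sc R] have SR: "S * R = 1\<^sub>m n" "R * S = 1\<^sub>m n" and Rc: "R \<in> carrier_mat n n" by auto
  have RT: "transpose_mat R \<in> carrier_mat n n" using Rc by simp
  have RS: "transpose_mat R * S = 1\<^sub>m n"
    using transpose_mult[OF Sc Rc] SR spdD(2)[OF S] by simp
  have "transpose_mat R = transpose_mat R * (S * R)" using SR RT by simp
  also have "\<dots> = (transpose_mat R * S) * R" by (rule assoc_mult_mat[OF RT Sc Rc, symmetric])
  also have "\<dots> = R" using RS Rc by simp
  finally show ?thesis using that R Rc SR by blast
qed

lemma spd_inv_sqrt:
  assumes A: "spd n A"
  shows "spd_inv_sqrt A \<in> carrier_mat n n" "transpose_mat (spd_inv_sqrt A) = spd_inv_sqrt A"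
    "spd_inv_sqrt A * A * spd_inv_sqrt A = 1\<^sub>m n"
proof -
  note S = spd_sqrt[OF A] and Sc = spdD(1)[OF spd_sqrt(1)[OF A]]
  obtain R where R: "mat_inverse (spd_sqrt A) = Some R" "R \<in> carrier_mat n n" "transpose_mat R = R"
    "spd_sqrt A * R = 1\<^sub>m n" "R * spd_sqrt A = 1\<^sub>m n" by (rule spd_mat_inverse[OF S(1)])
  have eq: "spd_inv_sqrt A = R" by (simp add: spd_inv_sqrt_def R)
  show "spd_inv_sqrt A \<in> carrier_mat n n" "transpose_mat (spd_inv_sqrt A) = spd_inv_sqrt A"
    using R eq by auto
  have "R * A * R = R * (spd_sqrt A * spd_sqrt A) * R" by (simp add: S(2))
  also have "\<dots> = (R * spd_sqrt A) * (spd_sqrt A * R)"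
    using Sc R(2) by (simp add: assoc_mult_mat[of _ n n _ n _ n])
  finally have "R * A * R = (R * spd_sqrt A) * (spd_sqrt A * R)" .
  thus "spd_inv_sqrt A * A * spd_inv_sqrt A = 1\<^sub>m n" using R eq by simp
qed

lemma spd_sqrt_mat_diag:
  assumes "\<And>i. i < n \<Longrightarrow> 0 < f i"
  shows "spd_sqrt (mat_diag n f) = mat_diag n (\<lambda>i. sqrt (f i))"
proof (rule spd_sqrt_eqI)
  show "spd n (mat_diag n (\<lambda>i. sqrt (f i)))" using assms by (intro spd_mat_diag) auto
  show "mat_diag n (\<lambda>i. sqrt (f i)) * mat_diag n (\<lambda>i. sqrt (f i)) = mat_diag n f"
    unfolding mat_diag_diag
    by (rule eq_matI) (use assms in \<open>auto simp: mat_diag_def less_imp_le\<close>)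
qed

lemma spd_inv_sqrt_mat_diag:
  assumes pos: "\<And>i. i < n \<Longrightarrow> 0 < f i"
  shows "spd_inv_sqrt (mat_diag n f) = mat_diag n (\<lambda>i. 1 / sqrt (f i))"
proof -
  define S where "S = mat_diag n (\<lambda>i. sqrt (f i))"
  define Q where "Q = mat_diag n (\<lambda>i. 1 / sqrt (f i))"
  have c: "S \<in> carrier_mat n n" "Q \<in> carrier_mat n n" by (simp_all add: S_def Q_def)
  have S: "spd n S" unfolding S_def using pos by (intro spd_mat_diag) auto
  have SQ: "S * Q = 1\<^sub>m n"
    unfolding S_def Q_def mat_diag_diag
  proof (rule eq_matI)
    fix i j assume "i < dim_row (1\<^sub>m n :: real mat)" "j < dim_col (1\<^sub>m n :: real mat)"
    thus "mat_diag n (\<lambda>i. sqrt (f i) * (1 / sqrt (f i))) $$ (i,j) = 1\<^sub>m n $$ (i,j)"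
      using pos[of j] by (auto simp: mat_diag_def)
  qed (auto simp: mat_diag_def)
  obtain R where R: "mat_inverse S = Some R" "R \<in> carrier_mat n n" "R * S = 1\<^sub>m n"
    by (rule spd_mat_inverse[OF S]) blast
  have "R = R * (S * Q)" using SQ R by simp
  also have "\<dots> = (R * S) * Q" using assoc_mult_mat[OF R(2) c] by simp
  also have "\<dots> = Q" using R c by simp
  finally show ?thesis
    using R(1) spd_sqrt_mat_diag[OF pos] by (simp add: spd_inv_sqrt_def S_def Q_def)
qed

section \<open>Condition numbers from Rayleigh quotients\<close>

text \<open>
  The hypothesis \<open>\<bar>l - 1\<bar> \<le> \<eta> l\<close>, rather than \<open>\<bar>l - 1\<bar> \<le> \<eta>\<close>, is what a perturbation bound relative to the
  form of \<open>M\<close> yields for a Rayleigh quotient \<open>l\<close>. It places the spectrum in \<open>[1/(1+\<eta>), 1/(1-\<eta>)]\<close>.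
\<close>

lemma cond_number_of_spectrum_near_1:
  fixes A :: "real mat"
  assumes A: "A \<in> carrier_mat n n" "transpose_mat A = A" and n: "0 < n"
    and \<eta>: "0 \<le> \<eta>" "\<eta> < 1"
    and near: "\<And>l. eigenvalue A l \<Longrightarrow> \<bar>l - 1\<bar> \<le> \<eta> * l"
  shows "\<bar>cond_number A - 1\<bar> \<le> 2 * \<eta> / (1 - \<eta>)"
proof -
  have fin: "finite (spectrum A)" by (rule card_finite_spectrum[OF A(1)])
  obtain v l where "v \<in> carrier_vec n" "v \<noteq> 0\<^sub>v n" "A *\<^sub>v v = l \<cdot>\<^sub>v v"
    by (rule symmetric_mat_real_eigenvector[OF A n])
  hence "l \<in> spectrum A" using A by (auto simp: spectrum_def eigenvalue_def eigenvector_def)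
  hence ne: "spectrum A \<noteq> {}" by blast
  define a where "a = Min (spectrum A)"
  define b where "b = Max (spectrum A)"
  have "a \<in> spectrum A" "b \<in> spectrum A" "a \<le> b" using fin ne by (auto simp: a_def b_def)
  hence a: "\<bar>a - 1\<bar> \<le> \<eta> * a" and b: "\<bar>b - 1\<bar> \<le> \<eta> * b" using near by (auto simp: spectrum_def)
  have a1: "1 \<le> (1 + \<eta>) * a" and b1: "(1 - \<eta>) * b \<le> 1" using a b by (auto simp: algebra_simps abs_le_iff)
  have a0: "0 < a"
  proof (rule ccontr)
    assume "\<not> 0 < a"
    hence "(1 + \<eta>) * a \<le> 0" using \<eta> by (intro mult_nonneg_nonpos) auto
    with a1 show False by simp
  qed
  have "(1 - \<eta>) * b \<le> (1 + \<eta>) * a" using a1 b1 by simp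
  hence "b / a \<le> (1 + \<eta>) / (1 - \<eta>)" using a0 \<eta> by (simp add: field_simps)
  also have "\<dots> = 1 + 2 * \<eta> / (1 - \<eta>)" using \<eta> by (simp add: field_simps)
  finally have "b / a - 1 \<le> 2 * \<eta> / (1 - \<eta>)" by simp
  moreover have "1 \<le> b / a" using a0 \<open>a \<le> b\<close> by simp
  ultimately show ?thesis by (simp add: cond_number_def a_def b_def)
qed

text \<open>
  If \<open>v\<close> is an eigenvector of \<open>R M R\<close> with \<open>R = P\<^sup>-\<^sup>1\<^sup>/\<^sup>2\<close> and \<open>w = R v\<close>, then its eigenvalue is the quotient of
  the forms of \<open>M\<close> and \<open>P\<close> at \<open>w\<close>.
\<close>

lemma cond_number_preconditioned:
  fixes P M :: "real mat"
  assumes P: "spd n P" and M: "M \<in> carrier_mat n n" "transpose_mat M = M" and n: "0 < n"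
    and \<eta>: "0 \<le> \<eta>" "\<eta> < 1"
    and close: "\<And>v. v \<in> carrier_vec n \<Longrightarrow>
      \<bar>v \<bullet> (M *\<^sub>v v) - v \<bullet> (P *\<^sub>v v)\<bar> \<le> \<eta> * (v \<bullet> (M *\<^sub>v v))"
  shows "\<bar>cond_number (spd_inv_sqrt P * M * spd_inv_sqrt P) - 1\<bar> \<le> 2 * \<eta> / (1 - \<eta>)"
proof (rule cond_number_of_spectrum_near_1[OF _ _ n \<eta>])
  define R where "R = spd_inv_sqrt P"
  note R = spd_inv_sqrt[OF P, folded R_def]
  note Pc = spdD(1)[OF P]
  show N: "spd_inv_sqrt P * M * spd_inv_sqrt P \<in> carrier_mat n n"
    using R(1) M(1) by (simp flip: R_def)
  show "transpose_mat (spd_inv_sqrt P * M * spd_inv_sqrt P) = spd_inv_sqrt P * M * spd_inv_sqrt P"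
    unfolding R_def[symmetric] using R M
    by (simp add: transpose_mult[of _ n n _ n] assoc_mult_mat[of _ n n _ n _ n])
  fix l assume "eigenvalue (spd_inv_sqrt P * M * spd_inv_sqrt P) l"
  then obtain v where v: "v \<in> carrier_vec n" "v \<noteq> 0\<^sub>v n" and ev: "(R * M * R) *\<^sub>v v = l \<cdot>\<^sub>v v"
    using N R(1) unfolding eigenvalue_def eigenvector_def R_def[symmetric] by auto
  define w where "w = R *\<^sub>v v"
  have w: "w \<in> carrier_vec n" using R v by (simp add: w_def)
  have "w \<bullet> (M *\<^sub>v w) = v \<bullet> ((R * M * R) *\<^sub>v v)"
    using quadratic_form_congruence[OF M(1) R(1) v(1)] by (simp add: R(2) w_def)
  hence wM: "w \<bullet> (M *\<^sub>v w) = l * (v \<bullet> v)" using v by (simp add: ev)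
  have "w \<bullet> (P *\<^sub>v w) = v \<bullet> ((R * P * R) *\<^sub>v v)"
    using quadratic_form_congruence[OF Pc R(1) v(1)] by (simp add: R(2) w_def)
  hence wP: "w \<bullet> (P *\<^sub>v w) = v \<bullet> v" using v by (simp add: R(3))
  have pos: "0 < v \<bullet> v"
    using scalar_prod_self_nonneg[of v] scalar_prod_self_eq_0_iff[OF v(1)] v(2) by linarith
  have "\<bar>l - 1\<bar> * (v \<bullet> v) = \<bar>(l - 1) * (v \<bullet> v)\<bar>" using pos by (simp add: abs_mult)
  also have "(l - 1) * (v \<bullet> v) = l * (v \<bullet> v) - v \<bullet> v" by (simp add: algebra_simps)
  also have "\<bar>l * (v \<bullet> v) - v \<bullet> v\<bar> \<le> \<eta> * l * (v \<bullet> v)" using close[OF w] by (simp add: wM wP)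
  finally show "\<bar>l - 1\<bar> \<le> \<eta> * l" using pos by simp
qed

section \<open>Univariate B-splines\<close>

lemma bspline_eq_0:
  assumes "mono_on {i..i+q+1} \<xi>" "x < \<xi> i \<or> \<xi> (i+q+1) \<le> x"
  shows "bspline \<xi> q i x = 0"
  using assms
proof (induction q arbitrary: i)
  case 0
  thus ?case by auto
next
  case (Suc q)
  have m: "mono_on {i..i+q+1} \<xi>" "mono_on {i+1..(i+1)+q+1} \<xi>"
    using Suc.prems(1) by (auto intro: mono_on_subset)
  have "\<xi> i \<le> \<xi> (i+1)" "\<xi> (i+q+1) \<le> \<xi> (i+1+q+1)"
    using Suc.prems(1) by (auto intro: mono_onD)
  hence "bspline \<xi> q i x = 0" "bspline \<xi> q (i+1) x = 0"
    using Suc.IH[OF m(1)] Suc.IH[OF m(2)] Suc.prems(2) by auto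
  thus ?case by simp
qed

text \<open>
  The factors of the recursion lie in \<open>[0,1]\<close> on the support of the B-spline they multiply, so each step at
  most doubles the bound.
\<close>

lemma bspline_bounds:
  assumes "mono_on {i..i+q+1} \<xi>"
  shows "0 \<le> bspline \<xi> q i x" "bspline \<xi> q i x \<le> 2 ^ q"
proof -
  have "0 \<le> bspline \<xi> q i x \<and> bspline \<xi> q i x \<le> 2 ^ q"
    using assms
  proof (induction q arbitrary: i)
    case 0
    thus ?case by auto
  next
    case (Suc q)
    have m: "mono_on {i..i+q+1} \<xi>" "mono_on {i+1..(i+1)+q+1} \<xi>"
      using Suc.prems(1) by (auto intro: mono_on_subset)
    have frac: "0 \<le> a * b \<and> a * b \<le> 2 ^ q"
      if "0 \<le> b \<and> b \<le> 2 ^ q" "b \<noteq> 0 \<Longrightarrow> 0 \<le> a \<and> a \<le> 1" for a b :: real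
    proof (cases "b = 0")
      case False
      thus ?thesis using that mult_mono[of a 1 b "2 ^ q"] by auto
    qed auto
    have "0 \<le> (x - \<xi> i) / (\<xi> (i+q+1) - \<xi> i) * bspline \<xi> q i x \<and>
        (x - \<xi> i) / (\<xi> (i+q+1) - \<xi> i) * bspline \<xi> q i x \<le> 2 ^ q"
    proof (rule frac)
      assume "bspline \<xi> q i x \<noteq> 0"
      hence "\<not> (x < \<xi> i \<or> \<xi> (i+q+1) \<le> x)" using bspline_eq_0[OF m(1)] by blast
      thus "0 \<le> (x - \<xi> i) / (\<xi> (i+q+1) - \<xi> i) \<and> (x - \<xi> i) / (\<xi> (i+q+1) - \<xi> i) \<le> 1"
        by simp
    qed (rule Suc.IH[OF m(1)])
    moreover have "0 \<le> (\<xi> (i+q+2) - x) / (\<xi> (i+q+2) - \<xi> (i+1)) * bspline \<xi> q (i+1) x \<and>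
        (\<xi> (i+q+2) - x) / (\<xi> (i+q+2) - \<xi> (i+1)) * bspline \<xi> q (i+1) x \<le> 2 ^ q"
    proof (rule frac)
      assume "bspline \<xi> q (i+1) x \<noteq> 0"
      hence "\<not> (x < \<xi> (i+1) \<or> \<xi> (i+1+q+1) \<le> x)" using bspline_eq_0[OF m(2)] by blast
      thus "0 \<le> (\<xi> (i+q+2) - x) / (\<xi> (i+q+2) - \<xi> (i+1)) \<and> (\<xi> (i+q+2) - x) / (\<xi> (i+q+2) - \<xi> (i+1)) \<le> 1"
        by simp
    qed (rule Suc.IH[OF m(2)])
    ultimately show ?case by simp
  qed
  thus "0 \<le> bspline \<xi> q i x" "bspline \<xi> q i x \<le> 2 ^ q" by auto
qed

lemma borel_measurable_bspline [measurable]: "bspline \<xi> q i \<in> borel_measurable borel"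
proof (induction q arbitrary: i)
  case 0
  have "bspline \<xi> 0 i = indicator {\<xi> i..<\<xi> (i+1)}" by (auto simp: indicator_def)
  thus ?case by simp
next
  case (Suc q)
  note Suc.IH[measurable]
  have "bspline \<xi> (Suc q) i = (\<lambda>x. (x - \<xi> i) / (\<xi> (i+q+1) - \<xi> i) * bspline \<xi> q i x +
     (\<xi> (i+q+2) - x) / (\<xi> (i+q+2) - \<xi> (i+1)) * bspline \<xi> q (i+1) x)" by auto
  thus ?case by simp
qed

lemma bspline_poly_on_span:
  assumes "mono_on {1..N} \<xi>" "1 \<le> r" "r + 1 \<le> N" "1 \<le> i" "i + q + 1 \<le> N"
  shows "\<exists>P. degree P \<le> q \<and> (\<forall>x\<in>{\<xi> r..<\<xi> (r+1)}. bspline \<xi> q i x = poly P x)"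
  using assms(4,5)
proof (induction q arbitrary: i)
  case 0
  show ?case
  proof (cases "r = i")
    case True
    show ?thesis by (intro exI[of _ 1]) (auto simp: True)
  next
    case False
    hence "\<xi> (i+1) \<le> \<xi> r \<or> \<xi> (r+1) \<le> \<xi> i"
      using assms(1-3) 0 by (cases "i < r") (auto intro!: mono_onD[OF assms(1)])
    thus ?thesis by (intro exI[of _ 0]) auto
  qed
next
  case (Suc q)
  obtain P1 where P1: "degree P1 \<le> q" "\<forall>x\<in>{\<xi> r..<\<xi> (r+1)}. bspline \<xi> q i x = poly P1 x"
    using Suc.IH[of i] Suc.prems by auto
  obtain P2 where P2: "degree P2 \<le> q" "\<forall>x\<in>{\<xi> r..<\<xi> (r+1)}. bspline \<xi> q (i+1) x = poly P2 x"
    using Suc.IH[of "i+1"] Suc.prems by auto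
  define c1 where "c1 = \<xi> (i+q+1) - \<xi> i"
  define c2 where "c2 = \<xi> (i+q+2) - \<xi> (i+1)"
  define P where "P = [:- \<xi> i / c1, 1 / c1:] * P1 + [:\<xi> (i+q+2) / c2, - 1 / c2:] * P2"
  have lin: "degree ([:a, b:] * Q) \<le> Suc q" if "degree Q \<le> q" for a b :: real and Q
    using degree_mult_le[of "[:a, b:]" Q] that degree_pCons_le[of a "[:b:]"] by simp
  have "degree P \<le> Suc q" unfolding P_def by (intro degree_add_le lin P1 P2)
  moreover have "\<forall>x\<in>{\<xi> r..<\<xi> (r+1)}. bspline \<xi> (Suc q) i x = poly P x"
    using P1(2) P2(2) by (simp add: P_def c1_def c2_def diff_divide_distrib algebra_simps)
  ultimately show ?case by blast
qed

text \<open>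
  Only the \<open>q + 1\<close> B-splines whose support contains the span \<open>[\<xi>\<^sub>s\<^sub>+\<^sub>q, \<xi>\<^sub>s\<^sub>+\<^sub>q\<^sub>+\<^sub>1)\<close> enter the sum. Inserting the
  recursion, the coefficient of a B-spline of lower degree is the product of its own \<open>q\<close> factors with an
  affine interpolation between \<open>y - \<xi>\<^sub>j\<^sub>+\<^sub>q\<^sub>+\<^sub>1\<close> and \<open>y - \<xi>\<^sub>j\<close>, which is \<open>y - x\<close>.
\<close>

lemma marsden_identity:
  assumes mono: "mono_on {1..N} \<xi>" and "1 \<le> s" "s + 2*q + 1 \<le> N"
    and "\<xi> (s+q) \<le> x" "x < \<xi> (s+q+1)"
  shows "(y - x) ^ q = (\<Sum>j=s..s+q. (\<Prod>l=j+1..j+q. y - \<xi> l) * bspline \<xi> q j x)"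
  using assms(2-)
proof (induction q arbitrary: s)
  case 0
  thus ?case by simp
next
  case (Suc q)
  define w where "w = (\<lambda>j. (x - \<xi> j) / (\<xi> (j+q+1) - \<xi> j))"
  define w' where "w' = (\<lambda>j. (\<xi> (j+q+1) - x) / (\<xi> (j+q+1) - \<xi> j))"
  define b where "b = (\<lambda>j. bspline \<xi> q j x)"
  define \<Psi> where "\<Psi> = (\<lambda>j. \<Prod>l=j+1..j+q. y - \<xi> l)"
  define \<Phi> where "\<Phi> = (\<lambda>j. \<Prod>l=j+1..j+Suc q. y - \<xi> l)"
  have sub: "mono_on {j..j+q+1} \<xi>" if "1 \<le> j" "j + q + 1 \<le> N" for j
    by (rule mono_on_subset[OF mono]) (use that in auto)
  \<comment> \<open>The recursion brings in two B-splines of degree \<open>q\<close> whose supports miss the span.\<close>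
  have b0: "b s = 0" "b (s + Suc q + 1) = 0"
    unfolding b_def using Suc.prems by (auto intro!: bspline_eq_0[OF sub])
  have "(\<Sum>j=s..s+Suc q. \<Phi> j * bspline \<xi> (Suc q) j x) =
      (\<Sum>j=s..s+Suc q. \<Phi> j * w j * b j) + (\<Sum>j=s..s+Suc q. \<Phi> j * w' (Suc j) * b (Suc j))"
    unfolding sum.distrib[symmetric]
    by (intro sum.cong) (simp_all add: w_def w'_def b_def algebra_simps)
  also have "(\<Sum>j=s..s+Suc q. \<Phi> j * w j * b j) = (\<Sum>j=Suc s..Suc s+q. \<Phi> j * w j * b j)"
    by (rule sum.mono_neutral_right) (use b0 in \<open>auto simp: le_Suc_eq not_less_eq_eq\<close>)
  also have "(\<Sum>j=s..s+Suc q. \<Phi> j * w' (Suc j) * b (Suc j)) =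
      (\<Sum>j=Suc s..Suc (s + Suc q). \<Phi> (j - 1) * w' j * b j)"
    by (subst sum.shift_bounds_cl_Suc_ivl) simp
  also have "\<dots> = (\<Sum>j=Suc s..Suc s+q. \<Phi> (j - 1) * w' j * b j)"
    by (rule sum.mono_neutral_right) (use b0 in \<open>auto simp: le_Suc_eq\<close>)
  also have "(\<Sum>j=Suc s..Suc s+q. \<Phi> j * w j * b j) + \<dots> = (\<Sum>j=Suc s..Suc s+q. (y - x) * (\<Psi> j * b j))"
    unfolding sum.distrib[symmetric]
  proof (rule sum.cong[OF refl])
    fix j assume j: "j \<in> {Suc s..Suc s+q}"
    have "\<xi> j \<le> \<xi> (s + Suc q)" "\<xi> (s + Suc q + 1) \<le> \<xi> (j+q+1)"
      using j Suc.prems by (auto intro!: mono_onD[OF mono])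
    hence d: "\<xi> (j+q+1) - \<xi> j \<noteq> 0" using Suc.prems by simp
    have P1: "\<Phi> j = \<Psi> j * (y - \<xi> (j+q+1))" by (simp add: \<Phi>_def \<Psi>_def)
    have "\<Phi> (j - 1) = (\<Prod>l=j..j+q. y - \<xi> l)" using j by (cases j) (simp_all add: \<Phi>_def del: prod.cl_ivl_Suc)
    also have "\<dots> = (y - \<xi> j) * \<Psi> j" by (simp add: \<Psi>_def prod.atLeast_Suc_atMost)
    finally have P2: "\<Phi> (j - 1) = (y - \<xi> j) * \<Psi> j" .
    have "(y - \<xi> (j+q+1)) * (x - \<xi> j) + (y - \<xi> j) * (\<xi> (j+q+1) - x) = (y - x) * (\<xi> (j+q+1) - \<xi> j)"
      by (simp add: algebra_simps)
    hence "(y - \<xi> (j+q+1)) * w j + (y - \<xi> j) * w' j = (y - x) * (\<xi> (j+q+1) - \<xi> j) / (\<xi> (j+q+1) - \<xi> j)"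
      unfolding w_def w'_def times_divide_eq_right add_divide_distrib[symmetric] by simp
    hence "(y - \<xi> (j+q+1)) * w j + (y - \<xi> j) * w' j = y - x" using d by simp
    hence "\<Psi> j * b j * ((y - \<xi> (j+q+1)) * w j + (y - \<xi> j) * w' j) = (y - x) * (\<Psi> j * b j)" by simp
    thus "\<Phi> j * w j * b j + \<Phi> (j - 1) * w' j * b j = (y - x) * (\<Psi> j * b j)"
      unfolding P1 P2 by (simp add: algebra_simps)
  qed
  also have "\<dots> = (y - x) * (y - x) ^ q"
    unfolding sum_distrib_left[symmetric] \<Psi>_def b_def
    by (subst Suc.IH[of "Suc s"]) (use Suc.prems in auto)
  finally show ?case by (simp add: \<Phi>_def)
qed

section \<open>Functions dual to the monomials\<close>

text \<open>
  Multiplication by a linear factor multiplies the largest coefficient by at most \<open>1 + T\<close>.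
\<close>

lemma coeff_prod_linear_bound:
  fixes t :: "nat \<Rightarrow> real"
  assumes "finite A" "\<And>l. l \<in> A \<Longrightarrow> \<bar>t l\<bar> \<le> T" "0 \<le> T"
  shows "\<bar>coeff (\<Prod>l\<in>A. [:- t l, 1:]) k\<bar> \<le> (1 + T) ^ card A"
  using assms(1,2)
proof (induction A arbitrary: k rule: finite_induct)
  case empty
  show ?case by (cases k) auto
next
  case (insert a A)
  define P where "P = (\<Prod>l\<in>A. [:- t l, 1:])"
  have IH: "\<bar>coeff P k\<bar> \<le> (1 + T) ^ card A" for k
    unfolding P_def by (rule insert.IH) (use insert.prems in auto)
  have "coeff ([:- t a, 1:] * P) k = - t a * coeff P k + (if k = 0 then 0 else coeff P (k - 1))"
    by (cases k) simp_all
  also have "\<bar>\<dots>\<bar> \<le> \<bar>- t a * coeff P k\<bar> + \<bar>if k = 0 then 0 else coeff P (k - 1)\<bar>"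
    by (rule abs_triangle_ineq)
  also have "\<dots> \<le> T * (1 + T) ^ card A + (1 + T) ^ card A"
  proof (rule add_mono)
    show "\<bar>- t a * coeff P k\<bar> \<le> T * (1 + T) ^ card A"
      unfolding abs_mult using insert.prems[of a] IH assms(3) by (intro mult_mono) auto
    show "\<bar>if k = 0 then 0 else coeff P (k - 1)\<bar> \<le> (1 + T) ^ card A"
      using IH[of "k - 1"] assms(3) by auto
  qed
  also have "\<dots> = (1 + T) ^ card (insert a A)" using insert.hyps by (simp add: algebra_simps)
  finally show ?case using insert.hyps by (simp add: P_def)
qed

lemma integral_power_open_unit_interval:
  "(\<integral>x. indicator {0<..<1} x * x ^ k \<partial>lborel) = 1 / (real k + 1)"
    "integrable lborel (\<lambda>x::real. indicator {0<..<1} x * x ^ k)"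
proof -
  have "AE x in lborel. x \<noteq> (0::real) \<and> x \<noteq> (1::real)"
    using AE_lborel_singleton[of "0::real"] AE_lborel_singleton[of "1::real"] by eventually_elim auto
  hence "(\<integral>x. indicator {0<..<1} x * x ^ k \<partial>lborel) = (\<integral>x. x ^ k * indicator {0..1::real} x \<partial>lborel)"
  proof (intro integral_cong_AE)
    show "AE x in lborel. indicator {0<..<1} x * x ^ k = x ^ k * indicator {0..1::real} x"
      using \<open>AE x in lborel. x \<noteq> (0::real) \<and> x \<noteq> (1::real)\<close>
      by eventually_elim (auto simp: indicator_def)
  qed auto
  also have "\<dots> = 1 / (real k + 1)" by (simp add: integral_power)
  finally show "(\<integral>x. indicator {0<..<1} x * x ^ k \<partial>lborel) = 1 / (real k + 1)" .
  show "integrable lborel (\<lambda>x::real. indicator {0<..<1} x * x ^ k)"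
    using integrableI_bounded_set_indicator[of "{0<..<1}" lborel "\<lambda>x::real. x ^ k" 1]
    by (auto simp: power_le_one power_abs AE_I2)
qed

lemma poly_eq_0_if_square_integral_0:
  fixes P :: "real poly"
  assumes "integrable lborel (\<lambda>x. indicator {0<..<1} x * (poly P x)\<^sup>2)"
    and "(\<integral>x. indicator {0<..<1} x * (poly P x)\<^sup>2 \<partial>lborel) = 0"
  shows "P = 0"
proof (rule ccontr)
  assume "P \<noteq> 0"
  hence fin: "finite {x. poly P x = 0}" by (rule poly_roots_finite)
  have "AE x in lborel. indicator {0<..<1} x * (poly P x)\<^sup>2 = 0"
    using integral_nonneg_eq_0_iff_AE[OF assms(1)] assms(2) by simp
  moreover have "AE x in lborel. x \<notin> {x. poly P x = 0}"
    using finite_imp_null_set_lborel[OF fin] by (rule AE_not_in)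
  ultimately have "AE x in lborel. x \<notin> {0<..<1::real}"
    by eventually_elim (auto simp: indicator_def split: if_splits)
  hence "{0<..<1::real} \<in> null_sets lborel"
    by (subst AE_iff_null_sets) auto
  hence "emeasure lborel {0<..<1::real} = 0" by (auto simp: null_sets_def)
  thus False by simp
qed

text \<open>
  This is the Gram matrix of \<open>1, x, \<dots>, x\<^sup>n\<^sup>-\<^sup>1\<close> on \<open>(0,1)\<close>. A vector in its kernel is the coefficient vector of
  a polynomial whose square has integral 0.
\<close>

lemma hilbert_matrix_det_nonzero:
  "Determinant.det (Matrix.mat n n (\<lambda>(k,l). 1 / (real (k + l) + 1))) \<noteq> 0"
proof
  define G where "G = Matrix.mat n n (\<lambda>(k,l). 1 / (real (k + l) + 1))"
  have G: "G \<in> carrier_mat n n" by (simp add: G_def)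
  assume "Determinant.det (Matrix.mat n n (\<lambda>(k,l). 1 / (real (k + l) + 1))) = 0"
  then obtain v where v: "v \<in> carrier_vec n" "v \<noteq> 0\<^sub>v n" "G *\<^sub>v v = 0\<^sub>v n"
    using det_0_iff_vec_prod_zero[OF G] by (auto simp: G_def)
  define P where "P = (\<Sum>k<n. monom (v $ k) k)"
  have P: "poly P x = (\<Sum>k<n. v $ k * x ^ k)" for x
    by (simp add: P_def poly_sum poly_monom)
  have sq: "indicator {0<..<1} x * (poly P x)\<^sup>2 =
      (\<Sum>k<n. \<Sum>l<n. v $ k * v $ l * (indicator {0<..<1} x * x ^ (k + l)))" for x :: real
    unfolding P by (simp add: power2_eq_square sum_product sum_distrib_left power_add mult_ac)
  have int: "integrable lborel (\<lambda>x. indicator {0<..<1} x * (poly P x)\<^sup>2)"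
    unfolding sq by (intro Bochner_Integration.integrable_sum integrable_mult_right
        integral_power_open_unit_interval(2))
  have "(\<integral>x. indicator {0<..<1} x * (poly P x)\<^sup>2 \<partial>lborel) =
      (\<Sum>k<n. \<Sum>l<n. v $ k * v $ l * (1 / (real (k + l) + 1)))"
    unfolding sq
    by (simp only: Bochner_Integration.integral_sum Bochner_Integration.integrable_sum
        integrable_mult_right integral_power_open_unit_interval integral_mult_right_zero)
  also have "\<dots> = (\<Sum>k<n. v $ k * (G *\<^sub>v v) $ k)"
    using v(1) by (auto simp: G_def scalar_prod_def atLeast0LessThan sum_distrib_left intro!: sum.cong)
  also have "\<dots> = 0" using v by simp
  finally have "P = 0" by (rule poly_eq_0_if_square_integral_0[OF int])
  hence "v $ k = 0" if "k < n" for k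
  proof -
    have "coeff P k = v $ k" using that by (simp add: P_def coeff_sum)
    thus ?thesis using \<open>P = 0\<close> by simp
  qed
  hence "v = 0\<^sub>v n" using v by (intro eq_vecI) auto
  with v show False by simp
qed

text \<open>
  The rows of the inverse Gram matrix are the coefficients of polynomials dual to the monomials.
  They depend on \<open>p\<close> alone, which is why the bound \<open>X\<close> is independent of any knots.
\<close>

lemma monomial_dual_functions:
  obtains \<chi> :: "nat \<Rightarrow> real \<Rightarrow> real" and X
  where "\<And>k. \<chi> k \<in> borel_measurable borel" "0 < X"
    "\<And>k u. k \<le> p \<Longrightarrow> 0 < u \<Longrightarrow> u < 1 \<Longrightarrow> \<bar>\<chi> k u\<bar> \<le> X"
    "\<And>k l. k \<le> p \<Longrightarrow> l \<le> p \<Longrightarrow>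
      (\<integral>u. indicator {0<..<1} u * (\<chi> k u * u ^ l) \<partial>lborel) = (if k = l then 1 else 0)"
proof -
  define n where "n = Suc p"
  define G where "G = Matrix.mat n n (\<lambda>(k,l). 1 / (real (k + l) + 1))"
  have G: "G \<in> carrier_mat n n" by (simp add: G_def)
  have "G \<in> Units (ring_mat TYPE(real) n ())"
    using det_non_zero_imp_unit[OF G] hilbert_matrix_det_nonzero[of n] by (simp add: G_def)
  then obtain H where H: "H \<in> carrier_mat n n" "H * G = 1\<^sub>m n"
    by (auto simp: Units_def ring_mat_def)
  define \<chi> where "\<chi> = (\<lambda>k u. \<Sum>i<n. H $$ (k,i) * u ^ i)"
  define X where "X = 1 + (\<Sum>k<n. \<Sum>i<n. \<bar>H $$ (k,i)\<bar>)"
  show ?thesis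
  proof (rule that[of \<chi> X])
    show "\<chi> k \<in> borel_measurable borel" for k by (simp add: \<chi>_def)
    show "0 < X" unfolding X_def by (intro add_pos_nonneg sum_nonneg) auto
    fix k assume k: "k \<le> p"
    show "\<bar>\<chi> k u\<bar> \<le> X" if "0 < u" "u < 1" for u
    proof -
      have "\<bar>\<chi> k u\<bar> \<le> (\<Sum>i<n. \<bar>H $$ (k,i) * u ^ i\<bar>)" unfolding \<chi>_def by (rule sum_abs)
      also have "\<dots> \<le> (\<Sum>i<n. \<bar>H $$ (k,i)\<bar>)"
        using that by (intro sum_mono) (auto simp: abs_mult power_abs intro!: mult_left_le power_le_one)
      also have "\<dots> \<le> (\<Sum>k<n. \<Sum>i<n. \<bar>H $$ (k,i)\<bar>)"
        using member_le_sum[of k "{..<n}" "\<lambda>k. \<Sum>i<n. \<bar>H $$ (k,i)\<bar>"] k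
        by (auto simp: n_def intro: sum_nonneg)
      finally show ?thesis by (simp add: X_def)
    qed
    fix l assume l: "l \<le> p"
    have "(\<integral>u. indicator {0<..<1} u * (\<chi> k u * u ^ l) \<partial>lborel) =
        (\<integral>u. (\<Sum>i<n. H $$ (k,i) * (indicator {0<..<1} u * u ^ (i + l))) \<partial>lborel)"
      by (intro Bochner_Integration.integral_cong)
        (auto simp: \<chi>_def sum_distrib_left sum_distrib_right power_add algebra_simps)
    also have "\<dots> = (\<Sum>i<n. H $$ (k,i) * (1 / (real (i + l) + 1)))"
      by (simp only: Bochner_Integration.integral_sum integrable_mult_right
          integral_power_open_unit_interval integral_mult_right_zero)
    also have "\<dots> = (H * G) $$ (k,l)"
      using H(1) k l by (simp add: G_def n_def scalar_prod_def atLeast0LessThan)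
    also have "\<dots> = (if k = l then 1 else 0)" using k l by (simp add: H(2) n_def)
    finally show "(\<integral>u. indicator {0<..<1} u * (\<chi> k u * u ^ l) \<partial>lborel) = (if k = l then 1 else 0)" .
  qed
qed

section \<open>Functions dual to the B-splines on one knot span\<close>

text \<open>
  Marsden's identity in the variable \<open>u = (x - a) / L\<close> of the span, read off at the power \<open>v\<^sup>p\<^sup>-\<^sup>k\<close> of its
  free variable \<open>v\<close>.
\<close>

lemma marsden_monomials:
  assumes mono: "mono_on {1..N} \<xi>" and "1 \<le> s" "s + 2*p + 1 \<le> N"
    and a: "a = \<xi> (s+p)" and L: "L = \<xi> (s+p+1) - \<xi> (s+p)" "0 < L"
    and u: "0 \<le> u" "u < 1" and k: "k \<le> p"
  shows "u ^ k = (\<Sum>j=s..s+p. (-1) ^ k * coeff (\<Prod>l=j+1..j+p. [:- ((\<xi> l - a) / L), 1:]) (p - k)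
      / real (p choose k) * bspline \<xi> p j (a + L * u))"
proof -
  define Q where "Q = (\<lambda>j. \<Prod>l=j+1..j+p. [:- ((\<xi> l - a) / L), 1:])"
  define b where "b = (\<lambda>j. bspline \<xi> p j (a + L * u))"
  have x: "\<xi> (s+p) \<le> a + L * u" "a + L * u < \<xi> (s+p+1)"
  proof -
    show "\<xi> (s+p) \<le> a + L * u" using a L u by simp
    have "L * u < L" using L u by simp
    moreover have "a + L = \<xi> (s+p+1)" using a L(1) by simp
    ultimately show "a + L * u < \<xi> (s+p+1)" by linarith
  qed
  have "poly ([:- u, 1:] ^ p) v = poly (\<Sum>j=s..s+p. Polynomial.smult (b j) (Q j)) v" for v
  proof -
    have "L ^ p * (v - u) ^ p = (a + L * v - (a + L * u)) ^ p"
      by (simp add: power_mult_distrib[symmetric] algebra_simps)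
    also have "\<dots> = (\<Sum>j=s..s+p. (\<Prod>l=j+1..j+p. a + L * v - \<xi> l) * b j)"
      unfolding b_def using marsden_identity[OF mono assms(2,3) x] .
    also have "\<dots> = (\<Sum>j=s..s+p. L ^ p * (poly (Q j) v * b j))"
    proof (rule sum.cong[OF refl])
      fix j
      have "(\<Prod>l=j+1..j+p. a + L * v - \<xi> l) = (\<Prod>l=j+1..j+p. L * (v - (\<xi> l - a) / L))"
        using L(2) by (intro prod.cong) (auto simp: field_simps)
      also have "\<dots> = L ^ p * poly (Q j) v"
        unfolding prod.distrib by (simp add: Q_def poly_prod)
      finally show "(\<Prod>l=j+1..j+p. a + L * v - \<xi> l) * b j = L ^ p * (poly (Q j) v * b j)" by simp
    qed
    also have "\<dots> = L ^ p * (\<Sum>j=s..s+p. poly (Q j) v * b j)" by (simp only: sum_distrib_left)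
    finally have "(v - u) ^ p = (\<Sum>j=s..s+p. poly (Q j) v * b j)" using L(2) by simp
    thus ?thesis by (simp add: poly_sum poly_power mult.commute)
  qed
  hence "[:- u, 1:] ^ p = (\<Sum>j=s..s+p. Polynomial.smult (b j) (Q j))"
    by (subst poly_eq_poly_eq_iff[symmetric]) (rule ext)
  hence "coeff ([:- u, 1:] ^ p) (p - k) = (\<Sum>j=s..s+p. b j * coeff (Q j) (p - k))"
    by (simp add: coeff_sum)
  moreover have "coeff ([:- u, 1:] ^ p) (p - k) = real (p choose k) * (- u) ^ k"
    using k coeff_linear_poly_power[of "p - k" p "- u" 1] by (simp add: binomial_symmetric[of k p])
  ultimately have "(- u) ^ k = (\<Sum>j=s..s+p. b j * coeff (Q j) (p - k)) / real (p choose k)"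
    using k by (simp add: field_simps)
  moreover have "u ^ k = (-1) ^ k * (- u) ^ k"
    by (simp add: power_mult_distrib[symmetric])
  ultimately show ?thesis
    by (simp add: Q_def b_def sum_distrib_left sum_divide_distrib mult_ac)
qed

lemma poly_eq_if_eq_on_unit_interval:
  fixes P Q :: "real poly"
  assumes "\<And>u. 0 < u \<Longrightarrow> u < 1 \<Longrightarrow> poly P u = poly Q u"
  shows "P = Q"
proof (rule ccontr)
  assume "P \<noteq> Q"
  hence "finite {u. poly (P - Q) u = 0}" by (intro poly_roots_finite) simp
  moreover have "{0<..<1} \<subseteq> {u. poly (P - Q) u = 0}" using assms by auto
  ultimately have "finite {0<..<1::real}" by (rule finite_subset[rotated])
  thus False using infinite_Ioo[of 0 "1::real"] by simp
qed

lemma poly_eq_sum_atMost: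
  fixes P :: "real poly"
  assumes "degree P \<le> n"
  shows "poly P x = (\<Sum>i\<le>n. coeff P i * x ^ i)"
  unfolding poly_altdef
  by (rule sum.mono_neutral_left) (use assms in \<open>auto simp: coeff_eq_0\<close>)

text \<open>
  Let \<open>A\<close> be the matrix of the coefficients in \<open>marsden_monomials\<close> and \<open>B\<close> that of the coefficients of
  the B-splines as polynomials in the span variable. Comparing coefficients gives \<open>A B = 1\<close>, hence \<open>B A = 1\<close>,
  so combining the duals of the monomials with the columns of \<open>A\<close> gives functions dual to the B-splines. Only \<open>A\<close>,
  whose entries are bounded explicitly, enters the size of the dual functions.
\<close>

lemma bspline_local_dual:
  assumes T: "0 \<le> T"
  shows "\<exists>C>0. \<forall>N \<xi> s. mono_on {1..N} \<xi> \<and> 1 \<le> s \<and> s + 2*p + 1 \<le> N \<and> \<xi> (s+p) < \<xi> (s+p+1) \<and>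
      (\<forall>l\<in>{s+1..s+2*p}. \<bar>\<xi> l - \<xi> (s+p)\<bar> \<le> T * (\<xi> (s+p+1) - \<xi> (s+p))) \<longrightarrow>
      (\<forall>i\<in>{s..s+p}. \<exists>\<psi>. \<psi> \<in> borel_measurable borel \<and>
        (\<forall>x. \<bar>\<psi> x\<bar> \<le> C / (\<xi> (s+p+1) - \<xi> (s+p)) * indicator {\<xi> (s+p)<..<\<xi> (s+p+1)} x) \<and>
        (\<forall>j\<in>{s..s+p}. (\<integral>x. \<psi> x * bspline \<xi> p j x \<partial>lborel) = (if i = j then 1 else 0)))"
proof -
  obtain \<chi> :: "nat \<Rightarrow> real \<Rightarrow> real" and X where \<chi>[measurable]: "\<And>k. \<chi> k \<in> borel_measurable borel" and X: "0 < X"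
    and \<chi>X: "\<And>k u. k \<le> p \<Longrightarrow> 0 < u \<Longrightarrow> u < 1 \<Longrightarrow> \<bar>\<chi> k u\<bar> \<le> X"
    and dual: "\<And>k l. k \<le> p \<Longrightarrow> l \<le> p \<Longrightarrow>
      (\<integral>u. indicator {0<..<1} u * (\<chi> k u * u ^ l) \<partial>lborel) = (if k = l then 1 else 0)"
    by (rule monomial_dual_functions[of p]) (rule that)
  have int\<chi>: "integrable lborel (\<lambda>u. indicator {0<..<1} u * (\<chi> k u * u ^ l))" if "k \<le> p" for k l
  proof -
    have "\<bar>\<chi> k u * u ^ l\<bar> \<le> X" if "0 < u" "u < 1" for u
      using mult_mono[of "\<bar>\<chi> k u\<bar>" X "\<bar>u ^ l\<bar>" 1] \<chi>X[OF \<open>k \<le> p\<close>] that X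
      by (simp add: abs_mult power_abs power_le_one)
    thus ?thesis
      using integrableI_bounded_set_indicator[of "{0<..<1}" lborel "\<lambda>u. \<chi> k u * u ^ l" X]
      by (auto simp: AE_I2)
  qed
  define C where "C = (1 + real p) * ((1 + T) ^ p * X)"
  show ?thesis
  proof (intro exI[of _ C] conjI allI impI ballI)
    show "0 < C" using T X by (auto simp: C_def)
    fix N :: nat and \<xi> :: "nat \<Rightarrow> real" and s i :: nat
    assume knots: "mono_on {1..N} \<xi> \<and> 1 \<le> s \<and> s + 2*p + 1 \<le> N \<and> \<xi> (s+p) < \<xi> (s+p+1) \<and>
      (\<forall>l\<in>{s+1..s+2*p}. \<bar>\<xi> l - \<xi> (s+p)\<bar> \<le> T * (\<xi> (s+p+1) - \<xi> (s+p)))"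
      and i: "i \<in> {s..s+p}"
    have mono: "mono_on {1..N} \<xi>" and s: "1 \<le> s" "s + 2*p + 1 \<le> N"
      and span: "\<xi> (s+p) < \<xi> (s+p+1)"
      and near: "\<And>l. l \<in> {s+1..s+2*p} \<Longrightarrow> \<bar>\<xi> l - \<xi> (s+p)\<bar> \<le> T * (\<xi> (s+p+1) - \<xi> (s+p))"
      using knots by blast+
    define a where "a = \<xi> (s+p)"
    define L where "L = \<xi> (s+p+1) - \<xi> (s+p)"
    have L: "0 < L" and aL: "a + L = \<xi> (s+p+1)" using span by (auto simp: L_def a_def)
    define c where "c = (\<lambda>k j. (-1) ^ k * coeff (\<Prod>l=j+1..j+p. [:- ((\<xi> l - a) / L), 1:]) (p - k) / real (p choose k))"
    have monomials: "u ^ k = (\<Sum>j=s..s+p. c k j * bspline \<xi> p j (a + L * u))"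
      if "0 < u" "u < 1" "k \<le> p" for u k
      using marsden_monomials[OF mono s a_def L_def L _ that(2,3)] that(1) by (simp add: c_def)
    have c_bound: "\<bar>c k j\<bar> \<le> (1 + T) ^ p" if "j \<in> {s..s+p}" "k \<le> p" for k j
    proof -
      have "\<bar>coeff (\<Prod>l\<in>{j+1..j+p}. [:- ((\<xi> l - a) / L), 1:]) (p - k)\<bar> \<le> (1 + T) ^ card {j+1..j+p}"
      proof (rule coeff_prod_linear_bound[OF _ _ T])
        fix l assume "l \<in> {j+1..j+p}"
        hence "\<bar>\<xi> l - a\<bar> \<le> T * L" using near[of l] that by (auto simp: a_def L_def)
        thus "\<bar>(\<xi> l - a) / L\<bar> \<le> T" using L by (simp add: field_simps)
      qed simp
      hence "\<bar>coeff (\<Prod>l\<in>{j+1..j+p}. [:- ((\<xi> l - a) / L), 1:]) (p - k)\<bar> \<le> (1 + T) ^ p" by simp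
      moreover have "1 \<le> real (p choose k)" using that(2) by (simp add: Suc_leI)
      ultimately have "\<bar>coeff (\<Prod>l\<in>{j+1..j+p}. [:- ((\<xi> l - a) / L), 1:]) (p - k)\<bar> / real (p choose k) \<le> (1 + T) ^ p / 1"
        by (intro frac_le) auto
      thus ?thesis by (simp add: c_def abs_mult power_abs)
    qed
    have ex_P: "\<exists>P. degree P \<le> p \<and> (\<forall>x\<in>{\<xi> (s+p)..<\<xi> (s+p+1)}. bspline \<xi> p j x = poly P x)"
      if "j \<in> {s..s+p}" for j
      using bspline_poly_on_span[OF mono, of "s+p" j p] that s by auto
    define P where "P = (\<lambda>j. SOME P. degree P \<le> p \<and>
      (\<forall>x\<in>{\<xi> (s+p)..<\<xi> (s+p+1)}. bspline \<xi> p j x = poly P x))"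
    have "degree (P j) \<le> p \<and> (\<forall>x\<in>{\<xi> (s+p)..<\<xi> (s+p+1)}. bspline \<xi> p j x = poly (P j) x)"
      if "j \<in> {s..s+p}" for j
      unfolding P_def by (rule someI_ex[OF ex_P[OF that]])
    hence P: "\<And>j. j \<in> {s..s+p} \<Longrightarrow> degree (P j) \<le> p"
      "\<And>j x. j \<in> {s..s+p} \<Longrightarrow> x \<in> {\<xi> (s+p)..<\<xi> (s+p+1)} \<Longrightarrow> bspline \<xi> p j x = poly (P j) x"
      by auto
    define R where "R = (\<lambda>j. pcompose (P j) [:a, L:])"
    have degR: "degree (R j) \<le> p" if "j \<in> {s..s+p}" for j
      using degree_pcompose_le[of "P j" "[:a, L:]"] P(1)[OF that] L by (simp add: R_def)
    have R: "bspline \<xi> p j (a + L * u) = (\<Sum>l\<le>p. coeff (R j) l * u ^ l)"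
      if "j \<in> {s..s+p}" "0 < u" "u < 1" for j u
    proof -
      have "L * u < L" "0 < L * u" using L that by auto
      hence "a + L * u \<in> {\<xi> (s+p)..<\<xi> (s+p+1)}" using aL by (simp add: a_def)
      hence "bspline \<xi> p j (a + L * u) = poly (R j) u"
        using P(2)[OF that(1)] by (simp add: R_def poly_pcompose mult.commute)
      thus ?thesis using poly_eq_sum_atMost[OF degR[OF that(1)]] by simp
    qed
    \<comment> \<open>Both sides of the expansion of a monomial are polynomials on the span, so their coefficients agree.\<close>
    have AB: "(\<Sum>j=s..s+p. c k j * coeff (R j) l) = (if k = l then 1 else 0)" if "k \<le> p" "l \<le> p" for k l
    proof -
      have "monom 1 k = (\<Sum>j=s..s+p. Polynomial.smult (c k j) (R j))"
      proof (rule poly_eq_if_eq_on_unit_interval)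
        fix u :: real assume u: "0 < u" "u < 1"
        have "poly (R j) u = bspline \<xi> p j (a + L * u)" if "j \<in> {s..s+p}" for j
          using R[OF that u] poly_eq_sum_atMost[OF degR[OF that]] by simp
        thus "poly (monom 1 k) u = poly (\<Sum>j=s..s+p. Polynomial.smult (c k j) (R j)) u"
          using monomials[OF u \<open>k \<le> p\<close>] by (simp add: poly_monom poly_sum)
      qed
      hence "coeff (monom 1 k) l = (\<Sum>j=s..s+p. c k j * coeff (R j) l)" by (simp add: coeff_sum)
      thus ?thesis by simp
    qed
    define A where "A = Matrix.mat (Suc p) (Suc p) (\<lambda>(k,j). c k (s+j))"
    define B where "B = Matrix.mat (Suc p) (Suc p) (\<lambda>(j,l). coeff (R (s+j)) l)"
    have carr: "A \<in> carrier_mat (Suc p) (Suc p)" "B \<in> carrier_mat (Suc p) (Suc p)"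
      by (auto simp: A_def B_def)
    have shift: "(\<Sum>j=s..s+p. f j) = (\<Sum>j<Suc p. f (s + j))" for f :: "nat \<Rightarrow> real"
      using sum.shift_bounds_cl_nat_ivl[of f 0 s p] by (simp add: add.commute atLeast0AtMost lessThan_Suc_atMost)
    have "A * B = 1\<^sub>m (Suc p)"
    proof (rule eq_matI)
      fix k l assume "k < dim_row (1\<^sub>m (Suc p) :: real mat)" "l < dim_col (1\<^sub>m (Suc p) :: real mat)"
      hence kl: "k \<le> p" "l \<le> p" by auto
      have "(A * B) $$ (k,l) = (\<Sum>j<Suc p. c k (s+j) * coeff (R (s+j)) l)"
        using kl by (simp add: A_def B_def scalar_prod_def atLeast0LessThan)
      thus "(A * B) $$ (k,l) = 1\<^sub>m (Suc p) $$ (k,l)"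
        using AB[OF kl] kl unfolding shift by simp
    qed (use carr in auto)
    hence BA: "B * A = 1\<^sub>m (Suc p)" by (rule mat_mult_left_right_inverse[OF carr])
    have BA': "(\<Sum>k\<le>p. c k i * coeff (R j) k) = (if i = j then 1 else 0)" if "j \<in> {s..s+p}" for j
    proof -
      have ij: "i - s < Suc p" "j - s < Suc p" and eqs: "s + (i - s) = i" "s + (j - s) = j"
        using i that by auto
      have "(B * A) $$ (j - s, i - s) = (\<Sum>k<Suc p. coeff (R j) k * c k i)"
        using ij eqs by (simp add: A_def B_def scalar_prod_def atLeast0LessThan del: sum.lessThan_Suc)
      moreover have "(B * A) $$ (j - s, i - s) = (if i = j then 1 else 0)"
        unfolding BA using ij eqs by auto
      ultimately show ?thesis by (simp add: lessThan_Suc_atMost mult.commute)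
    qed
    define \<psi> where "\<psi> = (\<lambda>x. indicator {a<..<a+L} x * ((\<Sum>k\<le>p. c k i * \<chi> k ((x - a) / L)) / L))"
    show "\<exists>\<psi>. \<psi> \<in> borel_measurable borel \<and>
        (\<forall>x. \<bar>\<psi> x\<bar> \<le> C / (\<xi> (s+p+1) - \<xi> (s+p)) * indicator {\<xi> (s+p)<..<\<xi> (s+p+1)} x) \<and>
        (\<forall>j\<in>{s..s+p}. (\<integral>x. \<psi> x * bspline \<xi> p j x \<partial>lborel) = (if i = j then 1 else 0))"
    proof (intro exI[of _ \<psi>] conjI allI ballI)
      show "\<psi> \<in> borel_measurable borel" unfolding \<psi>_def by measurable
      show "\<bar>\<psi> x\<bar> \<le> C / (\<xi> (s+p+1) - \<xi> (s+p)) * indicator {\<xi> (s+p)<..<\<xi> (s+p+1)} x" for x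
      proof (cases "a < x \<and> x < a + L")
        case True
        hence u: "0 < (x - a) / L" "(x - a) / L < 1" using L by (auto simp: field_simps)
        have "\<bar>\<Sum>k\<le>p. c k i * \<chi> k ((x - a) / L)\<bar> \<le> (\<Sum>k\<le>p. \<bar>c k i * \<chi> k ((x - a) / L)\<bar>)"
          by (rule sum_abs)
        also have "\<dots> \<le> (\<Sum>k\<le>p. (1 + T) ^ p * X)"
          unfolding abs_mult using c_bound[OF i] \<chi>X u X T by (intro sum_mono mult_mono) auto
        also have "\<dots> = C" by (simp add: C_def)
        finally have "\<bar>\<Sum>k\<le>p. c k i * \<chi> k ((x - a) / L)\<bar> / L \<le> C / L"
          using L by (intro divide_right_mono) auto
        thus ?thesis using True L by (simp add: \<psi>_def a_def L_def abs_mult)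
      next
        case False
        hence "\<psi> x = 0" by (auto simp: \<psi>_def)
        thus ?thesis using L \<open>0 < C\<close> by (simp add: L_def)
      qed
      fix j assume j: "j \<in> {s..s+p}"
      have "(\<integral>x. \<psi> x * bspline \<xi> p j x \<partial>lborel) = L * (\<integral>u. \<psi> (a + L * u) * bspline \<xi> p j (a + L * u) \<partial>lborel)"
        using lborel_integral_real_affine[of L "\<lambda>x. \<psi> x * bspline \<xi> p j x" a] L by simp
      also have "\<dots> = (\<integral>u. L * (\<psi> (a + L * u) * bspline \<xi> p j (a + L * u)) \<partial>lborel)" by simp
      also have "\<dots> = (\<integral>u. (\<Sum>k\<le>p. \<Sum>l\<le>p. c k i * coeff (R j) l * (indicator {0<..<1} u * (\<chi> k u * u ^ l))) \<partial>lborel)"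
      proof (rule Bochner_Integration.integral_cong[OF refl])
        fix u
        have mem: "a + L * u \<in> {a<..<a+L} \<longleftrightarrow> u \<in> {0<..<1}" using L by (simp add: zero_less_mult_iff)
        show "L * (\<psi> (a + L * u) * bspline \<xi> p j (a + L * u)) =
            (\<Sum>k\<le>p. \<Sum>l\<le>p. c k i * coeff (R j) l * (indicator {0<..<1} u * (\<chi> k u * u ^ l)))"
        proof (cases "u \<in> {0<..<1}")
          case True
          hence "L * (\<psi> (a + L * u) * bspline \<xi> p j (a + L * u)) =
              (\<Sum>k\<le>p. c k i * \<chi> k u) * (\<Sum>l\<le>p. coeff (R j) l * u ^ l)"
            using mem L R[OF j, of u] by (simp add: \<psi>_def)
          thus ?thesis using True by (simp add: sum_product mult_ac)
        next
          case False
          thus ?thesis using mem by (simp add: \<psi>_def)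
        qed
      qed
      also have "\<dots> = (\<Sum>k\<le>p. \<Sum>l\<le>p. c k i * coeff (R j) l * (if k = l then 1 else 0))"
      proof -
        have "integrable lborel (\<lambda>u. c k i * coeff (R j) l * (indicator {0<..<1} u * (\<chi> k u * u ^ l)))"
          if "k \<le> p" for k l using int\<chi>[OF that] by (intro integrable_mult_right)
        thus ?thesis using dual
          by (subst Bochner_Integration.integral_sum, force)
            (intro sum.cong refl, subst Bochner_Integration.integral_sum, auto)
      qed
      also have "\<dots> = (\<Sum>k\<le>p. c k i * coeff (R j) k)"
        by (intro sum.cong) (auto simp: if_distrib[of "\<lambda>x. _ * x"] cong: if_cong)
      also have "\<dots> = (if i = j then 1 else 0)" by (rule BA'[OF j])
      finally show "(\<integral>x. \<psi> x * bspline \<xi> p j x \<partial>lborel) = (if i = j then 1 else 0)" .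
    qed
  qed
qed

section \<open>Open knot vectors\<close>

lemma open_knot_vector_mono:
  assumes "open_knot_vector m p \<xi>"
  shows "mono_on {1..m+p+1} \<xi>"
proof (rule mono_onI)
  fix r s assume rs: "r \<in> {1..m+p+1}" "s \<in> {1..m+p+1}" "r \<le> s"
  have step: "\<xi> i \<le> \<xi> (Suc i)" if "i \<in> {1..m+p}" for i
    using assms that by (auto simp: open_knot_vector_def)
  have "s \<le> m+p+1 \<longrightarrow> \<xi> r \<le> \<xi> s" using \<open>r \<le> s\<close>
  proof (induction s rule: dec_induct)
    case (step n)
    thus ?case using rs(1) \<open>\<And>i. i \<in> {1..m+p} \<Longrightarrow> \<xi> i \<le> \<xi> (Suc i)\<close>[of n] by auto
  qed simp
  thus "\<xi> r \<le> \<xi> s" using rs by simp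
qed

lemma open_knot_vector_boundary:
  assumes "open_knot_vector m p \<xi>"
  shows "\<And>i. 1 \<le> i \<Longrightarrow> i \<le> p+1 \<Longrightarrow> \<xi> i = 0" "\<And>i. m+1 \<le> i \<Longrightarrow> i \<le> m+p+1 \<Longrightarrow> \<xi> i = 1"
  using assms by (auto simp: open_knot_vector_def)

lemma open_knot_vector_size:
  assumes "open_knot_vector m p \<xi>"
  shows "p + 1 \<le> m"
proof (rule ccontr)
  assume "\<not> p + 1 \<le> m"
  hence "\<xi> (m+1) = 0" "\<xi> (m+1) = 1" using open_knot_vector_boundary[OF assms, of "m+1"] by auto
  thus False by simp
qed

lemma open_knot_vector_in_unit_interval:
  assumes "open_knot_vector m p \<xi>" "i \<in> {1..m+p+1}"
  shows "0 \<le> \<xi> i" "\<xi> i \<le> 1"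
proof -
  have "\<xi> 1 \<le> \<xi> i" "\<xi> i \<le> \<xi> (m+p+1)"
    using assms(2) by (auto intro: mono_onD[OF open_knot_vector_mono[OF assms(1)]])
  thus "0 \<le> \<xi> i" "\<xi> i \<le> 1"
    using open_knot_vector_boundary[OF assms(1), of 1] open_knot_vector_boundary[OF assms(1), of "m+p+1"] by auto
qed

text \<open>
  An interior knot cannot be repeated \<open>p + 2\<close> times, and neither end knot reaches the other end of a
  support because \<open>\<xi>\<^sub>p\<^sub>+\<^sub>2 > 0\<close> and \<open>\<xi>\<^sub>m < 1\<close>.
\<close>

lemma open_knot_vector_support_nonempty:
  assumes \<xi>: "open_knot_vector m p \<xi>" and i: "i \<in> {1..m}"
  shows "\<xi> i < \<xi> (i+p+1)"
proof -
  note mono = mono_onD[OF open_knot_vector_mono[OF \<xi>]]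
  have m: "p + 1 \<le> m" by (rule open_knot_vector_size[OF \<xi>])
  have first: "0 < \<xi> (p+2)" and last: "\<xi> m < 1" using \<xi> by (auto simp: open_knot_vector_def)
  consider "i \<le> p+1" | "m < i+p+1" | "p+2 \<le> i" "i+p+1 \<le> m" by linarith
  thus ?thesis
  proof cases
    case 1
    have "\<xi> (p+2) \<le> \<xi> (i+p+1)" using i m by (intro mono) auto
    thus ?thesis using 1 i first open_knot_vector_boundary(1)[OF \<xi>, of i] by auto
  next
    case 2
    have "\<xi> i \<le> \<xi> m" using i m by (intro mono) auto
    thus ?thesis using 2 i last open_knot_vector_boundary(2)[OF \<xi>, of "i+p+1"] by auto
  next
    case 3
    show ?thesis
    proof (rule ccontr)
      assume "\<not> \<xi> i < \<xi> (i+p+1)"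
      moreover have "\<xi> i \<le> \<xi> j" "\<xi> j \<le> \<xi> (i+p+1)" if "j \<in> {i..i+p+1}" for j
        using that 3 by (auto intro!: mono)
      ultimately have eq: "\<xi> j = \<xi> i" if "j \<in> {i..i+p+1}" for j using that by force
      have "{i..i+p+1} \<subseteq> {j\<in>{p+2..m}. \<xi> j = \<xi> i}"
      proof
        fix j assume j: "j \<in> {i..i+p+1}"
        thus "j \<in> {j\<in>{p+2..m}. \<xi> j = \<xi> i}" using eq[OF j] 3 by simp
      qed
      hence "card {i..i+p+1} \<le> card {j\<in>{p+2..m}. \<xi> j = \<xi> i}" by (intro card_mono) auto
      moreover have "card {j\<in>{p+2..m}. \<xi> j = \<xi> i} \<le> p"
        using \<xi> 3 unfolding open_knot_vector_def by auto
      ultimately show False by simp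
    qed
  qed
qed

lemma knot_distance_le:
  fixes \<xi> :: "nat \<Rightarrow> real"
  assumes "\<And>i. i \<in> {a..<a+n} \<Longrightarrow> \<xi> (i+1) - \<xi> i \<le> h"
  shows "\<xi> (a+n) - \<xi> a \<le> real n * h"
  using assms
proof (induction n)
  case (Suc n)
  have "\<xi> (a+n) - \<xi> a \<le> real n * h" by (rule Suc.IH) (use Suc.prems in auto)
  moreover have "\<xi> (a+n+1) - \<xi> (a+n) \<le> h" by (rule Suc.prems) auto
  ultimately show ?case by (simp add: algebra_simps)
qed simp

text \<open>
  If \<open>i\<^sub>0\<close> is the least active index, then \<open>x < \<xi> (i\<^sub>0 + p + 1)\<close> excludes all indices from \<open>i\<^sub>0 + p + 1\<close> on.
\<close>

lemma card_active_bsplines: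
  fixes \<xi> :: "nat \<Rightarrow> real"
  assumes "mono_on {1..m+p+1} \<xi>"
  shows "card {i\<in>{1..m}. \<xi> i \<le> x \<and> x < \<xi> (i+p+1)} \<le> p + 1"
proof (cases "{i\<in>{1..m}. \<xi> i \<le> x \<and> x < \<xi> (i+p+1)} = {}")
  case True
  show ?thesis unfolding True by simp
next
  case False
  define A where "A = {i\<in>{1..m}. \<xi> i \<le> x \<and> x < \<xi> (i+p+1)}"
  have fin: "finite A" by (simp add: A_def)
  define i0 where "i0 = Min A"
  have i0: "i0 \<in> A" unfolding i0_def using False by (intro Min_in fin) (simp add: A_def)
  have "i < i0 + p + 1" if "i \<in> A" for i
  proof (rule ccontr)
    assume "\<not> i < i0 + p + 1"
    hence "\<xi> (i0+p+1) \<le> \<xi> i" using that i0 by (intro mono_onD[OF assms]) (auto simp: A_def)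
    moreover have "\<xi> i \<le> x" "x < \<xi> (i0+p+1)" using that i0 by (auto simp: A_def)
    ultimately show False by linarith
  qed
  hence "A \<subseteq> {i0..<i0+p+1}" using fin by (auto simp: i0_def)
  hence "card A \<le> card {i0..<i0+p+1}" by (intro card_mono) auto
  thus ?thesis by (simp add: A_def)
qed

text \<open>
  The support of a B-spline contains a nonempty knot span, of length at least \<open>\<alpha> h\<close>. The neighbouring knots are
  within \<open>p h\<close> of it, that is, within \<open>p / \<alpha>\<close> times its length, and the local dual functions apply. The
  B-splines that do not appear in the local duality vanish on the span.
\<close>

lemma bspline_dual:
  assumes \<alpha>: "0 < \<alpha>"
  shows "\<exists>C>0. \<forall>m \<xi> h. open_knot_vector m p \<xi> \<and> 0 < h \<and>
      (\<forall>l\<in>{1..m+p}. \<xi> (l+1) - \<xi> l \<le> h) \<and>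
      (\<forall>l\<in>{1..m+p}. \<xi> l < \<xi> (l+1) \<longrightarrow> \<alpha> * h \<le> \<xi> (l+1) - \<xi> l) \<longrightarrow>
      (\<forall>i\<in>{1..m}. \<exists>\<psi>. \<psi> \<in> borel_measurable borel \<and>
        (\<forall>x. \<bar>\<psi> x\<bar> \<le> C / h * indicator ({\<xi> i..<\<xi> (i+p+1)} \<inter> {0<..<1}) x) \<and>
        (\<forall>j\<in>{1..m}. (\<integral>x. \<psi> x * bspline \<xi> p j x \<partial>lborel) = (if i = j then 1 else 0)))"
proof -
  define T where "T = real p / \<alpha>"
  have T: "0 \<le> T" using \<alpha> by (simp add: T_def)
  obtain C0 where C0: "0 < C0"
    "\<forall>N \<xi> s. mono_on {1..N} \<xi> \<and> 1 \<le> s \<and> s + 2*p + 1 \<le> N \<and> \<xi> (s+p) < \<xi> (s+p+1) \<and>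
      (\<forall>l\<in>{s+1..s+2*p}. \<bar>\<xi> l - \<xi> (s+p)\<bar> \<le> T * (\<xi> (s+p+1) - \<xi> (s+p))) \<longrightarrow>
      (\<forall>i\<in>{s..s+p}. \<exists>\<psi>. \<psi> \<in> borel_measurable borel \<and>
        (\<forall>x. \<bar>\<psi> x\<bar> \<le> C0 / (\<xi> (s+p+1) - \<xi> (s+p)) * indicator {\<xi> (s+p)<..<\<xi> (s+p+1)} x) \<and>
        (\<forall>j\<in>{s..s+p}. (\<integral>x. \<psi> x * bspline \<xi> p j x \<partial>lborel) = (if i = j then 1 else 0)))"
    using bspline_local_dual[OF T, of p] by (elim exE conjE) (rule that)
  show ?thesis
  proof (intro exI[of _ "C0 / \<alpha>"] conjI allI impI ballI)
    show "0 < C0 / \<alpha>" using C0(1) \<alpha> by simp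
    fix m \<xi> h i
    assume knots: "open_knot_vector m p \<xi> \<and> 0 < h \<and>
      (\<forall>l\<in>{1..m+p}. \<xi> (l+1) - \<xi> l \<le> h) \<and>
      (\<forall>l\<in>{1..m+p}. \<xi> l < \<xi> (l+1) \<longrightarrow> \<alpha> * h \<le> \<xi> (l+1) - \<xi> l)"
      and i: "i \<in> {1..m}"
    have \<xi>: "open_knot_vector m p \<xi>" and h: "0 < h"
      and mesh: "\<And>l. l \<in> {1..m+p} \<Longrightarrow> \<xi> (l+1) - \<xi> l \<le> h"
      and qu: "\<And>l. l \<in> {1..m+p} \<Longrightarrow> \<xi> l < \<xi> (l+1) \<Longrightarrow> \<alpha> * h \<le> \<xi> (l+1) - \<xi> l"
      using knots by blast+
    note mono = open_knot_vector_mono[OF \<xi>]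
    have m: "p + 1 \<le> m" by (rule open_knot_vector_size[OF \<xi>])
    have "\<exists>r\<in>{i..i+p}. \<xi> r < \<xi> (r+1)"
    proof (rule ccontr)
      assume none: "\<not> ?thesis"
      have "\<xi> (i+(p+1)) - \<xi> i \<le> real (p+1) * 0"
      proof (rule knot_distance_le)
        fix l assume "l \<in> {i..<i+(p+1)}"
        thus "\<xi> (l+1) - \<xi> l \<le> 0" using none by (auto simp: not_less)
      qed
      hence "\<xi> (i+p+1) \<le> \<xi> i" by (simp add: add.assoc)
      with open_knot_vector_support_nonempty[OF \<xi> i] show False by simp
    qed
    then obtain r where r: "r \<in> {i..i+p}" "\<xi> r < \<xi> (r+1)" by blast
    have rp: "p + 1 \<le> r"
    proof (rule ccontr)
      assume "\<not> p + 1 \<le> r"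
      thus False using r i open_knot_vector_boundary(1)[OF \<xi>, of r]
          open_knot_vector_boundary(1)[OF \<xi>, of "r+1"] by auto
    qed
    have rm: "r \<le> m"
    proof (rule ccontr)
      assume "\<not> r \<le> m"
      thus False using r i open_knot_vector_boundary(2)[OF \<xi>, of r]
          open_knot_vector_boundary(2)[OF \<xi>, of "r+1"] by auto
    qed
    define s where "s = r - p"
    have s: "1 \<le> s" "s + 2*p + 1 \<le> m+p+1" "s + p = r" using rp rm by (auto simp: s_def)
    have L: "\<alpha> * h \<le> \<xi> (r+1) - \<xi> r" using qu[of r] r rp rm by auto
    have near: "\<bar>\<xi> l - \<xi> (s+p)\<bar> \<le> T * (\<xi> (s+p+1) - \<xi> (s+p))" if l: "l \<in> {s+1..s+2*p}" for l
    proof -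
      have "\<bar>\<xi> l - \<xi> r\<bar> \<le> real p * h"
      proof (cases "l \<le> r")
        case True
        have "\<xi> (l + (r - l)) - \<xi> l \<le> real (r - l) * h"
          by (rule knot_distance_le) (use mesh l s rm True in auto)
        also have "\<dots> \<le> real p * h" using l s h by (intro mult_right_mono) auto
        moreover have "\<xi> l \<le> \<xi> r" using True l s rm by (intro mono_onD[OF mono]) auto
        ultimately show ?thesis using True by simp
      next
        case False
        have "\<xi> (r + (l - r)) - \<xi> r \<le> real (l - r) * h"
          by (rule knot_distance_le) (use mesh l s rm False in auto)
        also have "\<dots> \<le> real p * h" using l s h by (intro mult_right_mono) auto
        moreover have "\<xi> r \<le> \<xi> l" using False l s rm by (intro mono_onD[OF mono]) auto
        ultimately show ?thesis using False by simp
      qed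
      also have "\<dots> = T * (\<alpha> * h)" using \<alpha> by (simp add: T_def)
      also have "\<dots> \<le> T * (\<xi> (r+1) - \<xi> r)" using L T by (rule mult_left_mono)
      finally show ?thesis by (simp add: s(3))
    qed
    have "\<exists>\<psi>. \<psi> \<in> borel_measurable borel \<and>
        (\<forall>x. \<bar>\<psi> x\<bar> \<le> C0 / (\<xi> (s+p+1) - \<xi> (s+p)) * indicator {\<xi> (s+p)<..<\<xi> (s+p+1)} x) \<and>
        (\<forall>j\<in>{s..s+p}. (\<integral>x. \<psi> x * bspline \<xi> p j x \<partial>lborel) = (if i = j then 1 else 0))"
    proof (rule C0(2)[rule_format])
      show "i \<in> {s..s+p}" using r i s by auto
      show "mono_on {1..m+p+1} \<xi> \<and> 1 \<le> s \<and> s + 2*p + 1 \<le> m+p+1 \<and> \<xi> (s+p) < \<xi> (s+p+1) \<and>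
          (\<forall>l\<in>{s+1..s+2*p}. \<bar>\<xi> l - \<xi> (s+p)\<bar> \<le> T * (\<xi> (s+p+1) - \<xi> (s+p)))"
      proof (intro conjI ballI)
        show "\<xi> (s+p) < \<xi> (s+p+1)" using r(2) by (simp add: s(3))
      qed (use mono s near in auto)
    qed
    then obtain \<psi> where \<psi>: "\<psi> \<in> borel_measurable borel"
      and bd: "\<And>x. \<bar>\<psi> x\<bar> \<le> C0 / (\<xi> (r+1) - \<xi> r) * indicator {\<xi> r<..<\<xi> (r+1)} x"
      and dual: "\<And>j. j \<in> {s..s+p} \<Longrightarrow> (\<integral>x. \<psi> x * bspline \<xi> p j x \<partial>lborel) = (if i = j then 1 else 0)"
      unfolding s(3) by blast
    show "\<exists>\<psi>. \<psi> \<in> borel_measurable borel \<and>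
        (\<forall>x. \<bar>\<psi> x\<bar> \<le> C0 / \<alpha> / h * indicator ({\<xi> i..<\<xi> (i+p+1)} \<inter> {0<..<1}) x) \<and>
        (\<forall>j\<in>{1..m}. (\<integral>x. \<psi> x * bspline \<xi> p j x \<partial>lborel) = (if i = j then 1 else 0))"
    proof (intro exI[of _ \<psi>] conjI allI ballI \<psi>)
      have sub: "{\<xi> r<..<\<xi> (r+1)} \<subseteq> {\<xi> i..<\<xi> (i+p+1)} \<inter> {0<..<1}"
      proof -
        have "\<xi> i \<le> \<xi> r" "\<xi> (r+1) \<le> \<xi> (i+p+1)" using r i by (auto intro!: mono_onD[OF mono])
        moreover have "0 \<le> \<xi> r" "\<xi> (r+1) \<le> 1"
          using open_knot_vector_in_unit_interval[OF \<xi>] r i rm rp by auto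
        ultimately show ?thesis by auto
      qed
      fix x
      have "C0 / (\<xi> (r+1) - \<xi> r) \<le> C0 / (\<alpha> * h)"
        using L C0(1) \<alpha> h r(2) by (intro divide_left_mono) (auto intro!: mult_pos_pos)
      hence le: "C0 / (\<xi> (r+1) - \<xi> r) \<le> C0 / \<alpha> / h" by simp
      have "C0 / (\<xi> (r+1) - \<xi> r) * indicator {\<xi> r<..<\<xi> (r+1)} x \<le>
          C0 / \<alpha> / h * indicator ({\<xi> i..<\<xi> (i+p+1)} \<inter> {0<..<1}) x"
      proof (cases "x \<in> {\<xi> r<..<\<xi> (r+1)}")
        case True
        thus ?thesis using sub le by (simp add: subset_iff)
      next
        case False
        thus ?thesis using C0(1) \<alpha> h by simp
      qed
      thus "\<bar>\<psi> x\<bar> \<le> C0 / \<alpha> / h * indicator ({\<xi> i..<\<xi> (i+p+1)} \<inter> {0<..<1}) x"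
        using bd[of x] by (rule order_trans[rotated])
    next
      fix j assume j: "j \<in> {1..m}"
      show "(\<integral>x. \<psi> x * bspline \<xi> p j x \<partial>lborel) = (if i = j then 1 else 0)"
      proof (cases "j \<in> {s..s+p}")
        case True
        thus ?thesis by (rule dual)
      next
        case False
        have "\<psi> x * bspline \<xi> p j x = 0" for x
        proof (cases "x \<in> {\<xi> r<..<\<xi> (r+1)}")
          case True
          have "\<xi> (r+1) \<le> \<xi> j \<or> \<xi> (j+p+1) \<le> \<xi> r"
          proof (cases "r < j")
            case True
            thus ?thesis using j rp rm by (intro disjI1 mono_onD[OF mono]) auto
          next
            assume "\<not> r < j"
            thus ?thesis using j False s rp rm by (intro disjI2 mono_onD[OF mono]) auto
          qed
          hence "bspline \<xi> p j x = 0"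
            using True j by (intro bspline_eq_0 mono_on_subset[OF mono]) auto
          thus ?thesis by simp
        next
          case False
          thus ?thesis using bd[of x] by simp
        qed
        hence "(\<lambda>x. \<psi> x * bspline \<xi> p j x) = (\<lambda>_. 0)" by blast
        moreover have "i \<noteq> j" using False r i s by auto
        ultimately show ?thesis by (simp del: mult_eq_0_iff)
      qed
    qed
  qed
qed

section \<open>Integration over the open cube\<close>

text \<open>
  The integrals that define the mass matrix are integrals with respect to a finite measure, for
  which bounded measurable functions are integrable.
\<close>

definition cube_measure :: "nat \<Rightarrow> (nat \<Rightarrow> real) measure" where
  "cube_measure d = restrict_space (PiM {1..d} (\<lambda>_. lborel)) (open_unit_cube d)"

lemma open_unit_cube_sets: "open_unit_cube d \<in> sets (PiM {1..d} (\<lambda>_. lborel))"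
  unfolding open_unit_cube_def by (rule sets_PiM_I_finite) auto

lemma emeasure_open_unit_cube: "emeasure (PiM {1..d} (\<lambda>_. lborel)) (open_unit_cube d) = 1"
proof -
  interpret product_sigma_finite "\<lambda>_::nat. lborel :: real measure" ..
  show ?thesis unfolding open_unit_cube_def by (subst emeasure_PiM) auto
qed

lemma space_cube_measure: "space (cube_measure d) = open_unit_cube d"
  using sets.sets_into_space[OF open_unit_cube_sets[of d]]
  by (auto simp: cube_measure_def space_restrict_space)

lemma finite_cube_measure: "finite_measure (cube_measure d)"
proof
  have "emeasure (cube_measure d) (open_unit_cube d) = 1"
    unfolding cube_measure_def using open_unit_cube_sets emeasure_open_unit_cube
    by (subst emeasure_restrict_space) (auto intro: sets.Int)
  thus "emeasure (cube_measure d) (space (cube_measure d)) \<noteq> \<infinity>"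
    by (simp add: space_cube_measure)
qed

lemma set_lebesgue_integral_open_unit_cube:
  fixes f :: "(nat \<Rightarrow> real) \<Rightarrow> real"
  shows "set_lebesgue_integral (PiM {1..d} (\<lambda>_. lborel)) (open_unit_cube d) f = integral\<^sup>L (cube_measure d) f"
  unfolding cube_measure_def set_lebesgue_integral_def
  using open_unit_cube_sets by (subst integral_restrict_space) (auto intro: sets.Int)

lemma measurable_component_cube:
  assumes "k \<in> {1..d}"
  shows "(\<lambda>x. x k) \<in> borel_measurable (cube_measure d)"
proof -
  have "(\<lambda>x. x k) \<in> measurable (PiM {1..d} (\<lambda>_. lborel)) lborel"
    by (rule measurable_component_singleton[OF assms])
  thus ?thesis unfolding cube_measure_def by (auto intro: measurable_restrict_space1)
qed

lemma borel_measurable_tensor_product: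
  fixes f :: "nat \<Rightarrow> real \<Rightarrow> real"
  assumes "\<And>k. k \<in> {1..d} \<Longrightarrow> f k \<in> borel_measurable borel"
  shows "(\<lambda>x. \<Prod>k\<in>{1..d}. f k (x k)) \<in> borel_measurable (cube_measure d)"
  using assms
  by (intro borel_measurable_prod) (rule measurable_compose[OF measurable_component_cube])

lemma integrable_cube_measure_bounded:
  fixes f :: "(nat \<Rightarrow> real) \<Rightarrow> real"
  assumes "f \<in> borel_measurable (cube_measure d)" "\<And>x. x \<in> open_unit_cube d \<Longrightarrow> \<bar>f x\<bar> \<le> K"
  shows "integrable (cube_measure d) f"
proof -
  interpret finite_measure "cube_measure d" by (rule finite_cube_measure)
  show ?thesis
    by (rule integrable_const_bound[where B = K]) (use assms in \<open>auto simp: space_cube_measure intro!: AE_I2\<close>)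
qed

text \<open>
  The factors vanish outside \<open>(0,1)\<close>, so the restriction to the cube costs nothing and Fubini's theorem applies.
\<close>

lemma integral_cube_measure_tensor_product:
  fixes f :: "nat \<Rightarrow> real \<Rightarrow> real"
  assumes meas: "\<And>k. k \<in> {1..d} \<Longrightarrow> f k \<in> borel_measurable borel"
    and bound: "\<And>k x. k \<in> {1..d} \<Longrightarrow> \<bar>f k x\<bar> \<le> K * indicator {0<..<1} x"
  shows "(\<integral>x. (\<Prod>k\<in>{1..d}. f k (x k)) \<partial>cube_measure d) = (\<Prod>k\<in>{1..d}. integral\<^sup>L lborel (f k))"
proof -
  interpret product_sigma_finite "\<lambda>_::nat. lborel :: real measure" ..
  have int: "integrable lborel (f k)" if k: "k \<in> {1..d}" for k
  proof -
    have "integrable lborel (\<lambda>x. indicator {0<..<1} x *\<^sub>R f k x)"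
    proof (rule integrableI_bounded_set_indicator)
      show "AE x in lborel. x \<in> {0<..<1} \<longrightarrow> norm (f k x) \<le> K"
      proof (intro AE_I2 impI)
        fix x :: real assume "x \<in> {0<..<1}"
        thus "norm (f k x) \<le> K" using bound[OF k, of x] by simp
      qed
    qed (use meas[OF k] in auto)
    moreover have "(\<lambda>x. indicator {0<..<1} x *\<^sub>R f k x) = f k"
    proof
      fix x show "indicator {0<..<1} x *\<^sub>R f k x = f k x"
        using bound[OF k, of x] by (cases "x \<in> {0<..<1}") auto
    qed
    ultimately show ?thesis by simp
  qed
  have "(\<integral>x. (\<Prod>k\<in>{1..d}. f k (x k)) \<partial>cube_measure d)
      = (\<integral>x. indicator (open_unit_cube d) x *\<^sub>R (\<Prod>k\<in>{1..d}. f k (x k)) \<partial>PiM {1..d} (\<lambda>_. lborel))"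
    by (simp flip: set_lebesgue_integral_open_unit_cube add: set_lebesgue_integral_def)
  also have "\<dots> = (\<integral>x. (\<Prod>k\<in>{1..d}. f k (x k)) \<partial>PiM {1..d} (\<lambda>_. lborel))"
  proof (rule Bochner_Integration.integral_cong[OF refl])
    fix x assume x: "x \<in> space (PiM {1..d} (\<lambda>_. lborel :: real measure))"
    show "indicator (open_unit_cube d) x *\<^sub>R (\<Prod>k\<in>{1..d}. f k (x k)) = (\<Prod>k\<in>{1..d}. f k (x k))"
    proof (cases "x \<in> open_unit_cube d")
      case False
      then obtain k where k: "k \<in> {1..d}" "x k \<notin> {0<..<1}"
        using x unfolding open_unit_cube_def by (auto simp: space_PiM PiE_iff)
      hence "f k (x k) = 0" using bound[OF k(1), of "x k"] by simp
      hence "(\<Prod>k\<in>{1..d}. f k (x k)) = 0" using k(1) by (intro prod_zero) auto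
      thus ?thesis by simp
    qed simp
  qed
  also have "\<dots> = (\<Prod>k\<in>{1..d}. integral\<^sup>L lborel (f k))"
    by (rule product_integral_prod) (use int in auto)
  finally show ?thesis .
qed

section \<open>Bounded measurable functions on the cube\<close>

text \<open>
  This class is closed under the arithmetic used below, so that all integrability conditions follow
  from one set of introduction rules.
\<close>

definition bounded_measurable :: "nat \<Rightarrow> ((nat \<Rightarrow> real) \<Rightarrow> real) \<Rightarrow> bool" where
  "bounded_measurable d f \<longleftrightarrow> f \<in> borel_measurable (cube_measure d) \<and>
     (\<exists>K. \<forall>x\<in>open_unit_cube d. \<bar>f x\<bar> \<le> K)"

lemma bounded_measurableI:
  assumes "f \<in> borel_measurable (cube_measure d)" "\<And>x. x \<in> open_unit_cube d \<Longrightarrow> \<bar>f x\<bar> \<le> K"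
  shows "bounded_measurable d f"
  using assms unfolding bounded_measurable_def by blast

lemma bounded_measurable_integrable:
  assumes "bounded_measurable d f"
  shows "integrable (cube_measure d) f"
  using assms integrable_cube_measure_bounded unfolding bounded_measurable_def by blast

lemma bounded_measurable_const: "bounded_measurable d (\<lambda>_. c)"
  by (rule bounded_measurableI[of _ _ "\<bar>c\<bar>"]) auto

lemma bounded_measurable_add:
  assumes "bounded_measurable d f" "bounded_measurable d g"
  shows "bounded_measurable d (\<lambda>x. f x + g x)"
proof -
  obtain K L where "\<forall>x\<in>open_unit_cube d. \<bar>f x\<bar> \<le> K" "\<forall>x\<in>open_unit_cube d. \<bar>g x\<bar> \<le> L"
    using assms unfolding bounded_measurable_def by blast
  hence "\<bar>f x + g x\<bar> \<le> K + L" if "x \<in> open_unit_cube d" for x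
    using that by (intro order_trans[OF abs_triangle_ineq] add_mono) auto
  thus ?thesis using assms by (intro bounded_measurableI[of _ _ "K + L"]) (auto simp: bounded_measurable_def)
qed

lemma bounded_measurable_mult:
  assumes "bounded_measurable d f" "bounded_measurable d g"
  shows "bounded_measurable d (\<lambda>x. f x * g x)"
proof -
  obtain K L where KL: "\<forall>x\<in>open_unit_cube d. \<bar>f x\<bar> \<le> K" "\<forall>x\<in>open_unit_cube d. \<bar>g x\<bar> \<le> L"
    using assms unfolding bounded_measurable_def by blast
  have "\<bar>f x * g x\<bar> \<le> K * L" if "x \<in> open_unit_cube d" for x
  proof -
    have "\<bar>f x\<bar> \<le> K" "\<bar>g x\<bar> \<le> L" using KL that by auto
    thus ?thesis unfolding abs_mult by (intro mult_mono) auto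
  qed
  thus ?thesis using assms by (intro bounded_measurableI[of _ _ "K * L"]) (auto simp: bounded_measurable_def)
qed

lemma bounded_measurable_sum:
  assumes "\<And>i. i \<in> A \<Longrightarrow> bounded_measurable d (f i)"
  shows "bounded_measurable d (\<lambda>x. \<Sum>i\<in>A. f i x)"
  using assms
  by (induction A rule: infinite_finite_induct)
     (auto intro: bounded_measurable_const bounded_measurable_add)

lemma bounded_measurable_power2:
  "bounded_measurable d f \<Longrightarrow> bounded_measurable d (\<lambda>x. (f x)\<^sup>2)"
  unfolding power2_eq_square by (rule bounded_measurable_mult)

lemma bounded_measurable_diff:
  assumes "bounded_measurable d f" "bounded_measurable d g"
  shows "bounded_measurable d (\<lambda>x. f x - g x)"
  using bounded_measurable_add[OF assms(1) bounded_measurable_mult[OF bounded_measurable_const[of d "-1"] assms(2)]]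
  by simp

lemma bounded_measurable_abs:
  "bounded_measurable d f \<Longrightarrow> bounded_measurable d (\<lambda>x. \<bar>f x\<bar>)"
  unfolding bounded_measurable_def by auto

lemmas bounded_measurable_intros =
  bounded_measurable_const bounded_measurable_add bounded_measurable_diff bounded_measurable_mult
  bounded_measurable_sum bounded_measurable_power2 bounded_measurable_abs

section \<open>Multi-indices\<close>

lemma multi_index_range:
  assumes "0 < m"
  shows "multi_index m j k \<in> {1..m}"
  using assms by (auto simp: multi_index_def Suc_le_eq)

text \<open>
  The multi-index consists of the first \<open>d\<close> digits in base \<open>m\<close>, shifted by 1.
\<close>

lemma multi_index_inj:
  assumes "i < m ^ d" "j < m ^ d" "\<And>k. k \<in> {1..d} \<Longrightarrow> multi_index m i k = multi_index m j k"
  shows "i = j"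
  using assms
proof (induction d arbitrary: i j)
  case (Suc d)
  have m: "0 < m" using Suc.prems(1) by (cases m) auto
  have "i div m = j div m"
  proof (rule Suc.IH)
    show "i div m < m ^ d" "j div m < m ^ d"
      using Suc.prems(1,2) m by (auto simp: div_less_iff_less_mult mult.commute)
    fix k assume k: "k \<in> {1..d}"
    have "multi_index m (n div m) k = multi_index m n (Suc k)" for n
      using k by (cases k) (auto simp: multi_index_def simp flip: div_mult2_eq)
    thus "multi_index m (i div m) k = multi_index m (j div m) k" using Suc.prems(3)[of "Suc k"] k by simp
  qed
  moreover have "i mod m = j mod m"
    using Suc.prems(3)[of 1] by (simp add: multi_index_def)
  ultimately show ?case by (metis div_mod_decomp)
qed auto

section \<open>Tensor-product splines\<close>

locale tensor_splines =
  fixes d p m :: nat and \<Xi> :: "nat \<Rightarrow> nat \<Rightarrow> real"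
  assumes d: "1 \<le> d"
    and knots: "\<And>k. k \<in> {1..d} \<Longrightarrow> open_knot_vector m p (\<Xi> k)"
begin

abbreviation h :: real where "h \<equiv> mesh_size d p m \<Xi>"
abbreviation B :: "nat \<Rightarrow> (nat \<Rightarrow> real) \<Rightarrow> real" where "B \<equiv> tensor_bspline d p m \<Xi>"
abbreviation \<mu> :: "(nat \<Rightarrow> real) measure" where "\<mu> \<equiv> cube_measure d"

definition supp_box :: "nat \<Rightarrow> (nat \<Rightarrow> real) set" where
  "supp_box j = {x. \<forall>k\<in>{1..d}. \<Xi> k (multi_index m j k) \<le> x k \<and> x k < \<Xi> k (multi_index m j k + p + 1)}"

definition spline :: "(nat \<Rightarrow> real) \<Rightarrow> (nat \<Rightarrow> real) \<Rightarrow> real" where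
  "spline c x = (\<Sum>j<m^d. c j * B j x)"

lemma m_pos: "0 < m"
  using open_knot_vector_size[OF knots[of 1]] d by auto

lemma knot_gap_le: "k \<in> {1..d} \<Longrightarrow> l \<in> {1..m+p} \<Longrightarrow> \<Xi> k (l+1) - \<Xi> k l \<le> h"
  unfolding mesh_size_def by (rule Max_ge) (auto intro!: image_eqI[of _ _ "(k,l)"])

lemma h_pos: "0 < h"
proof -
  have kn: "open_knot_vector m p (\<Xi> 1)" using knots[of 1] d by simp
  have "0 < \<Xi> 1 (p+2)" "\<Xi> 1 (p+1) = 0" using kn by (auto simp: open_knot_vector_def)
  moreover have "\<Xi> 1 (p+1+1) - \<Xi> 1 (p+1) \<le> h"
    using open_knot_vector_size[OF kn] d by (intro knot_gap_le) auto
  ultimately show ?thesis by simp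
qed

lemma support_width_le:
  assumes "k \<in> {1..d}" "i \<in> {1..m}"
  shows "\<Xi> k (i+p+1) - \<Xi> k i \<le> (real p + 1) * h"
proof -
  have "\<Xi> k (i+(p+1)) - \<Xi> k i \<le> real (p+1) * h"
    by (rule knot_distance_le) (use knot_gap_le[OF assms(1)] assms(2) in auto)
  thus ?thesis by (simp add: add.assoc algebra_simps)
qed

lemma knots_mono_support:
  assumes "k \<in> {1..d}" "i \<in> {1..m}"
  shows "mono_on {i..i+p+1} (\<Xi> k)"
  by (rule mono_on_subset[OF open_knot_vector_mono[OF knots[OF assms(1)]]]) (use assms in auto)

lemma tensor_bspline_bounds: "0 \<le> B j x" "B j x \<le> (2 ^ p) ^ d"
proof -
  have *: "0 \<le> bspline (\<Xi> k) p (multi_index m j k) (x k) \<and>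
      bspline (\<Xi> k) p (multi_index m j k) (x k) \<le> 2 ^ p" if "k \<in> {1..d}" for k
    using bspline_bounds[OF knots_mono_support[OF that multi_index_range[OF m_pos]]] by blast
  show "0 \<le> B j x" unfolding tensor_bspline_def using * by (intro prod_nonneg) auto
  have "B j x \<le> (\<Prod>k\<in>{1..d}. 2 ^ p)" unfolding tensor_bspline_def using * by (intro prod_mono) auto
  thus "B j x \<le> (2 ^ p) ^ d" by simp
qed

lemma tensor_bspline_eq_0:
  assumes "x \<notin> supp_box j"
  shows "B j x = 0"
proof -
  obtain k where k: "k \<in> {1..d}" "x k < \<Xi> k (multi_index m j k) \<or> \<Xi> k (multi_index m j k + p + 1) \<le> x k"
    using assms by (auto simp: supp_box_def not_le not_less)
  hence "bspline (\<Xi> k) p (multi_index m j k) (x k) = 0"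
    by (intro bspline_eq_0 knots_mono_support multi_index_range m_pos)
  thus ?thesis unfolding tensor_bspline_def using k(1) by (intro prod_zero) auto
qed

lemma bounded_measurable_tensor_bspline: "bounded_measurable d (B j)"
proof (rule bounded_measurableI)
  have "(\<lambda>x. \<Prod>k\<in>{1..d}. bspline (\<Xi> k) p (multi_index m j k) (x k)) \<in> borel_measurable \<mu>"
    by (rule borel_measurable_tensor_product) (rule borel_measurable_bspline)
  thus "B j \<in> borel_measurable \<mu>" by (simp add: tensor_bspline_def[abs_def])
  show "\<bar>B j x\<bar> \<le> (2 ^ p) ^ d" for x using tensor_bspline_bounds[of j x] by simp
qed

lemma bounded_measurable_spline: "bounded_measurable d (spline c)"
  unfolding spline_def[abs_def]
  by (intro bounded_measurable_intros bounded_measurable_tensor_bspline)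

text \<open>
  This product form gives the measurability of the box and a bound for its volume.
\<close>

lemma indicator_box:
  "indicator (supp_box j) x = (\<Prod>k\<in>{1..d}. indicator {\<Xi> k (multi_index m j k)..<\<Xi> k (multi_index m j k + p + 1)} (x k) :: real)"
proof (cases "x \<in> supp_box j")
  case True
  thus ?thesis by (auto simp: supp_box_def intro!: prod.neutral[symmetric])
next
  case False
  then obtain k where "k \<in> {1..d}" "x k \<notin> {\<Xi> k (multi_index m j k)..<\<Xi> k (multi_index m j k + p + 1)}"
    by (auto simp: supp_box_def)
  hence "(\<Prod>k\<in>{1..d}. indicator {\<Xi> k (multi_index m j k)..<\<Xi> k (multi_index m j k + p + 1)} (x k) :: real) = 0"
    by (intro prod_zero bexI[of _ k]) auto
  thus ?thesis using False by simp
qed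

lemma bounded_measurable_box: "bounded_measurable d (indicator (supp_box j))"
proof (rule bounded_measurableI)
  show "(indicator (supp_box j) :: _ \<Rightarrow> real) \<in> borel_measurable \<mu>"
  proof -
    have "(indicator (supp_box j) :: _ \<Rightarrow> real) = (\<lambda>x. \<Prod>k\<in>{1..d}. indicator {\<Xi> k (multi_index m j k)..<\<Xi> k (multi_index m j k + p + 1)} (x k))"
      by (rule ext) (rule indicator_box)
    thus ?thesis by (simp only:) (rule borel_measurable_tensor_product, simp)
  qed
  show "\<bar>indicator (supp_box j) x :: real\<bar> \<le> 1" for x by (simp add: indicator_def)
qed

lemma integral_box_le: "(\<integral>x. indicator (supp_box j) x \<partial>\<mu>) \<le> ((real p + 1) * h) ^ d"
proof -
  define S where "S = (\<lambda>k. {\<Xi> k (multi_index m j k)..<\<Xi> k (multi_index m j k + p + 1)})"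
  have "(\<integral>x. indicator (supp_box j) x \<partial>\<mu>) = (\<integral>x. (\<Prod>k\<in>{1..d}. indicator (S k \<inter> {0<..<1}) (x k) :: real) \<partial>\<mu>)"
  proof (rule Bochner_Integration.integral_cong[OF refl])
    fix x assume "x \<in> space \<mu>"
    hence "x k \<in> {0<..<1}" if "k \<in> {1..d}" for k
      using that by (auto simp: space_cube_measure open_unit_cube_def)
    thus "indicator (supp_box j) x = (\<Prod>k\<in>{1..d}. indicator (S k \<inter> {0<..<1}) (x k) :: real)"
      unfolding indicator_box S_def by (intro prod.cong) (auto simp: indicator_def)
  qed
  also have "\<dots> = (\<Prod>k\<in>{1..d}. \<integral>x. indicator (S k \<inter> {0<..<1}) x \<partial>lborel)"
    by (rule integral_cube_measure_tensor_product[where K = 1]) (auto simp: S_def indicator_def)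
  also have "\<dots> \<le> (\<Prod>k\<in>{1..d}. (real p + 1) * h)"
  proof (rule prod_mono, intro conjI)
    fix k assume k: "k \<in> {1..d}"
    define i where "i = multi_index m j k"
    have i: "i \<in> {1..m}" unfolding i_def by (rule multi_index_range[OF m_pos])
    have le: "\<Xi> k i \<le> \<Xi> k (i+p+1)"
      using open_knot_vector_support_nonempty[OF knots[OF k] i] by simp
    have Sk: "S k = {\<Xi> k i..<\<Xi> k (i+p+1)}" by (simp add: S_def i_def)
    have "(\<integral>x. indicator (S k \<inter> {0<..<1}) x \<partial>lborel) = measure lborel (S k \<inter> {0<..<1})"
      by (simp add: Sk)
    also have "\<dots> \<le> measure lborel (S k)"
      unfolding Sk using le by (intro measure_mono_fmeasurable) (auto intro!: fmeasurableI)
    also have "\<dots> = \<Xi> k (i+p+1) - \<Xi> k i" using le by (simp add: Sk)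
    also have "\<dots> \<le> (real p + 1) * h" by (rule support_width_le[OF k i])
    finally show "(\<integral>x. indicator (S k \<inter> {0<..<1}) x \<partial>lborel) \<le> (real p + 1) * h" .
  qed simp
  finally show ?thesis by simp
qed

text \<open>
  Distinct basis functions have distinct multi-indices, and each component of the multi-index
  of a basis function active at \<open>x\<close> has at most \<open>p + 1\<close> possible values.
\<close>

lemma card_active_boxes: "card {j\<in>{..<m^d}. x \<in> supp_box j} \<le> (p + 1) ^ d"
proof -
  define J where "J = {j\<in>{..<m^d}. x \<in> supp_box j}"
  define A where "A = (\<lambda>k. {i\<in>{1..m}. \<Xi> k i \<le> x k \<and> x k < \<Xi> k (i+p+1)})"
  define \<phi> where "\<phi> = (\<lambda>j. restrict (multi_index m j) {1..d})"
  have inj: "inj_on \<phi> J"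
  proof (rule inj_onI)
    fix i j assume ij: "i \<in> J" "j \<in> J" "\<phi> i = \<phi> j"
    show "i = j"
    proof (rule multi_index_inj)
      fix k assume "k \<in> {1..d}"
      thus "multi_index m i k = multi_index m j k"
        using fun_cong[OF ij(3), of k] by (simp add: \<phi>_def)
    qed (use ij in \<open>auto simp: J_def\<close>)
  qed
  have "\<phi> ` J \<subseteq> PiE {1..d} A"
    using multi_index_range[OF m_pos] by (auto simp: \<phi>_def J_def A_def supp_box_def)
  moreover have "finite (PiE {1..d} A)" by (intro finite_PiE) (auto simp: A_def)
  ultimately have "card J \<le> card (PiE {1..d} A)"
    using inj by (metis card_image card_mono)
  also have "\<dots> = (\<Prod>k\<in>{1..d}. card (A k))" by (rule card_PiE) simp
  also have "\<dots> \<le> (\<Prod>k\<in>{1..d}. p + 1)"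
  proof (rule prod_mono, intro conjI)
    fix k assume k: "k \<in> {1..d}"
    show "card (A k) \<le> p + 1"
      unfolding A_def by (rule card_active_bsplines[OF open_knot_vector_mono[OF knots[OF k]]])
  qed simp
  finally show ?thesis by (simp add: J_def)
qed

lemma sum_indicator_box_le: "(\<Sum>j<m^d. indicator (supp_box j) x :: real) \<le> (real p + 1) ^ d"
proof -
  have "(\<Sum>j<m^d. indicator (supp_box j) x :: real) = (\<Sum>j\<in>{j\<in>{..<m^d}. x \<in> supp_box j}. 1)"
    by (rule sum.mono_neutral_cong_right) (auto simp: indicator_def)
  also have "\<dots> = real (card {j\<in>{..<m^d}. x \<in> supp_box j})" by simp
  also have "\<dots> \<le> real ((p + 1) ^ d)" using card_active_boxes[of x] by (simp only: of_nat_le_iff)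
  finally show ?thesis by (simp add: add.commute)
qed

text \<open>
  Cauchy-Schwarz against the indicators of the supports, of which at most \<open>(p + 1)\<^sup>d\<close> are 1 at \<open>x\<close>.
\<close>

lemma square_of_active_sum_le:
  "(\<Sum>j<m^d. \<bar>c j\<bar> * B j x)\<^sup>2 \<le> (real p + 1) ^ d * (\<Sum>j<m^d. (c j)\<^sup>2 * (B j x)\<^sup>2)"
proof -
  have "(\<Sum>j<m^d. \<bar>c j\<bar> * B j x) = (\<Sum>j<m^d. indicator (supp_box j) x * (\<bar>c j\<bar> * B j x))"
    using tensor_bspline_eq_0[of x] by (intro sum.cong) (auto simp: indicator_def)
  hence "(\<Sum>j<m^d. \<bar>c j\<bar> * B j x)\<^sup>2 \<le>
      (\<Sum>j<m^d. (indicator (supp_box j) x)\<^sup>2) * (\<Sum>j<m^d. (\<bar>c j\<bar> * B j x)\<^sup>2)"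
    using Cauchy_Schwarz_ineq_sum[of "\<lambda>j. indicator (supp_box j) x" "\<lambda>j. \<bar>c j\<bar> * B j x" "{..<m^d}"] by simp
  also have "(\<Sum>j<m^d. (indicator (supp_box j) x)\<^sup>2 :: real) = (\<Sum>j<m^d. indicator (supp_box j) x)"
    by (intro sum.cong) (auto simp: indicator_def)
  also have "(\<Sum>j<m^d. indicator (supp_box j) x) * (\<Sum>j<m^d. (\<bar>c j\<bar> * B j x)\<^sup>2) \<le>
      (real p + 1) ^ d * (\<Sum>j<m^d. (\<bar>c j\<bar> * B j x)\<^sup>2)"
    by (intro mult_right_mono sum_indicator_box_le sum_nonneg) auto
  finally show ?thesis by (simp add: power_mult_distrib)
qed

end

context tensor_splines
begin

section \<open>Stability of the tensor-product basis\<close>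

text \<open>
  The existence of dual functions with the constant \<open>C\<close>, in all directions. Keeping it as a property of \<open>C\<close>
  makes visible that the constant in \<open>l2_stability\<close> depends on the knots through \<open>C\<close> alone.
\<close>

definition has_dual_bound :: "real \<Rightarrow> bool" where
  "has_dual_bound C \<longleftrightarrow> (\<forall>k\<in>{1..d}. \<forall>i\<in>{1..m}. \<exists>\<psi>. \<psi> \<in> borel_measurable borel \<and>
     (\<forall>x. \<bar>\<psi> x\<bar> \<le> C / h * indicator ({\<Xi> k i..<\<Xi> k (i+p+1)} \<inter> {0<..<1}) x) \<and>
     (\<forall>j\<in>{1..m}. (\<integral>x. \<psi> x * bspline (\<Xi> k) p j x \<partial>lborel) = (if i = j then 1 else 0)))"

lemma tensor_dual_function:
  assumes C: "0 < C" and dual: "has_dual_bound C" and j: "j < m^d"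
  obtains \<Psi> where "bounded_measurable d \<Psi>"
    "\<And>x. x \<in> open_unit_cube d \<Longrightarrow> \<bar>\<Psi> x\<bar> \<le> (C / h) ^ d * indicator (supp_box j) x"
    "\<And>i. i < m^d \<Longrightarrow> (\<integral>x. \<Psi> x * B i x \<partial>\<mu>) = (if i = j then 1 else 0)"
proof -
  define Q where "Q = (\<lambda>k \<psi>. \<psi> \<in> borel_measurable borel \<and>
     (\<forall>x. \<bar>\<psi> x\<bar> \<le> C / h * indicator ({\<Xi> k (multi_index m j k)..<\<Xi> k (multi_index m j k+p+1)} \<inter> {0<..<1}) x) \<and>
     (\<forall>i\<in>{1..m}. (\<integral>x. \<psi> x * bspline (\<Xi> k) p i x \<partial>lborel) = (if multi_index m j k = i then 1 else 0)))"
  define \<psi> where "\<psi> = (\<lambda>k. SOME \<psi>. Q k \<psi>)"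
  have "Q k (\<psi> k)" if "k \<in> {1..d}" for k
  proof -
    have "\<exists>\<psi>. Q k \<psi>"
      using dual[unfolded has_dual_bound_def] that multi_index_range[OF m_pos, of j k] unfolding Q_def by blast
    thus ?thesis unfolding \<psi>_def by (rule someI_ex)
  qed
  hence \<psi>: "\<And>k. k \<in> {1..d} \<Longrightarrow> \<psi> k \<in> borel_measurable borel"
    and bd: "\<And>k x. k \<in> {1..d} \<Longrightarrow> \<bar>\<psi> k x\<bar> \<le> C / h * indicator ({\<Xi> k (multi_index m j k)..<\<Xi> k (multi_index m j k+p+1)} \<inter> {0<..<1}) x"
    and du: "\<And>k i. k \<in> {1..d} \<Longrightarrow> i \<in> {1..m} \<Longrightarrow>
      (\<integral>x. \<psi> k x * bspline (\<Xi> k) p i x \<partial>lborel) = (if multi_index m j k = i then 1 else 0)"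
    by (auto simp: Q_def)
  have Ch: "0 < C / h" using C h_pos by simp
  define \<Psi> where "\<Psi> = (\<lambda>x. \<Prod>k\<in>{1..d}. \<psi> k (x k))"
  have bound: "\<bar>\<Psi> x\<bar> \<le> (C / h) ^ d * indicator (supp_box j) x" for x
  proof -
    have "\<bar>\<Psi> x\<bar> = (\<Prod>k\<in>{1..d}. \<bar>\<psi> k (x k)\<bar>)" by (simp add: \<Psi>_def abs_prod)
    also have "\<dots> \<le> (\<Prod>k\<in>{1..d}. C / h * indicator {\<Xi> k (multi_index m j k)..<\<Xi> k (multi_index m j k+p+1)} (x k))"
    proof (rule prod_mono, intro conjI)
      fix k assume k: "k \<in> {1..d}"
      show "\<bar>\<psi> k (x k)\<bar> \<le> C / h * indicator {\<Xi> k (multi_index m j k)..<\<Xi> k (multi_index m j k+p+1)} (x k)"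
        using Ch by (intro order_trans[OF bd[OF k]] mult_left_mono) (auto simp: indicator_def)
    qed simp
    also have "\<dots> = (C / h) ^ d * indicator (supp_box j) x"
      unfolding prod.distrib indicator_box by simp
    finally show ?thesis .
  qed
  show ?thesis
  proof (rule that[of \<Psi>])
    have "\<bar>\<Psi> x\<bar> \<le> (C / h) ^ d" for x
      using bound[of x] Ch by (cases "x \<in> supp_box j") auto
    thus "bounded_measurable d \<Psi>"
      unfolding \<Psi>_def using \<psi> by (intro bounded_measurableI borel_measurable_tensor_product) auto
    show "\<bar>\<Psi> x\<bar> \<le> (C / h) ^ d * indicator (supp_box j) x" for x by (rule bound)
    fix i assume i: "i < m^d"
    have "(\<integral>x. \<Psi> x * B i x \<partial>\<mu>) = (\<integral>x. (\<Prod>k\<in>{1..d}. \<psi> k (x k) * bspline (\<Xi> k) p (multi_index m i k) (x k)) \<partial>\<mu>)"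
      by (simp add: \<Psi>_def tensor_bspline_def prod.distrib)
    also have "\<dots> = (\<Prod>k\<in>{1..d}. \<integral>x. \<psi> k x * bspline (\<Xi> k) p (multi_index m i k) x \<partial>lborel)"
    proof (rule integral_cube_measure_tensor_product[where f = "\<lambda>k x. \<psi> k x * bspline (\<Xi> k) p (multi_index m i k) x" and K = "C / h * 2 ^ p"])
      fix k assume k: "k \<in> {1..d}"
      show "(\<lambda>x. \<psi> k x * bspline (\<Xi> k) p (multi_index m i k) x) \<in> borel_measurable borel"
        using \<psi>[OF k] by (intro borel_measurable_times borel_measurable_bspline)
      fix x
      have b: "\<bar>bspline (\<Xi> k) p (multi_index m i k) x\<bar> \<le> 2 ^ p"
        using bspline_bounds[OF knots_mono_support[OF k multi_index_range[OF m_pos]]] by simp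
      have "\<bar>\<psi> k x\<bar> \<le> C / h * indicator {0<..<1} x"
        using Ch by (intro order_trans[OF bd[OF k]] mult_left_mono) (auto simp: indicator_def)
      hence "\<bar>\<psi> k x\<bar> * \<bar>bspline (\<Xi> k) p (multi_index m i k) x\<bar> \<le> (C / h * indicator {0<..<1} x) * 2 ^ p"
        using b Ch by (intro mult_mono) auto
      thus "\<bar>\<psi> k x * bspline (\<Xi> k) p (multi_index m i k) x\<bar> \<le> C / h * 2 ^ p * indicator {0<..<1} x"
        by (simp add: abs_mult mult_ac)
    qed
    also have "\<dots> = (\<Prod>k\<in>{1..d}. if multi_index m j k = multi_index m i k then 1 else 0)"
      by (intro prod.cong refl du multi_index_range[OF m_pos])
    also have "\<dots> = (if i = j then 1 else 0)"
    proof (cases "i = j")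
      case False
      then obtain k where "k \<in> {1..d}" "multi_index m j k \<noteq> multi_index m i k"
        using multi_index_inj[OF i j] by metis
      hence "(\<Prod>k\<in>{1..d}. if multi_index m j k = multi_index m i k then 1 else 0 :: real) = 0"
        by (intro prod_zero bexI[of _ k]) auto
      thus ?thesis using False by simp
    qed simp
    finally show "(\<integral>x. \<Psi> x * B i x \<partial>\<mu>) = (if i = j then 1 else 0)" .
  qed
qed

lemma integral_dual_spline:
  assumes \<Psi>: "bounded_measurable d \<Psi>"
    and dual: "\<And>i. i < m^d \<Longrightarrow> (\<integral>x. \<Psi> x * B i x \<partial>\<mu>) = (if i = j then 1 else 0)" and j: "j < m^d"
  shows "(\<integral>x. \<Psi> x * spline c x \<partial>\<mu>) = c j"
proof -
  have "(\<integral>x. \<Psi> x * spline c x \<partial>\<mu>) = (\<integral>x. (\<Sum>i<m^d. c i * (\<Psi> x * B i x)) \<partial>\<mu>)"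
    by (simp add: spline_def sum_distrib_left mult_ac)
  also have "\<dots> = (\<Sum>i<m^d. c i * (\<integral>x. \<Psi> x * B i x \<partial>\<mu>))"
    by (subst Bochner_Integration.integral_sum)
      (auto intro!: bounded_measurable_integrable bounded_measurable_intros \<Psi> bounded_measurable_tensor_bspline)
  also have "\<dots> = (\<Sum>i<m^d. if i = j then c i else 0)"
    using dual by (intro sum.cong) auto
  also have "\<dots> = c j" using j by simp
  finally show ?thesis .
qed

text \<open>
  The coefficient is \<open>c\<^sub>j = \<integral>\<Psi> G\<close> for the dual function \<open>\<Psi>\<close>, which lives on the support of \<open>B\<^sub>j\<close>. So this is the
  Cauchy-Schwarz inequality, with the constant \<open>P\<close> a bound for \<open>\<integral>\<Psi>\<^sup>2\<close>. It is derived from the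
  nonnegativity of \<open>\<integral>(P G - c\<^sub>j \<Psi>)\<^sup>2\<close> over that support.
\<close>

lemma coefficient_bound:
  assumes C: "0 < C" and dual: "has_dual_bound C" and j: "j < m^d"
  shows "(c j)\<^sup>2 \<le> ((C / h)\<^sup>2 * ((real p + 1) * h)) ^ d * (\<integral>x. indicator (supp_box j) x * (spline c x)\<^sup>2 \<partial>\<mu>)"
proof -
  obtain \<Psi> where \<Psi>: "bounded_measurable d \<Psi>"
    and bound: "\<And>x. x \<in> open_unit_cube d \<Longrightarrow> \<bar>\<Psi> x\<bar> \<le> (C / h) ^ d * indicator (supp_box j) x"
    and du: "\<And>i. i < m^d \<Longrightarrow> (\<integral>x. \<Psi> x * B i x \<partial>\<mu>) = (if i = j then 1 else 0)"
    by (rule tensor_dual_function[OF C dual j]) (rule that)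
  define P where "P = ((C / h)\<^sup>2 * ((real p + 1) * h)) ^ d"
  have P: "0 < P" using C h_pos by (auto simp: P_def intro!: zero_less_power mult_pos_pos)
  define I where "I = (\<integral>x. indicator (supp_box j) x * (spline c x)\<^sup>2 \<partial>\<mu>)"
  note bm = bounded_measurable_integrable bounded_measurable_intros \<Psi>
    bounded_measurable_spline bounded_measurable_box
  have "(\<integral>x. (\<Psi> x)\<^sup>2 \<partial>\<mu>) \<le> (\<integral>x. ((C / h) ^ d)\<^sup>2 * indicator (supp_box j) x \<partial>\<mu>)"
  proof (rule integral_mono)
    fix x assume "x \<in> space \<mu>"
    hence "\<bar>\<Psi> x\<bar>\<^sup>2 \<le> ((C / h) ^ d * indicator (supp_box j) x)\<^sup>2"
      using bound by (intro power_mono) (auto simp: space_cube_measure)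
    thus "(\<Psi> x)\<^sup>2 \<le> ((C / h) ^ d)\<^sup>2 * indicator (supp_box j) x"
      by (cases "x \<in> supp_box j") (auto simp: power_mult_distrib)
  qed (intro bm)+
  also have "\<dots> = ((C / h) ^ d)\<^sup>2 * (\<integral>x. indicator (supp_box j) x \<partial>\<mu>)" by simp
  also have "\<dots> \<le> ((C / h) ^ d)\<^sup>2 * ((real p + 1) * h) ^ d"
    by (intro mult_left_mono integral_box_le) auto
  also have "\<dots> = P" by (simp add: P_def power_mult_distrib power_mult[symmetric] mult.commute)
  finally have Q: "(\<integral>x. (\<Psi> x)\<^sup>2 \<partial>\<mu>) \<le> P" .
  have "0 \<le> (\<integral>x. (P * (indicator (supp_box j) x * spline c x) - c j * \<Psi> x)\<^sup>2 \<partial>\<mu>)"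
    by (rule integral_nonneg_AE) auto
  also have "\<dots> = (\<integral>x. P\<^sup>2 * (indicator (supp_box j) x * (spline c x)\<^sup>2) - (2 * P * c j) * (\<Psi> x * spline c x)
      + (c j)\<^sup>2 * (\<Psi> x)\<^sup>2 \<partial>\<mu>)"
  proof (rule Bochner_Integration.integral_cong[OF refl])
    fix x assume "x \<in> space \<mu>"
    hence "x \<in> open_unit_cube d" by (simp add: space_cube_measure)
    hence "x \<notin> supp_box j \<Longrightarrow> \<Psi> x = 0" using bound[of x] by simp
    thus "(P * (indicator (supp_box j) x * spline c x) - c j * \<Psi> x)\<^sup>2 =
        P\<^sup>2 * (indicator (supp_box j) x * (spline c x)\<^sup>2) - (2 * P * c j) * (\<Psi> x * spline c x) + (c j)\<^sup>2 * (\<Psi> x)\<^sup>2"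
      by (cases "x \<in> supp_box j") (auto simp: power2_diff power_mult_distrib)
  qed
  also have "\<dots> = (\<integral>x. P\<^sup>2 * (indicator (supp_box j) x * (spline c x)\<^sup>2) \<partial>\<mu>)
      - (\<integral>x. (2 * P * c j) * (\<Psi> x * spline c x) \<partial>\<mu>) + (\<integral>x. (c j)\<^sup>2 * (\<Psi> x)\<^sup>2 \<partial>\<mu>)"
    by (subst Bochner_Integration.integral_add, (intro bm)+,
        subst Bochner_Integration.integral_diff, (intro bm)+, rule refl)
  also have "\<dots> = P\<^sup>2 * I - 2 * P * c j * c j + (c j)\<^sup>2 * (\<integral>x. (\<Psi> x)\<^sup>2 \<partial>\<mu>)"
    using integral_dual_spline[OF \<Psi> du j, of c] by (simp add: I_def)
  also have "\<dots> \<le> P\<^sup>2 * I - 2 * P * c j * c j + (c j)\<^sup>2 * P"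
    using Q by (intro add_left_mono mult_left_mono) auto
  also have "\<dots> = P * (P * I - (c j)\<^sup>2)" by (simp add: algebra_simps power2_eq_square)
  finally have "0 \<le> P * I - (c j)\<^sup>2" using P by (simp add: zero_le_mult_iff)
  thus ?thesis by (simp add: P_def I_def)
qed

lemma integral_square_tensor_bspline_le:
  "(\<integral>x. (B j x)\<^sup>2 \<partial>\<mu>) \<le> (4 ^ p * ((real p + 1) * h)) ^ d"
proof -
  have "(\<integral>x. (B j x)\<^sup>2 \<partial>\<mu>) \<le> (\<integral>x. ((2 ^ p) ^ d)\<^sup>2 * indicator (supp_box j) x \<partial>\<mu>)"
  proof (rule integral_mono)
    fix x
    show "(B j x)\<^sup>2 \<le> ((2 ^ p) ^ d)\<^sup>2 * indicator (supp_box j) x"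
      using tensor_bspline_bounds[of j x] tensor_bspline_eq_0[of x j]
      by (cases "x \<in> supp_box j") (auto intro: power_mono)
  qed (intro bounded_measurable_integrable bounded_measurable_intros
      bounded_measurable_tensor_bspline bounded_measurable_box)+
  also have "\<dots> = ((2 ^ p) ^ d)\<^sup>2 * (\<integral>x. indicator (supp_box j) x \<partial>\<mu>)" by simp
  also have "\<dots> \<le> ((2 ^ p) ^ d)\<^sup>2 * ((real p + 1) * h) ^ d"
    by (intro mult_left_mono integral_box_le) auto
  also have "((2 ^ p) ^ d)\<^sup>2 = ((4 ^ p) ^ d :: real)"
    by (metis four_x_squared mult.commute power2_eq_square power_mult power_mult_distrib numeral_Bit0_eq_double mult_2)
  finally show ?thesis by (simp add: power_mult_distrib)
qed

text \<open>
  Each dual function contributes \<open>(C/h)\<^sup>2\<close> and each of the two integrals over a support a volume of order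
  \<open>h\<close> in each direction, so the powers of \<open>h\<close> cancel. One factor \<open>p + 1\<close> in each direction pays for the overlap of the supports.
\<close>

theorem l2_stability:
  assumes C: "0 < C" and dual: "has_dual_bound C"
  shows "(\<Sum>j<m^d. (c j)\<^sup>2 * (\<integral>x. (B j x)\<^sup>2 \<partial>\<mu>)) \<le>
    (C\<^sup>2 * (real p + 1) ^ 3 * 4 ^ p) ^ d * (\<integral>x. (spline c x)\<^sup>2 \<partial>\<mu>)"
proof -
  define P where "P = ((C / h)\<^sup>2 * ((real p + 1) * h)) ^ d"
  define V where "V = (4 ^ p * ((real p + 1) * h)) ^ d"
  have P: "0 \<le> P" and V: "0 \<le> V" using C h_pos by (auto simp: P_def V_def)
  note bm = bounded_measurable_integrable bounded_measurable_intros
    bounded_measurable_spline bounded_measurable_box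
  have "(\<Sum>j<m^d. (c j)\<^sup>2 * (\<integral>x. (B j x)\<^sup>2 \<partial>\<mu>)) \<le>
      (\<Sum>j<m^d. (P * (\<integral>x. indicator (supp_box j) x * (spline c x)\<^sup>2 \<partial>\<mu>)) * V)"
    using coefficient_bound[OF C dual] integral_square_tensor_bspline_le P
    by (intro sum_mono mult_mono) (auto simp: P_def V_def intro!: mult_nonneg_nonneg integral_nonneg_AE)
  also have "\<dots> = P * V * (\<Sum>j<m^d. \<integral>x. indicator (supp_box j) x * (spline c x)\<^sup>2 \<partial>\<mu>)"
    by (simp add: sum_distrib_left mult_ac)
  also have "(\<Sum>j<m^d. \<integral>x. indicator (supp_box j) x * (spline c x)\<^sup>2 \<partial>\<mu>) =
      (\<integral>x. (\<Sum>j<m^d. indicator (supp_box j) x * (spline c x)\<^sup>2) \<partial>\<mu>)"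
    by (rule Bochner_Integration.integral_sum[symmetric]) (intro bm)
  also have "\<dots> \<le> (\<integral>x. (real p + 1) ^ d * (spline c x)\<^sup>2 \<partial>\<mu>)"
  proof (rule integral_mono)
    fix x
    show "(\<Sum>j<m^d. indicator (supp_box j) x * (spline c x)\<^sup>2) \<le> (real p + 1) ^ d * (spline c x)\<^sup>2"
      unfolding sum_distrib_right[symmetric] by (intro mult_right_mono sum_indicator_box_le) auto
  qed (intro bm)+
  also have "\<dots> = (real p + 1) ^ d * (\<integral>x. (spline c x)\<^sup>2 \<partial>\<mu>)" by simp
  finally have "(\<Sum>j<m^d. (c j)\<^sup>2 * (\<integral>x. (B j x)\<^sup>2 \<partial>\<mu>)) \<le>
      P * V * (real p + 1) ^ d * (\<integral>x. (spline c x)\<^sup>2 \<partial>\<mu>)"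
    using P V by (simp add: mult_left_mono mult.assoc)
  also have "P * V * (real p + 1) ^ d = ((C / h)\<^sup>2 * ((real p + 1) * h) * (4 ^ p * ((real p + 1) * h)) * (real p + 1)) ^ d"
    by (simp add: P_def V_def power_mult_distrib)
  also have "(C / h)\<^sup>2 * ((real p + 1) * h) * (4 ^ p * ((real p + 1) * h)) * (real p + 1) = C\<^sup>2 * (real p + 1) ^ 3 * 4 ^ p"
    using h_pos by (simp add: power2_eq_square power3_eq_cube)
  finally show ?thesis .
qed

text \<open>
  Apply \<open>coefficient_bound\<close> to the spline \<open>B\<^sub>j\<close> itself.
\<close>

lemma integral_square_tensor_bspline_pos:
  assumes C: "0 < C" and dual: "has_dual_bound C" and j: "j < m^d"
  shows "0 < (\<integral>x. (B j x)\<^sup>2 \<partial>\<mu>)"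
proof -
  define c where "c = (\<lambda>i. if i = j then 1 else 0 :: real)"
  have "spline c x = B j x" for x
  proof -
    have "spline c x = (\<Sum>i<m^d. if i = j then B i x else 0)"
      unfolding spline_def c_def by (intro sum.cong) auto
    thus ?thesis using j by simp
  qed
  hence "indicator (supp_box j) x * (spline c x)\<^sup>2 = (B j x)\<^sup>2" for x
    using tensor_bspline_eq_0[of x j] by (cases "x \<in> supp_box j") auto
  hence "1 \<le> ((C / h)\<^sup>2 * ((real p + 1) * h)) ^ d * (\<integral>x. (B j x)\<^sup>2 \<partial>\<mu>)"
    using coefficient_bound[OF C dual j, of c] by (simp add: c_def)
  moreover have "0 \<le> (\<integral>x. (B j x)\<^sup>2 \<partial>\<mu>)" by (rule integral_nonneg_AE) auto
  moreover have "(\<integral>x. (B j x)\<^sup>2 \<partial>\<mu>) \<noteq> 0" using calculation(1) by auto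
  ultimately show ?thesis by linarith
qed

end

section \<open>Mass matrices and the effect of the weight\<close>

text \<open>
  The product \<open>s t\<close> lies between \<open>s\<^sup>2\<close> and \<open>t\<^sup>2\<close>.
\<close>

lemma abs_geometric_mean_diff_le:
  fixes s t w \<delta> :: real
  assumes "0 \<le> s" "0 \<le> t" "\<bar>w - s\<^sup>2\<bar> \<le> \<delta>" "\<bar>w - t\<^sup>2\<bar> \<le> \<delta>"
  shows "\<bar>w - s * t\<bar> \<le> \<delta>"
proof (cases "s \<le> t")
  case True
  have "s * s \<le> s * t" "s * t \<le> t * t" using True assms by (auto intro: mult_mono)
  thus ?thesis using assms(3,4) unfolding power2_eq_square by linarith
next
  case False
  have "t * t \<le> s * t" "s * t \<le> s * s" using False assms by (auto intro: mult_mono)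
  thus ?thesis using assms(3,4) unfolding power2_eq_square by linarith
qed

context tensor_splines
begin

abbreviation N :: nat where "N \<equiv> m ^ d"
abbreviation M :: "((nat \<Rightarrow> real) \<Rightarrow> real) \<Rightarrow> real mat" where "M \<equiv> mass_matrix d p m \<Xi>"

lemma N_pos: "0 < N"
  using m_pos by simp

lemma mass_matrix_carrier: "M w \<in> carrier_mat N N"
  by (simp add: mass_matrix_def)

lemma mass_matrix_entry:
  assumes "i < N" "j < N"
  shows "M w $$ (i,j) = (\<integral>x. B i x * B j x * w x \<partial>\<mu>)"
  using assms by (simp add: mass_matrix_def set_lebesgue_integral_open_unit_cube del: One_nat_def)

lemma mass_matrix_symmetric: "transpose_mat (M w) = M w"
  by (rule eq_matI) (auto simp: mass_matrix_def set_lebesgue_integral_open_unit_cube mult_ac)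

lemma quadratic_form_mass_matrix:
  assumes w: "bounded_measurable d w" and v: "v \<in> carrier_vec N"
  shows "v \<bullet> (M w *\<^sub>v v) = (\<integral>x. w x * (spline (\<lambda>i. v $ i) x)\<^sup>2 \<partial>\<mu>)"
proof -
  have "(M w *\<^sub>v v) $ i = (\<Sum>j<N. M w $$ (i,j) * v $ j)" if "i < N" for i
    using that v mass_matrix_carrier[of w] by (auto simp: scalar_prod_def atLeast0LessThan intro!: sum.cong)
  hence "v \<bullet> (M w *\<^sub>v v) = (\<Sum>i<N. \<Sum>j<N. v $ i * (M w $$ (i,j) * v $ j))"
    using v mass_matrix_carrier[of w]
    by (simp add: scalar_prod_def atLeast0LessThan sum_distrib_left)
  also have "\<dots> = (\<Sum>i<N. \<Sum>j<N. \<integral>x. v $ i * v $ j * (B i x * B j x * w x) \<partial>\<mu>)"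
  proof (intro sum.cong refl)
    fix i j assume "i \<in> {..<N}" "j \<in> {..<N}"
    hence ij: "i < N" "j < N" by auto
    show "v $ i * (M w $$ (i,j) * v $ j) = (\<integral>x. v $ i * v $ j * (B i x * B j x * w x) \<partial>\<mu>)"
      unfolding mass_matrix_entry[OF ij] integral_mult_right_zero by (simp only: mult_ac)
  qed
  also have "\<dots> = (\<integral>x. (\<Sum>i<N. \<Sum>j<N. v $ i * v $ j * (B i x * B j x * w x)) \<partial>\<mu>)"
  proof -
    have int: "integrable \<mu> (\<lambda>x. v $ i * v $ j * (B i x * B j x * w x))" for i j
      by (intro bounded_measurable_integrable bounded_measurable_intros bounded_measurable_tensor_bspline w)
    show ?thesis
      by (subst Bochner_Integration.integral_sum, intro Bochner_Integration.integrable_sum int)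
        (intro sum.cong refl Bochner_Integration.integral_sum[symmetric] int)
  qed
  also have "\<dots> = (\<integral>x. w x * (spline (\<lambda>i. v $ i) x)\<^sup>2 \<partial>\<mu>)"
    by (intro Bochner_Integration.integral_cong refl)
      (simp add: spline_def power2_eq_square sum_product sum_distrib_left sum_distrib_right mult_ac)
  finally show ?thesis .
qed

text \<open>
  The diagonal entries of \<open>D\<^sup>1\<^sup>/\<^sup>2 D_hat\<^sup>-\<^sup>1\<^sup>/\<^sup>2\<close>.
\<close>

definition weight_scale :: "((nat \<Rightarrow> real) \<Rightarrow> real) \<Rightarrow> nat \<Rightarrow> real" where
  "weight_scale w i = sqrt ((\<integral>x. (B i x)\<^sup>2 * w x \<partial>\<mu>) / (\<integral>x. (B i x)\<^sup>2 \<partial>\<mu>))"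

lemma weighted_square_integral_pos:
  assumes w: "bounded_measurable d w" and lower: "0 < b" "\<And>x. x \<in> open_unit_cube d \<Longrightarrow> b \<le> w x"
    and pos: "0 < (\<integral>x. (B i x)\<^sup>2 \<partial>\<mu>)"
  shows "0 < (\<integral>x. (B i x)\<^sup>2 * w x \<partial>\<mu>)"
proof -
  have "0 < (\<integral>x. (B i x)\<^sup>2 \<partial>\<mu>) * b" using pos lower by simp
  also have "\<dots> = (\<integral>x. (B i x)\<^sup>2 * b \<partial>\<mu>)" by simp
  also have "\<dots> \<le> (\<integral>x. (B i x)\<^sup>2 * w x \<partial>\<mu>)"
  proof (rule integral_mono)
    fix x assume "x \<in> space \<mu>"
    thus "(B i x)\<^sup>2 * b \<le> (B i x)\<^sup>2 * w x"
      using lower by (intro mult_left_mono) (auto simp: space_cube_measure)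
  qed (intro bounded_measurable_integrable bounded_measurable_intros bounded_measurable_tensor_bspline w)+
  finally show ?thesis .
qed

lemma precond_matrix_eq:
  assumes Dpos: "\<And>i. i < N \<Longrightarrow> 0 < (\<integral>x. (B i x)\<^sup>2 * w x \<partial>\<mu>)"
    and pos: "\<And>i. i < N \<Longrightarrow> 0 < (\<integral>x. (B i x)\<^sup>2 \<partial>\<mu>)"
  shows "precond_matrix d p m \<Xi> w = mat_diag N (weight_scale w) * M (\<lambda>_. 1) * transpose_mat (mat_diag N (weight_scale w))"
proof -
  define D where "D = (\<lambda>i. \<integral>x. (B i x)\<^sup>2 * w x \<partial>\<mu>)"
  define Dh where "Dh = (\<lambda>i. \<integral>x. (B i x)\<^sup>2 \<partial>\<mu>)"
  have dp: "diag_part (M w) = mat_diag N D"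
    by (rule eq_matI) (auto simp: diag_part_def mat_diag_def mass_matrix_entry D_def power2_eq_square
        mass_matrix_carrier[THEN carrier_matD(1)])
  have dph: "diag_part (M (\<lambda>_. 1)) = mat_diag N Dh"
    by (rule eq_matI) (auto simp: diag_part_def mat_diag_def mass_matrix_entry Dh_def power2_eq_square
        mass_matrix_carrier[THEN carrier_matD(1)])
  have sc: "weight_scale w i = sqrt (D i) * (1 / sqrt (Dh i))" for i
    by (simp add: weight_scale_def D_def Dh_def real_sqrt_divide)
  have tr: "transpose_mat (mat_diag N f) = mat_diag N f" for f :: "nat \<Rightarrow> real"
    by (rule eq_matI) (auto simp: mat_diag_def)
  define X where "X = mat_diag N (\<lambda>i. sqrt (D i))"
  define Y where "Y = mat_diag N (\<lambda>i. 1 / sqrt (Dh i))"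
  have XY: "X \<in> carrier_mat N N" "Y \<in> carrier_mat N N" by (simp_all add: X_def Y_def)
  have "X * Y = mat_diag N (weight_scale w)" "Y * X = mat_diag N (weight_scale w)"
    by (simp_all add: X_def Y_def sc[abs_def] mult.commute)
  moreover have "precond_matrix d p m \<Xi> w = X * Y * M (\<lambda>_. 1) * Y * X"
    unfolding precond_matrix_def Let_def dp dph X_def Y_def
    using spd_sqrt_mat_diag[of N D] spd_inv_sqrt_mat_diag[of N Dh] Dpos pos
    by (simp add: D_def Dh_def)
  moreover have "X * Y * M (\<lambda>_. 1) * Y * X = (X * Y) * M (\<lambda>_. 1) * (Y * X)"
    using XY mass_matrix_carrier[of "\<lambda>_. 1"] by (simp add: assoc_mult_mat[of _ N N _ N _ N])
  ultimately show ?thesis by (simp add: tr)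
qed

lemma spd_mass_matrix_unweighted:
  assumes C: "0 < C" and dual: "has_dual_bound C"
  shows "spd N (M (\<lambda>_. 1))"
  unfolding spd_def
proof (intro conjI ballI impI mass_matrix_carrier mass_matrix_symmetric)
  fix v :: "real vec" assume v: "v \<in> carrier_vec N" "v \<noteq> 0\<^sub>v N"
  then obtain i where i: "i < N" "v $ i \<noteq> 0"
    by (metis carrier_vecD eq_vecI index_zero_vec(1) index_zero_vec(2))
  have pos: "0 < (\<integral>x. (B j x)\<^sup>2 \<partial>\<mu>)" if "j < N" for j
    by (rule integral_square_tensor_bspline_pos[OF C dual that])
  have "0 < (\<Sum>j<N. (v $ j)\<^sup>2 * (\<integral>x. (B j x)\<^sup>2 \<partial>\<mu>))"
  proof (rule sum_pos2[of _ i])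
    show "0 < (v $ i)\<^sup>2 * (\<integral>x. (B i x)\<^sup>2 \<partial>\<mu>)" using i pos by simp
    show "0 \<le> (v $ j)\<^sup>2 * (\<integral>x. (B j x)\<^sup>2 \<partial>\<mu>)" if "j \<in> {..<N}" for j
      using pos[of j] that by simp
  qed (use i in auto)
  also have "\<dots> \<le> (C\<^sup>2 * (real p + 1) ^ 3 * 4 ^ p) ^ d * (\<integral>x. (spline (\<lambda>i. v $ i) x)\<^sup>2 \<partial>\<mu>)"
    by (rule l2_stability[OF C dual])
  finally have "(\<integral>x. (spline (\<lambda>i. v $ i) x)\<^sup>2 \<partial>\<mu>) \<noteq> 0" by auto
  moreover have "0 \<le> (\<integral>x. (spline (\<lambda>i. v $ i) x)\<^sup>2 \<partial>\<mu>)" by (rule integral_nonneg_AE) auto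
  ultimately have "0 < (\<integral>x. (spline (\<lambda>i. v $ i) x)\<^sup>2 \<partial>\<mu>)" by linarith
  thus "0 < v \<bullet> (M (\<lambda>_. 1) *\<^sub>v v)"
    unfolding quadratic_form_mass_matrix[OF bounded_measurable_const v(1)] mult_1_left .
qed

text \<open>
  The square of the scale is the mean of \<open>w\<close> with respect to the density \<open>B\<^sub>i\<^sup>2\<close>, and the support of \<open>B\<^sub>i\<close> has
  side lengths at most \<open>(p + 1) h\<close>.
\<close>

lemma weight_scale_close:
  assumes w: "bounded_measurable d w" and lower: "\<And>x. x \<in> open_unit_cube d \<Longrightarrow> 0 \<le> w x"
    and osc: "\<And>x y. x \<in> open_unit_cube d \<Longrightarrow> y \<in> open_unit_cube d \<Longrightarrow>
      (\<forall>k\<in>{1..d}. \<bar>x k - y k\<bar> \<le> (real p + 1) * h) \<Longrightarrow> \<bar>w x - w y\<bar> \<le> \<delta>"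
    and pos: "0 < (\<integral>x. (B i x)\<^sup>2 \<partial>\<mu>)"
    and x: "x \<in> open_unit_cube d" "x \<in> supp_box i"
  shows "\<bar>w x - (weight_scale w i)\<^sup>2\<bar> \<le> \<delta>"
proof -
  note bm = bounded_measurable_integrable bounded_measurable_intros bounded_measurable_tensor_bspline w
  have near: "\<bar>w x - w y\<bar> \<le> \<delta>" if y: "y \<in> open_unit_cube d" "y \<in> supp_box i" for y
  proof (rule osc[OF x(1) y(1)], intro ballI)
    fix k assume k: "k \<in> {1..d}"
    have "\<Xi> k (multi_index m i k + p + 1) - \<Xi> k (multi_index m i k) \<le> (real p + 1) * h"
      by (rule support_width_le[OF k multi_index_range[OF m_pos]])
    thus "\<bar>x k - y k\<bar> \<le> (real p + 1) * h"
    proof -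
      have "\<Xi> k (multi_index m i k) \<le> z k \<and> z k < \<Xi> k (multi_index m i k + p + 1)" if "z \<in> supp_box i" for z
        using that k by (simp add: supp_box_def)
      from this[OF x(2)] this[OF y(2)] show ?thesis
        using \<open>\<Xi> k (multi_index m i k + p + 1) - \<Xi> k (multi_index m i k) \<le> (real p + 1) * h\<close> by linarith
    qed
  qed
  define I where "I = (\<integral>x. (B i x)\<^sup>2 \<partial>\<mu>)"
  define J where "J = (\<integral>x. (B i x)\<^sup>2 * w x \<partial>\<mu>)"
  have I: "0 < I" using pos by (simp add: I_def)
  have J: "0 \<le> J" unfolding J_def
    using lower by (intro integral_nonneg_AE AE_I2) (auto simp: space_cube_measure)
  have "\<bar>w x * I - J\<bar> = \<bar>\<integral>y. (B i y)\<^sup>2 * (w x - w y) \<partial>\<mu>\<bar>"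
  proof -
    have "(\<integral>y. (B i y)\<^sup>2 * (w x - w y) \<partial>\<mu>) = (\<integral>y. w x * (B i y)\<^sup>2 - (B i y)\<^sup>2 * w y \<partial>\<mu>)"
      by (simp add: algebra_simps)
    also have "\<dots> = (\<integral>y. w x * (B i y)\<^sup>2 \<partial>\<mu>) - J"
      unfolding J_def by (rule Bochner_Integration.integral_diff) (intro bm)+
    finally show ?thesis by (simp add: I_def)
  qed
  also have "\<dots> \<le> (\<integral>y. \<bar>(B i y)\<^sup>2 * (w x - w y)\<bar> \<partial>\<mu>)" by (rule integral_abs_bound)
  also have "\<dots> \<le> (\<integral>y. \<delta> * (B i y)\<^sup>2 \<partial>\<mu>)"
  proof (rule integral_mono)
    fix y assume "y \<in> space \<mu>"
    hence y: "y \<in> open_unit_cube d" by (simp add: space_cube_measure)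
    show "\<bar>(B i y)\<^sup>2 * (w x - w y)\<bar> \<le> \<delta> * (B i y)\<^sup>2"
    proof (cases "y \<in> supp_box i")
      case True
      thus ?thesis using mult_left_mono[OF near[OF y], of "(B i y)\<^sup>2"] by (simp add: abs_mult mult.commute)
    next
      case False
      thus ?thesis by (simp add: tensor_bspline_eq_0)
    qed
  qed (intro bm)+
  also have "\<dots> = \<delta> * I" by (simp add: I_def)
  finally have "\<bar>w x * I - J\<bar> \<le> \<delta> * I" .
  moreover have "w x - J / I = (w x * I - J) / I" using I by (simp add: field_simps)
  ultimately have "\<bar>w x - J / I\<bar> \<le> \<delta>" using I by (simp add: abs_divide pos_divide_le_eq)
  moreover have "(weight_scale w i)\<^sup>2 = J / I"
    using I J by (simp add: weight_scale_def I_def[symmetric] J_def[symmetric])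
  ultimately show ?thesis by simp
qed

text \<open>
  Expand both forms into double sums over the basis. The summand with indices \<open>i\<close>, \<open>j\<close> carries the factor
  \<open>w x - s\<^sub>i s\<^sub>j\<close>, at most \<open>\<delta>\<close> in absolute value where the summand does not vanish. Absolute values are then harmless, because
  the remaining sum is controlled by the squares of the coefficients and hence, by stability, by the spline itself.
\<close>

lemma weighted_norm_perturbation:
  assumes C: "0 < C" and dual: "has_dual_bound C"
    and w: "bounded_measurable d w" and b: "0 < b" "\<And>x. x \<in> open_unit_cube d \<Longrightarrow> b \<le> w x"
    and osc: "\<And>x y. x \<in> open_unit_cube d \<Longrightarrow> y \<in> open_unit_cube d \<Longrightarrow>
      (\<forall>k\<in>{1..d}. \<bar>x k - y k\<bar> \<le> (real p + 1) * h) \<Longrightarrow> \<bar>w x - w y\<bar> \<le> \<delta>"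
    and \<delta>: "0 \<le> \<delta>"
  shows "\<bar>(\<integral>x. w x * (spline c x)\<^sup>2 \<partial>\<mu>) - (\<integral>x. (spline (\<lambda>i. weight_scale w i * c i) x)\<^sup>2 \<partial>\<mu>)\<bar> \<le>
    \<delta> * ((real p + 1) ^ d * (C\<^sup>2 * (real p + 1) ^ 3 * 4 ^ p) ^ d / b) * (\<integral>x. w x * (spline c x)\<^sup>2 \<partial>\<mu>)"
proof -
  note bm = bounded_measurable_integrable bounded_measurable_intros bounded_measurable_tensor_bspline
    bounded_measurable_spline w
  define s where "s = weight_scale w"
  define K where "K = (C\<^sup>2 * (real p + 1) ^ 3 * 4 ^ p) ^ d"
  have K: "0 \<le> K" by (simp add: K_def)
  have w0: "0 \<le> w x" if "x \<in> open_unit_cube d" for x using b(2)[OF that] b(1) by linarith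
  have s0: "0 \<le> s i" for i
  proof -
    have "0 \<le> (\<integral>x. (B i x)\<^sup>2 * w x \<partial>\<mu>)"
      by (intro integral_nonneg_AE AE_I2 mult_nonneg_nonneg w0) (auto simp: space_cube_measure)
    moreover have "0 \<le> (\<integral>x. (B i x)\<^sup>2 \<partial>\<mu>)" by (intro integral_nonneg_AE AE_I2) simp
    ultimately show ?thesis unfolding s_def weight_scale_def
      by (intro real_sqrt_ge_zero divide_nonneg_nonneg)
  qed
  have point: "\<bar>w x * (spline c x)\<^sup>2 - (spline (\<lambda>i. s i * c i) x)\<^sup>2\<bar> \<le>
      \<delta> * ((real p + 1) ^ d * (\<Sum>j<N. (c j)\<^sup>2 * (B j x)\<^sup>2))" if x: "x \<in> open_unit_cube d" for x
  proof -
    have "w x * (spline c x)\<^sup>2 = (\<Sum>i<N. \<Sum>j<N. (c i * B i x) * (c j * B j x) * w x)"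
      by (simp add: spline_def power2_eq_square sum_product sum_distrib_left mult_ac)
    moreover have "(spline (\<lambda>i. s i * c i) x)\<^sup>2 = (\<Sum>i<N. \<Sum>j<N. (c i * B i x) * (c j * B j x) * (s i * s j))"
      by (simp add: spline_def power2_eq_square sum_product mult_ac)
    ultimately have eq: "w x * (spline c x)\<^sup>2 - (spline (\<lambda>i. s i * c i) x)\<^sup>2 =
        (\<Sum>i<N. \<Sum>j<N. (c i * B i x) * (c j * B j x) * (w x - s i * s j))"
      by (simp only: sum_subtractf[symmetric] right_diff_distrib)
    have "\<bar>w x * (spline c x)\<^sup>2 - (spline (\<lambda>i. s i * c i) x)\<^sup>2\<bar> \<le> (\<Sum>i<N. \<Sum>j<N. \<bar>(c i * B i x) * (c j * B j x) * (w x - s i * s j)\<bar>)"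
      unfolding eq by (rule order_trans[OF sum_abs sum_mono[OF sum_abs]])
    also have "\<dots> \<le> (\<Sum>i<N. \<Sum>j<N. (\<bar>c i\<bar> * B i x) * (\<bar>c j\<bar> * B j x) * \<delta>)"
    proof (intro sum_mono)
      fix i j assume ij: "i \<in> {..<N}" "j \<in> {..<N}"
      show "\<bar>(c i * B i x) * (c j * B j x) * (w x - s i * s j)\<bar> \<le> (\<bar>c i\<bar> * B i x) * (\<bar>c j\<bar> * B j x) * \<delta>"
      proof (cases "x \<in> supp_box i \<and> x \<in> supp_box j")
        case True
        have "\<bar>w x - (s l)\<^sup>2\<bar> \<le> \<delta>" if l: "l < N" "x \<in> supp_box l" for l
          unfolding s_def
        proof (rule weight_scale_close[OF w _ _ _ x l(2)])
          show "0 < (\<integral>x. (B l x)\<^sup>2 \<partial>\<mu>)" by (rule integral_square_tensor_bspline_pos[OF C dual l(1)])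
          fix y z assume "y \<in> open_unit_cube d" "z \<in> open_unit_cube d"
            "\<forall>k\<in>{1..d}. \<bar>y k - z k\<bar> \<le> (real p + 1) * h"
          thus "\<bar>w y - w z\<bar> \<le> \<delta>" by (rule osc)
        qed (rule w0)
        hence "\<bar>w x - s i * s j\<bar> \<le> \<delta>"
          using True ij s0 by (intro abs_geometric_mean_diff_le) auto
        moreover have "0 \<le> (\<bar>c i\<bar> * B i x) * (\<bar>c j\<bar> * B j x)"
          by (intro mult_nonneg_nonneg abs_ge_zero tensor_bspline_bounds(1))
        moreover have "\<bar>(c i * B i x) * (c j * B j x) * (w x - s i * s j)\<bar> =
            (\<bar>c i\<bar> * B i x) * (\<bar>c j\<bar> * B j x) * \<bar>w x - s i * s j\<bar>"
          using tensor_bspline_bounds(1)[of i x] tensor_bspline_bounds(1)[of j x] by (simp add: abs_mult)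
        ultimately show ?thesis by (simp only: mult_left_mono)
      next
        case False
        hence "B i x = 0 \<or> B j x = 0" using tensor_bspline_eq_0 by blast
        thus ?thesis by auto
      qed
    qed
    also have "\<dots> = \<delta> * (\<Sum>i<N. \<bar>c i\<bar> * B i x)\<^sup>2"
      by (simp add: power2_eq_square sum_product sum_distrib_left sum_distrib_right mult_ac)
    also have "\<dots> \<le> \<delta> * ((real p + 1) ^ d * (\<Sum>j<N. (c j)\<^sup>2 * (B j x)\<^sup>2))"
      by (intro mult_left_mono square_of_active_sum_le \<delta>)
    finally show ?thesis .
  qed
  have eq: "(\<integral>x. w x * (spline c x)\<^sup>2 \<partial>\<mu>) - (\<integral>x. (spline (\<lambda>i. s i * c i) x)\<^sup>2 \<partial>\<mu>) =
      (\<integral>x. w x * (spline c x)\<^sup>2 - (spline (\<lambda>i. s i * c i) x)\<^sup>2 \<partial>\<mu>)"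
    by (rule Bochner_Integration.integral_diff[symmetric]) (intro bm)+
  have "\<bar>(\<integral>x. w x * (spline c x)\<^sup>2 \<partial>\<mu>) - (\<integral>x. (spline (\<lambda>i. s i * c i) x)\<^sup>2 \<partial>\<mu>)\<bar> \<le> (\<integral>x. \<bar>w x * (spline c x)\<^sup>2 - (spline (\<lambda>i. s i * c i) x)\<^sup>2\<bar> \<partial>\<mu>)"
    unfolding eq by (rule integral_abs_bound)
  also have "\<dots> \<le> (\<integral>x. \<delta> * ((real p + 1) ^ d * (\<Sum>j<N. (c j)\<^sup>2 * (B j x)\<^sup>2)) \<partial>\<mu>)"
    by (rule integral_mono) ((intro bm)+, use point in \<open>auto simp: space_cube_measure\<close>)
  also have "\<dots> = \<delta> * ((real p + 1) ^ d * (\<Sum>j<N. (c j)\<^sup>2 * (\<integral>x. (B j x)\<^sup>2 \<partial>\<mu>)))"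
  proof -
    have "(\<integral>x. (\<Sum>j<N. (c j)\<^sup>2 * (B j x)\<^sup>2) \<partial>\<mu>) = (\<Sum>j<N. \<integral>x. (c j)\<^sup>2 * (B j x)\<^sup>2 \<partial>\<mu>)"
      by (rule Bochner_Integration.integral_sum) (intro bm)
    thus ?thesis by simp
  qed
  also have "\<dots> \<le> \<delta> * ((real p + 1) ^ d * (K * (\<integral>x. (spline c x)\<^sup>2 \<partial>\<mu>)))"
    unfolding K_def by (intro mult_left_mono l2_stability[OF C dual] \<delta>) auto
  also have "\<dots> \<le> \<delta> * ((real p + 1) ^ d * (K * ((\<integral>x. w x * (spline c x)\<^sup>2 \<partial>\<mu>) / b)))"
  proof (intro mult_left_mono \<delta> K)
    have "(\<integral>x. (spline c x)\<^sup>2 \<partial>\<mu>) * b = (\<integral>x. b * (spline c x)\<^sup>2 \<partial>\<mu>)" by simp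
    also have "\<dots> \<le> (\<integral>x. w x * (spline c x)\<^sup>2 \<partial>\<mu>)"
      by (rule integral_mono) ((intro bm)+, use b in \<open>auto simp: space_cube_measure intro!: mult_right_mono\<close>)
    finally show "(\<integral>x. (spline c x)\<^sup>2 \<partial>\<mu>) \<le> (\<integral>x. w x * (spline c x)\<^sup>2 \<partial>\<mu>) / b"
      using b by (simp add: pos_le_divide_eq)
  qed auto
  finally show ?thesis by (simp add: s_def K_def mult_ac)
qed

theorem cond_number_preconditioned_mass_matrix:
  assumes C: "0 < C" and dual: "has_dual_bound C"
    and w: "bounded_measurable d w" and b: "0 < b" "\<And>x. x \<in> open_unit_cube d \<Longrightarrow> b \<le> w x"
    and osc: "\<And>x y. x \<in> open_unit_cube d \<Longrightarrow> y \<in> open_unit_cube d \<Longrightarrow>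
      (\<forall>k\<in>{1..d}. \<bar>x k - y k\<bar> \<le> (real p + 1) * h) \<Longrightarrow> \<bar>w x - w y\<bar> \<le> \<delta>"
    and \<eta>: "\<eta> = \<delta> * ((real p + 1) ^ d * (C\<^sup>2 * (real p + 1) ^ 3 * 4 ^ p) ^ d / b)"
    and \<delta>: "0 \<le> \<delta>" "\<eta> < 1"
  shows "\<bar>cond_number (spd_inv_sqrt (precond_matrix d p m \<Xi> w) * M w * spd_inv_sqrt (precond_matrix d p m \<Xi> w)) - 1\<bar>
    \<le> 2 * \<eta> / (1 - \<eta>)"
proof -
  define P where "P = precond_matrix d p m \<Xi> w"
  define U where "U = mat_diag N (weight_scale w)"
  have pos: "0 < (\<integral>x. (B i x)\<^sup>2 \<partial>\<mu>)" if "i < N" for i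
    by (rule integral_square_tensor_bspline_pos[OF C dual that])
  have Dpos: "0 < (\<integral>x. (B i x)\<^sup>2 * w x \<partial>\<mu>)" if "i < N" for i
    by (rule weighted_square_integral_pos[OF w b pos[OF that]])
  have P: "P = U * M (\<lambda>_. 1) * transpose_mat U"
    unfolding P_def U_def by (rule precond_matrix_eq[OF Dpos pos])
  have U: "U \<in> carrier_mat N N" by (simp add: U_def)
  have s_pos: "0 < weight_scale w i" if "i < N" for i
    unfolding weight_scale_def using pos[OF that] Dpos[OF that] by simp
  have Uv: "(transpose_mat U *\<^sub>v v) $ i = weight_scale w i * v $ i" if "v \<in> carrier_vec N" "i < N" for v i
  proof -
    have "(transpose_mat U *\<^sub>v v) $ i = (\<Sum>j<N. (if j = i then weight_scale w i else 0) * v $ j)"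
      using that by (auto simp: U_def mat_diag_def scalar_prod_def atLeast0LessThan intro!: sum.cong)
    also have "\<dots> = (\<Sum>j<N. if j = i then weight_scale w i * v $ j else 0)" by (intro sum.cong) auto
    finally show ?thesis using that by simp
  qed
  have spdP: "spd N P"
    unfolding P
  proof (rule spd_congruence[OF spd_mass_matrix_unweighted[OF C dual] U])
    fix v :: "real vec" assume v: "v \<in> carrier_vec N" "transpose_mat U *\<^sub>v v = 0\<^sub>v N"
    have "v $ i = 0" if "i < N" for i
      using Uv[OF v(1) that] v(2) s_pos[OF that] that by simp
    thus "v = 0\<^sub>v N" using v(1) by (intro eq_vecI) auto
  qed
  have "\<bar>cond_number (spd_inv_sqrt P * M w * spd_inv_sqrt P) - 1\<bar> \<le> 2 * \<eta> / (1 - \<eta>)"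
  proof (rule cond_number_preconditioned[OF spdP mass_matrix_carrier mass_matrix_symmetric N_pos])
    show "0 \<le> \<eta>" using \<delta> b by (simp add: \<eta>)
    fix v :: "real vec" assume v: "v \<in> carrier_vec N"
    have Uvc: "transpose_mat U *\<^sub>v v \<in> carrier_vec N" using U v by simp
    have "v \<bullet> (P *\<^sub>v v) = (\<integral>x. 1 * (spline (\<lambda>i. (transpose_mat U *\<^sub>v v) $ i) x)\<^sup>2 \<partial>\<mu>)"
      unfolding P quadratic_form_congruence[OF mass_matrix_carrier U v]
      by (rule quadratic_form_mass_matrix[OF bounded_measurable_const Uvc])
    also have "\<dots> = (\<integral>x. (spline (\<lambda>i. weight_scale w i * v $ i) x)\<^sup>2 \<partial>\<mu>)"
      using Uv[OF v] by (simp add: spline_def)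
    finally have quadP: "v \<bullet> (P *\<^sub>v v) = (\<integral>x. (spline (\<lambda>i. weight_scale w i * v $ i) x)\<^sup>2 \<partial>\<mu>)" .
    show "\<bar>v \<bullet> (M w *\<^sub>v v) - v \<bullet> (P *\<^sub>v v)\<bar> \<le> \<eta> * (v \<bullet> (M w *\<^sub>v v))"
      unfolding quadP quadratic_form_mass_matrix[OF w v] \<eta>
      by (rule weighted_norm_perturbation[OF C dual w b osc \<delta>(1)])
  qed (rule \<delta>)
  thus ?thesis by (simp add: P_def)
qed

end

section \<open>Continuous weights on the closed cube\<close>

text \<open>
  Outside the directions \<open>{1..d}\<close> the points of the cube are constant, so the cube is a product of compact sets
  over all indices.
\<close>

lemma compact_unit_cube: "compact (unit_cube d)"
proof -
  have "unit_cube d = PiE UNIV (\<lambda>i. if i \<in> {1..d} then {0..1} else {undefined})"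
    by (auto simp: unit_cube_def PiE_iff extensional_def split: if_splits)
  moreover have "compactin (product_topology (\<lambda>_. euclidean) UNIV)
      (PiE UNIV (\<lambda>i. if i \<in> {1..d} then {0..1::real} else {undefined}))"
    unfolding compactin_PiE by (auto simp: compactin_euclidean_iff)
  ultimately show ?thesis by (simp add: euclidean_product_topology compactin_euclidean_iff)
qed

lemma open_unit_cube_subset: "open_unit_cube d \<subseteq> unit_cube d"
  by (auto simp: open_unit_cube_def unit_cube_def PiE_iff less_imp_le)

text \<open>
  The metric of the product topology is bounded by twice the largest difference of finitely many
  coordinates plus a tail \<open>(1/2)\<^sup>n\<close>, so closeness in all coordinates implies closeness in the metric.
\<close>

lemma unit_cube_uniformly_continuous:
  assumes cont: "continuous_on (unit_cube d) \<omega>" and \<delta>: "0 < (\<delta> :: real)"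
  obtains r where "0 < r"
    "\<And>x y. x \<in> unit_cube d \<Longrightarrow> y \<in> unit_cube d \<Longrightarrow> (\<forall>k\<in>{1..d}. \<bar>x k - y k\<bar> \<le> r) \<Longrightarrow> \<bar>\<omega> x - \<omega> y\<bar> \<le> \<delta>"
proof -
  have "uniformly_continuous_on (unit_cube d) \<omega>"
    by (rule compact_uniformly_continuous[OF cont compact_unit_cube])
  then obtain e where e: "0 < e"
    "\<And>x y. x \<in> unit_cube d \<Longrightarrow> y \<in> unit_cube d \<Longrightarrow> dist y x < e \<Longrightarrow> dist (\<omega> y) (\<omega> x) < \<delta>"
    unfolding uniformly_continuous_on_def using \<delta> by blast
  obtain n :: nat where n: "(1/2) ^ n < e / 2"
    using real_arch_pow_inv[of "e/2" "1/2"] e(1) by auto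
  show ?thesis
  proof (rule that[of "e / 4"])
    show "0 < e / 4" using e(1) by simp
    fix x y :: "nat \<Rightarrow> real" assume xy: "x \<in> unit_cube d" "y \<in> unit_cube d" "\<forall>k\<in>{1..d}. \<bar>x k - y k\<bar> \<le> e / 4"
    have coord: "dist (y k) (x k) \<le> e / 4" for k
    proof (cases "k \<in> {1..d}")
      case True
      thus ?thesis using xy(3) by (auto simp: dist_real_def abs_minus_commute)
    next
      case False
      hence "x k = y k" using xy(1,2) by (auto simp: unit_cube_def PiE_iff extensional_def)
      thus ?thesis using e(1) by simp
    qed
    have "Max {dist (y (from_nat i)) (x (from_nat i)) |i. i \<le> n} \<le> e / 4"
    proof (rule Max.boundedI)
      have "{dist (y (from_nat i)) (x (from_nat i)) |i. i \<le> n} = (\<lambda>i. dist (y (from_nat i)) (x (from_nat i))) ` {..n}"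
        by auto
      thus "finite {dist (y (from_nat i)) (x (from_nat i)) |i. i \<le> n}" by simp
    qed (use coord in auto)
    hence "dist y x < e"
      using dist_fun_le_dist_first_terms[of y x n] n by linarith
    thus "\<bar>\<omega> x - \<omega> y\<bar> \<le> \<delta>"
      using e(2)[OF xy(1,2)] by (simp add: dist_real_def abs_minus_commute)
  qed
qed

lemma measurable_cube_measure_borel: "(\<lambda>x. x) \<in> borel_measurable (cube_measure d)"
proof (rule measurable_coordinatewise_then_product)
  fix i :: nat
  show "(\<lambda>x. x i) \<in> borel_measurable (cube_measure d)"
  proof (cases "i \<in> {1..d}")
    case True
    thus ?thesis by (rule measurable_component_cube)
  next
    case False
    have "(\<lambda>x. x i) \<in> borel_measurable (cube_measure d) \<longleftrightarrow> (\<lambda>x. undefined :: real) \<in> borel_measurable (cube_measure d)"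
      by (rule measurable_cong) (use False in \<open>auto simp: space_cube_measure open_unit_cube_def PiE_iff extensional_def\<close>)
    thus ?thesis by simp
  qed
qed

lemma bounded_measurable_continuous:
  assumes cont: "continuous_on (unit_cube d) \<omega>"
  shows "bounded_measurable d \<omega>"
proof -
  have "bounded (\<omega> ` unit_cube d)"
    by (rule compact_imp_bounded[OF compact_continuous_image[OF cont compact_unit_cube]])
  then obtain K where "\<forall>y\<in>\<omega> ` unit_cube d. norm y \<le> K" unfolding bounded_iff by (rule exE)
  hence K: "\<And>x. x \<in> unit_cube d \<Longrightarrow> \<bar>\<omega> x\<bar> \<le> K" by simp
  have "\<omega> \<in> borel_measurable (restrict_space borel (unit_cube d))"
    by (rule borel_measurable_continuous_on_restrict[OF cont])
  moreover have "(\<lambda>x. x) \<in> measurable (cube_measure d) (restrict_space borel (unit_cube d))"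
    using open_unit_cube_subset
    by (intro measurable_restrict_space2 measurable_cube_measure_borel) (auto simp: space_cube_measure)
  ultimately have "\<omega> \<in> borel_measurable (cube_measure d)"
    by (rule measurable_compose[rotated])
  thus ?thesis
    using K open_unit_cube_subset by (intro bounded_measurableI[of _ _ K]) auto
qed

lemma unit_cube_positive_lower_bound:
  assumes "continuous_on (unit_cube d) \<omega>" "\<And>x. x \<in> unit_cube d \<Longrightarrow> 0 < (\<omega> x :: real)"
  obtains b where "0 < b" "\<And>x. x \<in> unit_cube d \<Longrightarrow> b \<le> \<omega> x"
proof -
  have "(\<lambda>i\<in>{1..d}. 0) \<in> unit_cube d" by (auto simp: unit_cube_def)
  hence "unit_cube d \<noteq> {}" by blast
  then obtain x where "x \<in> unit_cube d" "\<forall>y\<in>unit_cube d. \<omega> x \<le> \<omega> y"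
    using continuous_attains_inf[OF compact_unit_cube _ assms(1)] by blast
  thus ?thesis using assms(2) that[of "\<omega> x"] by blast
qed

section \<open>Convergence of the condition number\<close>

theorem theorem2:
  fixes d p :: nat and \<alpha> :: real and \<omega> :: "(nat \<Rightarrow> real) \<Rightarrow> real"
  assumes "1 \<le> d" and "1 \<le> p" and "0 < \<alpha>"
    and "continuous_on (unit_cube d) \<omega>"
    and "\<And>x. x \<in> unit_cube d \<Longrightarrow> 0 < \<omega> x"
  shows "\<forall>\<epsilon>>0. \<exists>h\<^sub>0>0. \<forall>m \<Xi>.
    (\<forall>k\<in>{1..d}. open_knot_vector m p (\<Xi> k)) \<and> quasi_uniform \<alpha> d p m \<Xi> \<and>
    mesh_size d p m \<Xi> < h\<^sub>0 \<longrightarrow>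
    \<bar>cond_number (spd_inv_sqrt (precond_matrix d p m \<Xi> \<omega>) * mass_matrix d p m \<Xi> \<omega> *
       spd_inv_sqrt (precond_matrix d p m \<Xi> \<omega>)) - 1\<bar> < \<epsilon>"
proof (intro allI impI)
  fix \<epsilon> :: real assume \<epsilon>: "0 < \<epsilon>"
  obtain C where C: "0 < C" and dual: "\<forall>m \<xi> h. open_knot_vector m p \<xi> \<and> 0 < h \<and>
      (\<forall>l\<in>{1..m+p}. \<xi> (l+1) - \<xi> l \<le> h) \<and>
      (\<forall>l\<in>{1..m+p}. \<xi> l < \<xi> (l+1) \<longrightarrow> \<alpha> * h \<le> \<xi> (l+1) - \<xi> l) \<longrightarrow>
      (\<forall>i\<in>{1..m}. \<exists>\<psi>. \<psi> \<in> borel_measurable borel \<and>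
        (\<forall>x. \<bar>\<psi> x\<bar> \<le> C / h * indicator ({\<xi> i..<\<xi> (i+p+1)} \<inter> {0<..<1}) x) \<and>
        (\<forall>j\<in>{1..m}. (\<integral>x. \<psi> x * bspline \<xi> p j x \<partial>lborel) = (if i = j then 1 else 0)))"
    using bspline_dual[OF \<open>0 < \<alpha>\<close>, of p] by (elim exE conjE) (rule that)
  obtain b where b: "0 < b" "\<And>x. x \<in> unit_cube d \<Longrightarrow> b \<le> \<omega> x"
    by (rule unit_cube_positive_lower_bound[OF assms(4,5)]) (assumption, rule that)
  \<comment> \<open>With this choice the final bound \<open>2 \<eta> / (1 - \<eta>)\<close> equals \<open>2 \<epsilon> / (2 + \<epsilon>) < \<epsilon>\<close>.\<close>
  define \<eta> where "\<eta> = \<epsilon> / (2 + 2 * \<epsilon>)"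
  have \<eta>: "0 < \<eta>" "\<eta> < 1" using \<epsilon> by (auto simp: \<eta>_def field_simps)
  define F where "F = (real p + 1) ^ d * (C\<^sup>2 * (real p + 1) ^ 3 * 4 ^ p) ^ d / b"
  have F: "0 < F" using C b(1) by (simp add: F_def)
  \<comment> \<open>The oscillation of the weight on a support that the stability constant turns into \<open>\<eta>\<close>.\<close>
  define \<delta> where "\<delta> = \<eta> / F"
  have \<delta>: "0 < \<delta>" using \<eta> F by (simp add: \<delta>_def)
  obtain r where r: "0 < r" "\<And>x y. x \<in> unit_cube d \<Longrightarrow> y \<in> unit_cube d \<Longrightarrow>
      (\<forall>k\<in>{1..d}. \<bar>x k - y k\<bar> \<le> r) \<Longrightarrow> \<bar>\<omega> x - \<omega> y\<bar> \<le> \<delta>"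
    by (rule unit_cube_uniformly_continuous[OF assms(4) \<delta>]) (rule that)
  show "\<exists>h\<^sub>0>0. \<forall>m \<Xi>.
    (\<forall>k\<in>{1..d}. open_knot_vector m p (\<Xi> k)) \<and> quasi_uniform \<alpha> d p m \<Xi> \<and>
    mesh_size d p m \<Xi> < h\<^sub>0 \<longrightarrow>
    \<bar>cond_number (spd_inv_sqrt (precond_matrix d p m \<Xi> \<omega>) * mass_matrix d p m \<Xi> \<omega> *
       spd_inv_sqrt (precond_matrix d p m \<Xi> \<omega>)) - 1\<bar> < \<epsilon>"
  proof (intro exI[of _ "r / (real p + 1)"] conjI allI impI)
    show "0 < r / (real p + 1)" using r(1) by simp
    fix m and \<Xi> :: "nat \<Rightarrow> nat \<Rightarrow> real"
    assume mesh: "(\<forall>k\<in>{1..d}. open_knot_vector m p (\<Xi> k)) \<and> quasi_uniform \<alpha> d p m \<Xi> \<and>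
      mesh_size d p m \<Xi> < r / (real p + 1)"
    interpret tensor_splines d p m \<Xi>
      by unfold_locales (use assms(1) mesh in auto)
    have "has_dual_bound C"
      unfolding has_dual_bound_def
    proof
      fix k assume k: "k \<in> {1..d}"
      have "\<forall>l\<in>{1..m+p}. \<Xi> k l < \<Xi> k (l+1) \<longrightarrow> \<alpha> * h \<le> \<Xi> k (l+1) - \<Xi> k l"
        using mesh k unfolding quasi_uniform_def by blast
      thus "\<forall>i\<in>{1..m}. \<exists>\<psi>. \<psi> \<in> borel_measurable borel \<and>
          (\<forall>x. \<bar>\<psi> x\<bar> \<le> C / h * indicator ({\<Xi> k i..<\<Xi> k (i+p+1)} \<inter> {0<..<1}) x) \<and>
          (\<forall>j\<in>{1..m}. (\<integral>x. \<psi> x * bspline (\<Xi> k) p j x \<partial>lborel) = (if i = j then 1 else 0))"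
        using knots[OF k] h_pos knot_gap_le[OF k] by (intro dual[THEN spec, THEN spec, THEN spec, THEN mp]) blast
    qed
    moreover have "\<bar>\<omega> x - \<omega> y\<bar> \<le> \<delta>"
      if "x \<in> open_unit_cube d" "y \<in> open_unit_cube d" "\<forall>k\<in>{1..d}. \<bar>x k - y k\<bar> \<le> (real p + 1) * h" for x y
    proof (rule r(2))
      have "(real p + 1) * h \<le> r" using mesh by (simp add: field_simps)
      thus "\<forall>k\<in>{1..d}. \<bar>x k - y k\<bar> \<le> r" using that(3) by force
    qed (use that open_unit_cube_subset in auto)
    moreover have "\<eta> = \<delta> * ((real p + 1) ^ d * (C\<^sup>2 * (real p + 1) ^ 3 * 4 ^ p) ^ d / b)"
      using F by (simp add: \<delta>_def flip: F_def)
    moreover have "b \<le> \<omega> x" if "x \<in> open_unit_cube d" for x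
      using that open_unit_cube_subset by (intro b(2)) auto
    ultimately have "\<bar>cond_number (spd_inv_sqrt (precond_matrix d p m \<Xi> \<omega>) * M \<omega> *
        spd_inv_sqrt (precond_matrix d p m \<Xi> \<omega>)) - 1\<bar> \<le> 2 * \<eta> / (1 - \<eta>)"
      using \<delta> \<eta>(2) b(1)
      by (intro cond_number_preconditioned_mass_matrix[OF C _ bounded_measurable_continuous[OF assms(4)]]) auto
    also have "2 * \<eta> / (1 - \<eta>) = 2 * \<epsilon> / (2 + \<epsilon>)"
    proof -
      have "1 - \<eta> = (2 + \<epsilon>) / (2 + 2 * \<epsilon>)" using \<epsilon> by (simp add: \<eta>_def field_simps)
      thus ?thesis using \<epsilon> by (simp add: \<eta>_def)
    qed
    also have "\<dots> < \<epsilon>" using \<epsilon> by (simp add: field_simps)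
    finally show "\<bar>cond_number (spd_inv_sqrt (precond_matrix d p m \<Xi> \<omega>) * mass_matrix d p m \<Xi> \<omega> *
       spd_inv_sqrt (precond_matrix d p m \<Xi> \<omega>)) - 1\<bar> < \<epsilon>" .
  qed
qed

end
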